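(* Let $\mathcal{H}$ and $\mathcal{U}$ be real Hilbert spaces, let $A:D(A)\subset\mathcal{H}\to\mathcal{H}$ generate a quasi-contractive $C_0$-semigroup $S(t)$ on $\mathcal{H}$, and let $L:\mathcal{U}\to\mathcal{H}$ be a bounded linear operator with adjoint $L^*$. Put $B=LL^*$ and $\mathcal{W}=\{x\in\mathcal{H}: L^*S(t)x=0\ \forall t\ge0\}$, let $P$ be the orthogonal projection of $\mathcal{H}$ onto $\mathcal{W}^\perp$ (along $\mathcal{W}$), and let $S_2(t)$ be the restriction of $S(t)$ to $\mathcal{W}$. Assume that: (i) $\mathcal{W}^{\perp}$ is invariant under $S(t)$ for all $t\ge0$; (ii) there is a function $\varphi:\mathcal{W}^{\perp}\cap D(A)\to\mathbb{R}^{+}$ such that $\langle Ay,By\rangle\le\varphi(y)\|By\|^2$ for all $y\in\mathcal{W}^{\perp}\cap D(A)$, and such that the mapping $\Upsilon:\mathcal{W}^{\perp}\cap D(A)\to\mathcal{H}$, $\Upsilon(y)=\varphi(y)By$, can be extended to a globally Lipschitz function on $\mathcal{W}^{\perp}$; (iii) there exists $\gamma>0$ such that $\gamma\langle Bx,x\rangle\le\|Bx\|^2$ for all $x\in\mathcal{W}^{\perp}$; (iv) there exists $\delta\ge0$ such that $S_2(t)=0$ for all $t\ge\delta$. Let $0<\mu<\frac12$. Then the linear system $$\frac{d}{dt}y(t)=Ay(t)+Lv(t),\quad t>0,\qquad y(0)=y_0,$$ is globally finite-time stable by the state feedback law $$v(t)=-\left(\frac{L^*Py(t)}{\|L^*Py(t)\|^{2\mu}}+\varphi(Py(t))\,L^*Py(t)\right)\mathbf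 1_{E_P}(y(t)),\qquad E_P=\{y\in\mathcal{H}: L^*Py\ne0\}.$$ Furthermore, writing $y_{01}=Py_0$, the settling time admits the estimate $$T^{*}\le\max\left(\delta,\ \frac{\|L^*y_{01}\|^{2\mu}}{2\gamma\mu}\right).$$
   Context: A $C_0$-semigroup with generator $A$ is quasi-contractive (of type $\omega$) if $\langle Ax,x\rangle\le\omega\|x\|^2$ for all $x\in D(A)$, for some $\omega\in\mathbb{R}$. The set $\mathcal{W}$ is a closed $S(t)$-invariant subspace; by (i), $P$ commutes with $S(t)$ and maps $D(A)$ into $D(A)\cap\mathcal{W}^\perp$, so the feedback makes sense for $y(t)\in D(A)$. $\mathbf 1_{E_P}$ is the indicator function of $E_P$ (so $v(t)=0$ when $L^*Py(t)=0$). Solutions are weak solutions: write the closed-loop equation as $\frac{d}{dt}y=G(y)$ (with $G$ defined on $D(A)$). For $f\in L^1(0,T;\mathcal{H})$, a strong solution of $\frac{d}{dt}y=G(y)+f$ on $[0,T]$ is a $y\in C([0,T],\mathcal{H})$, absolutely continuous on compact subsets of $(0,T)$, with $y(t)\in D(A)$ and the equation satisfied for a.e. $t\in(0,T)$; a weak solution of $\frac{d}{dt}y=G(y)$, $y(0)=y_0$, is a continuous $y:[0,\infty)\to\mathcal{H}$ with $y(0)=y_0$ which on each $[0,T]$ is the uniform limit of strong solutions $y_n$ of $\frac{d}{dt}y_n=G(y_n)+f_n$ with $f_n\to0$ in $L^1(0,T;\mathcal{H})$. Globally finite-time stable (by the given feedback) means: the closed-loop system is Lyapunov stable (at the origin)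 and, for every $y_0\in\mathcal{H}$, there is a finite time $T(y_0)$ such that the solution satisfies $y(t)=0$ for all $t\ge T(y_0)$. The settling time is $T^*=T^*(y_0)=\inf\{T\ge0: y(t)=0\ \forall t\ge T\}$. *)

theory Defs
  imports "HOL-Analysis.Analysis"
begin

text \<open>An unbounded operator is given by its domain, a set \<open>D\<close>, together with a total function
  whose values outside \<open>D\<close> are irrelevant.  Real Hilbert spaces are types of sort
  \<open>{real_inner, complete_space}\<close>; separability is not assumed.\<close>

section \<open>Semigroups\<close>

definition C0_semigroup :: "(real \<Rightarrow> 'h::real_normed_vector \<Rightarrow> 'h) \<Rightarrow> bool" where
  "C0_semigroup S \<longleftrightarrow>
     (\<forall>t\<ge>0. bounded_linear (S t)) \<and>
     (\<forall>x. S 0 x = x) \<and>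
     (\<forall>s\<ge>0. \<forall>t\<ge>0. \<forall>x. S (s + t) x = S s (S t x)) \<and>
     (\<forall>x. ((\<lambda>t. S t x) \<longlongrightarrow> x) (at_right 0))"

definition generates ::
  "'h::real_normed_vector set \<Rightarrow> ('h \<Rightarrow> 'h) \<Rightarrow> (real \<Rightarrow> 'h \<Rightarrow> 'h) \<Rightarrow> bool" where
  "generates D A S \<longleftrightarrow>
     C0_semigroup S \<and>
     D = {x. \<exists>l. ((\<lambda>h. (S h x - x) /\<^sub>R h) \<longlongrightarrow> l) (at_right 0)} \<and>
     (\<forall>x\<in>D. ((\<lambda>h. (S h x - x) /\<^sub>R h) \<longlongrightarrow> A x) (at_right 0))"

definition quasi_contractive :: "'h::real_inner set \<Rightarrow> ('h \<Rightarrow> 'h) \<Rightarrow> bool" where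
  "quasi_contractive D A \<longleftrightarrow> (\<exists>\<omega>. \<forall>x\<in>D. A x \<bullet> x \<le> \<omega> * (norm x)\<^sup>2)"

section \<open>The feedback law\<close>

definition orthogonal_projection :: "'h::real_inner set \<Rightarrow> 'h \<Rightarrow> 'h" where
  "orthogonal_projection M x = (THE p. p \<in> M \<and> x - p \<in> M\<^sup>\<bottom>)"

definition unobservable ::
  "(real \<Rightarrow> 'h::real_inner \<Rightarrow> 'h) \<Rightarrow> ('u::real_inner \<Rightarrow> 'h) \<Rightarrow> 'h set" where
  "unobservable S L = {x. \<forall>t\<ge>0. adjoint L (S t x) = 0}"

definition feedback ::
  "('u::real_inner \<Rightarrow> 'h::real_inner) \<Rightarrow> ('h \<Rightarrow> 'h) \<Rightarrow> ('h \<Rightarrow> real) \<Rightarrow> real \<Rightarrow> 'h \<Rightarrow> 'u" where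
  "feedback L P \<phi> \<mu> y =
     - (indicat_real {z. adjoint L (P z) \<noteq> 0} y *\<^sub>R
         (adjoint L (P y) /\<^sub>R (norm (adjoint L (P y)) powr (2 * \<mu>)) +
          \<phi> (P y) *\<^sub>R adjoint L (P y)))"

definition closed_loop :: "('h \<Rightarrow> 'h) \<Rightarrow> ('u \<Rightarrow> 'h) \<Rightarrow> ('h \<Rightarrow> 'u) \<Rightarrow> 'h \<Rightarrow> 'h::real_vector" where
  "closed_loop A L v y = A y + L (v y)"

section \<open>Strong and weak solutions\<close>

text \<open>The Bochner integral of the library requires a second countable codomain.  To cover
  non-separable Hilbert spaces, strong measurability is spelled out: \<open>f\<close> is almost everywhere
  the pointwise limit of simple functions.\<close>

definition strongly_measurable :: "'a measure \<Rightarrow> ('a \<Rightarrow> 'b::topological_space) \<Rightarrow> bool" where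
  "strongly_measurable M f \<longleftrightarrow>
     (\<exists>s. (\<forall>n. simple_function M (s n)) \<and> (AE t in M. (\<lambda>n::nat. s n t) \<longlonglongrightarrow> f t))"

definition L1_norm :: "real \<Rightarrow> (real \<Rightarrow> 'h::real_normed_vector) \<Rightarrow> ennreal" where
  "L1_norm T f = (\<integral>\<^sup>+ t. ennreal (norm (f t)) \<partial>lebesgue_on {0..T})"

definition in_L1 :: "real \<Rightarrow> (real \<Rightarrow> 'h::real_normed_vector) \<Rightarrow> bool" where
  "in_L1 T f \<longleftrightarrow> strongly_measurable (lebesgue_on {0..T}) f \<and> L1_norm T f < \<infinity>"

definition abs_continuous_on :: "real set \<Rightarrow> (real \<Rightarrow> 'a::metric_space) \<Rightarrow> bool" where
  "abs_continuous_on K f \<longleftrightarrow>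
     (\<forall>\<epsilon>>0. \<exists>\<delta>>0. \<forall>(n::nat) a b.
        (\<forall>i<n. a i \<in> K \<and> b i \<in> K \<and> a i \<le> b i) \<and>
        (\<forall>i<n. \<forall>j<n. i \<noteq> j \<longrightarrow> {a i<..<b i} \<inter> {a j<..<b j} = {}) \<and>
        (\<Sum>i<n. b i - a i) < \<delta> \<longrightarrow>
        (\<Sum>i<n. dist (f (a i)) (f (b i))) < \<epsilon>)"

definition strong_solution ::
  "'h::real_normed_vector set \<Rightarrow> ('h \<Rightarrow> 'h) \<Rightarrow> (real \<Rightarrow> 'h) \<Rightarrow> real \<Rightarrow> (real \<Rightarrow> 'h) \<Rightarrow> bool" where
  "strong_solution D G f T y \<longleftrightarrow>
     continuous_on {0..T} y \<and>
     (\<forall>K. compact K \<and> K \<subseteq> {0<..<T} \<longrightarrow> abs_continuous_on K y) \<and>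
     (AE t in lebesgue_on {0<..<T}.
        y t \<in> D \<and> (y has_vector_derivative (G (y t) + f t)) (at t))"

text \<open>Solutions live on \<open>{0..}\<close>; the values of \<open>y\<close> at negative times play no role.\<close>

definition weak_solution ::
  "'h::real_normed_vector set \<Rightarrow> ('h \<Rightarrow> 'h) \<Rightarrow> 'h \<Rightarrow> (real \<Rightarrow> 'h) \<Rightarrow> bool" where
  "weak_solution D G y0 y \<longleftrightarrow>
     continuous_on {0..} y \<and> y 0 = y0 \<and>
     (\<forall>T>0. \<exists>(Y :: nat \<Rightarrow> real \<Rightarrow> 'h) F.
        (\<forall>n. in_L1 T (F n) \<and> strong_solution D G (F n) T (Y n)) \<and>
        (\<lambda>n. L1_norm T (F n)) \<longlonglongrightarrow> 0 \<and>
        uniform_limit {0..T} Y y sequentially)"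

section \<open>Finite-time stability\<close>

definition well_posed :: "'h::real_normed_vector set \<Rightarrow> ('h \<Rightarrow> 'h) \<Rightarrow> bool" where
  "well_posed D G \<longleftrightarrow>
     (\<forall>y0. \<exists>y. weak_solution D G y0 y \<and>
        (\<forall>z. weak_solution D G y0 z \<longrightarrow> (\<forall>t\<ge>0. z t = y t)))"

definition lyapunov_stable :: "'h::real_normed_vector set \<Rightarrow> ('h \<Rightarrow> 'h) \<Rightarrow> bool" where
  "lyapunov_stable D G \<longleftrightarrow>
     (\<forall>\<epsilon>>0. \<exists>\<eta>>0. \<forall>y0 y. norm y0 < \<eta> \<and> weak_solution D G y0 y \<longrightarrow>
        (\<forall>t\<ge>0. norm (y t) < \<epsilon>))"

text \<open>Stability speaks of \<^emph>\<open>the\<close> solution starting at \<open>y0\<close>, hence well-posedness is part of it;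
  it also rules out that the conditions on solutions hold vacuously.\<close>

definition globally_finite_time_stable :: "'h::real_normed_vector set \<Rightarrow> ('h \<Rightarrow> 'h) \<Rightarrow> bool" where
  "globally_finite_time_stable D G \<longleftrightarrow>
     well_posed D G \<and> lyapunov_stable D G \<and>
     (\<forall>y0. \<exists>T\<ge>0. \<forall>y. weak_solution D G y0 y \<longrightarrow> (\<forall>t\<ge>T. y t = 0))"

text \<open>Meaningful only if \<open>y\<close> vanishes from some time on: \<open>Inf {}\<close> is unspecified on the reals.\<close>

definition settling_time :: "(real \<Rightarrow> 'h::zero) \<Rightarrow> real" where
  "settling_time y = Inf {T. 0 \<le> T \<and> (\<forall>t\<ge>T. y t = 0)}"

end

theory Submission
  imports Defs
begin

text \<open>On \<open>D\<close> the closed loop is \<open>A - F\<close> with \<open>F y = L (L' y / norm (L' y) powr (2 * \<mu>)) + \<Upsilon> (P y)\<close>,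
  where \<open>L'\<close> is the adjoint of \<open>L\<close>.  The first summand of \<open>F\<close> is monotone and the second Lipschitz, so
  strong solutions satisfy an energy estimate, which gives uniqueness; since \<open>F\<close> is moreover a uniform
  limit of Lipschitz maps, an explicit Euler scheme gives existence.  Along solutions \<open>q = (norm (L' y))\<^sup>2\<close>
  satisfies \<open>q' \<le> - 2 * \<gamma> * q powr (1 - \<mu>)\<close>, so the output \<open>L' y\<close> vanishes from the time
  \<open>norm (L' y0) powr (2 * \<mu>) / (2 * \<gamma> * \<mu>)\<close> on.  Afterwards \<open>F y = 0\<close>, hence \<open>y\<close> follows the
  semigroup with output zero and therefore lies in \<open>W\<close>, while its component in \<open>W\<close> is always
  \<open>S t\<close> applied to that of \<open>y0\<close>, which is zero for \<open>t \<ge> \<delta>\<close>.\<close>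

text \<open>The decay law has an explicit source. When \<open>q\<close> is differentiated, the term
  contributed by \<open>A\<close> is at most \<open>\<phi> (P y) * (norm (L (L' y)))\<^sup>2\<close>
  up to a factor 2, exactly what the \<open>\<Upsilon>\<close> part of the feedback subtracts; the
  remaining term becomes a power of \<open>q\<close> through \<open>\<gamma>\<close>. Formally
  \<open>(q powr \<mu>)' \<le> - 2 * \<gamma> * \<mu>\<close>, whence the time in the estimate. The
  condition \<mu> < 1/2 makes the singular feedback, of size
  \<open>norm (L' y) powr (1 - 2 * \<mu>)\<close>, vanish continuously with the output. The obstacle
  is that weak solutions need not lie in \<open>D\<close>, while the bound by \<open>\<phi>\<close>
  and the formula for \<open>\<Upsilon>\<close> are available only on \<open>D\<close>. Estimates
  are therefore made for strong solutions with forcing, and may depend on the forcing through its L1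
  norm alone. For existence, each Euler step solves the linear part exactly, so that the defect of
  the scheme is itself an admissible forcing.\<close>

section \<open>Hilbert space preliminaries\<close>

text \<open>The sort \<open>{real_inner, complete_space}\<close> is not below \<open>banach\<close>; this copy of a type is,
  which makes the library's theory of vector-valued integrals applicable.\<close>

typedef (overloaded) 'a banach_copy = "UNIV :: 'a::{real_normed_vector, complete_space} set"
  morphisms of_copy to_copy by simp

setup_lifting type_definition_banach_copy

instantiation banach_copy :: ("{real_normed_vector, complete_space}") real_vector
begin

lift_definition zero_banach_copy :: "'a banach_copy" is 0 .
lift_definition plus_banach_copy :: "'a banach_copy \<Rightarrow> 'a banach_copy \<Rightarrow> 'a banach_copy" is "(+)" .
lift_definition minus_banach_copy :: "'a banach_copy \<Rightarrow> 'a banach_copy \<Rightarrow> 'a banach_copy" is "(-)" .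
lift_definition uminus_banach_copy :: "'a banach_copy \<Rightarrow> 'a banach_copy" is "uminus" .
lift_definition scaleR_banach_copy :: "real \<Rightarrow> 'a banach_copy \<Rightarrow> 'a banach_copy" is "scaleR" .

instance
proof
  fix x y z :: "'a banach_copy" and a b :: real
  show "x + y + z = x + (y + z)" by transfer simp
  show "x + y = y + x" by transfer simp
  show "0 + x = x" by transfer simp
  show "- x + x = 0" by transfer simp
  show "x - y = x + - y" by transfer simp
  show "a *\<^sub>R (x + y) = a *\<^sub>R x + a *\<^sub>R y" by transfer (simp add: scaleR_add_right)
  show "(a + b) *\<^sub>R x = a *\<^sub>R x + b *\<^sub>R x" by transfer (simp add: scaleR_add_left)
  show "a *\<^sub>R b *\<^sub>R x = (a * b) *\<^sub>R x" by transfer simp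
  show "1 *\<^sub>R x = x" by transfer simp
qed

end

instantiation banach_copy :: ("{real_normed_vector, complete_space}") real_normed_vector
begin

lift_definition norm_banach_copy :: "'a banach_copy \<Rightarrow> real" is norm .

definition dist_banach_copy :: "'a banach_copy \<Rightarrow> 'a banach_copy \<Rightarrow> real" where
  "dist_banach_copy x y = norm (x - y)"

definition sgn_banach_copy :: "'a banach_copy \<Rightarrow> 'a banach_copy" where
  "sgn_banach_copy x = x /\<^sub>R norm x"

definition uniformity_banach_copy :: "('a banach_copy \<times> 'a banach_copy) filter" where
  "uniformity_banach_copy = (INF e\<in>{0<..}. principal {(x, y). dist x y < e})"

definition open_banach_copy :: "'a banach_copy set \<Rightarrow> bool" where
  "open_banach_copy U = (\<forall>x\<in>U. eventually (\<lambda>(x', y). x' = x \<longrightarrow> y \<in> U) uniformity)"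

instance
proof
  fix x y :: "'a banach_copy" and a :: real
  show "(norm x = 0) = (x = 0)" by transfer simp
  show "norm (x + y) \<le> norm x + norm y" by transfer (rule norm_triangle_ineq)
  show "norm (a *\<^sub>R x) = \<bar>a\<bar> * norm x" by transfer simp
qed (simp_all add: dist_banach_copy_def sgn_banach_copy_def uniformity_banach_copy_def
    open_banach_copy_def)

end

lemma bounded_linear_of_copy: "bounded_linear of_copy"
  by (rule bounded_linear_intro[where K = 1]; transfer; simp)

lemma dist_of_copy: "dist (of_copy x) (of_copy y) = dist x y"
  unfolding dist_norm by transfer simp

instance banach_copy :: ("{real_normed_vector, complete_space}") banach
proof
  fix X :: "nat \<Rightarrow> 'a banach_copy" assume "Cauchy X"
  then have "Cauchy (\<lambda>n. of_copy (X n))"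
    by (simp add: Cauchy_def dist_of_copy)
  then obtain l where l: "(\<lambda>n. of_copy (X n)) \<longlonglongrightarrow> l"
    using Cauchy_convergent_iff convergent_def by blast
  have "X \<longlonglongrightarrow> to_copy l"
    using l unfolding lim_sequentially
    by (metis UNIV_I dist_of_copy to_copy_inverse)
  then show "convergent X" by (auto simp: convergent_def)
qed

text \<open>The integral is formed in the copy and mapped back by the bounded linear
  \<open>of_copy\<close>. Basing it at \<open>0\<close> in both directions yields one antiderivative
  on the whole line.\<close>

lemma ex_antiderivative:
  fixes f :: "real \<Rightarrow> 'h::{real_normed_vector, complete_space}"
  assumes "continuous_on UNIV f"
  shows "\<exists>g. \<forall>t. (g has_vector_derivative f t) (at t)"
proof -
  define f' where "f' t = to_copy (f t)" for t
  have of_f': "of_copy (f' t) = f t" for t by (simp add: f'_def to_copy_inverse)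
  have "continuous_on S f'" for S
  proof -
    have "dist (f' x) (f' y) = dist (f x) (f y)" for x y
      by (metis dist_of_copy of_f')
    then show ?thesis
      using continuous_on_subset[OF assms, of S] by (simp add: continuous_on_iff)
  qed
  then have cont: "continuous_on {a..b} f'" for a b by blast
  define g where "g t = (if t \<ge> 0 then integral {0..t} f' else - integral {t..0} f')" for t
  have g: "g t = integral {a..t} f' - integral {a..0} f'" if "a \<le> t" "a \<le> 0" for a t
  proof (cases "t \<ge> 0")
    case True
    then show ?thesis
      using Henstock_Kurzweil_Integration.integral_combine[of a 0 t f']
        integrable_continuous_real[OF cont[of a t]] that
      by (simp add: g_def eq_diff_eq add.commute)
  next
    case False
    have "integral {a..t} f' + integral {t..0} f' = integral {a..0} f'"
      using False that integrable_continuous_real[OF cont[of a 0]]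
      by (intro Henstock_Kurzweil_Integration.integral_combine) auto
    then show ?thesis using False by (simp add: g_def flip: \<open>_ = integral {a..0} f'\<close>)
  qed
  have "((\<lambda>t. of_copy (g t)) has_vector_derivative f t) (at t)" for t
  proof -
    \<comment> \<open>With this base point \<open>0\<close> and \<open>t\<close> both lie to the
      right of \<open>a\<close>, and \<open>t\<close> is interior to \<open>{a..t+1}\<close>, so the
      derivative within the interval is two-sided.\<close>
    define a where "a = min t 0 - 1"
    have *: "((\<lambda>u. integral {a..u} f' - integral {a..0} f') has_vector_derivative f' t) (at t within {a..t+1})"
      using integral_has_vector_derivative[OF cont[of a "t+1"], of t]
      by (auto intro!: derivative_eq_intros simp: a_def)
    have "(g has_vector_derivative f' t) (at t within {a..t+1})"
      by (rule has_vector_derivative_transform[OF _ _ *]) (auto simp: a_def intro!: g)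
    then have "(g has_vector_derivative f' t) (at t)"
      by (subst (asm) at_within_interior) (auto simp: a_def)
    then show ?thesis
      using bounded_linear.has_vector_derivative[OF bounded_linear_of_copy] of_f' by metis
  qed
  then show ?thesis by blast
qed

section \<open>Orthogonal complements and projections\<close>

lemma closed_orthogonal_comp: "closed (W\<^sup>\<bottom>)"
proof -
  have "W\<^sup>\<bottom> = (\<Inter>y\<in>W. {x. y \<bullet> x = 0})"
    by (auto simp: orthogonal_comp_def orthogonal_def)
  then show ?thesis
    by (auto intro!: closed_INT closed_Collect_eq continuous_intros)
qed

lemma orthogonal_comp_Int: "x \<in> W \<Longrightarrow> x \<in> W\<^sup>\<bottom> \<Longrightarrow> x = 0"
  by (auto simp: orthogonal_comp_def orthogonal_def)

lemma parallelogram_law: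
  fixes x y :: "'a::real_inner"
  shows "(norm (x + y))\<^sup>2 + (norm (x - y))\<^sup>2 = 2 * (norm x)\<^sup>2 + 2 * (norm y)\<^sup>2"
  by (simp add: power2_norm_eq_inner algebra_simps)

text \<open>A minimising sequence for the distance to \<open>x\<close> is Cauchy by the
  parallelogram law, and the first-order condition at the minimiser is orthogonality.\<close>

theorem projection_theorem:
  fixes M :: "'h::{real_inner, complete_space} set"
  assumes sub: "subspace M" and cl: "closed M"
  shows "\<exists>p\<in>M. x - p \<in> M\<^sup>\<bottom>"
proof -
  define d where "d = Inf ((\<lambda>m. (norm (x - m))\<^sup>2) ` M)"
  have ne: "(\<lambda>m. (norm (x - m))\<^sup>2) ` M \<noteq> {}" using subspace_0[OF sub] by auto
  have bdd: "bdd_below ((\<lambda>m. (norm (x - m))\<^sup>2) ` M)" by (rule bdd_belowI[of _ 0]) auto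
  have d_le: "d \<le> (norm (x - m))\<^sup>2" if "m \<in> M" for m
    unfolding d_def using bdd that by (intro cInf_lower) auto
  have "\<exists>m\<in>M. (norm (x - m))\<^sup>2 < d + 1 / Suc n" for n
  proof -
    have "d < d + 1 / Suc n" by simp
    then show ?thesis unfolding d_def using cInf_lessD[OF ne] by fastforce
  qed
  then obtain m where m: "m n \<in> M" "(norm (x - m n))\<^sup>2 < d + 1 / Suc n" for n by metis
  have close: "(norm (m i - m j))\<^sup>2 \<le> 2 / Suc i + 2 / Suc j" for i j
  proof -
    \<comment> \<open>Midpoints stay in \<open>M\<close>, so their squared distance to
      \<open>x\<close> is at least \<open>d\<close>; this forces near-minimisers to be close to each
      other.\<close>
    have "(1/2) *\<^sub>R (m i + m j) \<in> M" using m sub by (intro subspace_scale subspace_add) auto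
    then have "d \<le> (norm (x - (1/2) *\<^sub>R (m i + m j)))\<^sup>2" by (rule d_le)
    moreover have "(x - m i) + (x - m j) = 2 *\<^sub>R (x - (1/2) *\<^sub>R (m i + m j))"
      by (simp add: algebra_simps scaleR_2)
    ultimately have "4 * d \<le> (norm ((x - m i) + (x - m j)))\<^sup>2"
      by (simp add: power_mult_distrib)
    then show ?thesis
      using parallelogram_law[of "x - m i" "x - m j"] m(2)[of i] m(2)[of j]
      by (simp add: norm_minus_commute)
  qed
  have "Cauchy m"
  proof (rule metric_CauchyI)
    fix e :: real assume "e > 0"
    then obtain N where N: "inverse (real (Suc N)) < e\<^sup>2 / 4"
      using reals_Archimedean[of "e\<^sup>2 / 4"] by auto
    have "dist (m i) (m j) < e" if "i \<ge> N" "j \<ge> N" for i j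
    proof -
      have "2 / real (Suc i) \<le> 2 * inverse (Suc N)" "2 / real (Suc j) \<le> 2 * inverse (Suc N)"
        using that by (auto simp: divide_inverse simp del: of_nat_Suc)
      then have "(norm (m i - m j))\<^sup>2 < e\<^sup>2" using close[of i j] N by linarith
      then show ?thesis
        using \<open>e > 0\<close> by (simp add: dist_norm power2_less_imp_less)
    qed
    then show "\<exists>N. \<forall>i\<ge>N. \<forall>j\<ge>N. dist (m i) (m j) < e" by blast
  qed
  then obtain p where p: "m \<longlonglongrightarrow> p" using Cauchy_convergent_iff convergent_def by blast
  have pM: "p \<in> M" using closed_sequentially[OF cl] m(1) p by blast
  have "(norm (x - p))\<^sup>2 \<le> d"
  proof (rule LIMSEQ_le)
    show "(\<lambda>n. (norm (x - m n))\<^sup>2) \<longlonglongrightarrow> (norm (x - p))\<^sup>2" by (intro tendsto_intros p)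
    show "(\<lambda>n. d + 1 / Suc n) \<longlonglongrightarrow> d"
      using tendsto_add[OF tendsto_const LIMSEQ_inverse_real_of_nat, of d]
      by (simp add: inverse_eq_divide)
  qed (use m(2) less_imp_le in blast)
  then have opt: "(norm (x - p))\<^sup>2 \<le> (norm (x - m))\<^sup>2" if "m \<in> M" for m
    by (rule order_trans) (rule d_le[OF that])
  have "y \<bullet> (x - p) = 0" if y: "y \<in> M" for y
  proof (cases "y = 0")
    case False
    \<comment> \<open>The minimiser of the squared distance to \<open>x\<close> along the line
      \<open>p + s *\<^sub>R y\<close>; a nonzero inner product would make the value there smaller
      than at \<open>p\<close>.\<close>
    define s where "s = y \<bullet> (x - p) / (y \<bullet> y)"
    have "p + s *\<^sub>R y \<in> M" using pM y sub by (intro subspace_add subspace_scale) auto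
    from opt[OF this, unfolded power2_norm_eq_inner]
    have "0 \<le> s\<^sup>2 * (y \<bullet> y) - 2 * s * (y \<bullet> (x - p))"
      by (simp add: inner_diff_left inner_diff_right inner_add_left
          inner_add_right inner_commute algebra_simps power2_eq_square)
    also have "\<dots> = - (y \<bullet> (x - p))\<^sup>2 / (y \<bullet> y)"
      using False by (simp add: s_def power2_eq_square field_simps)
    finally have "(y \<bullet> (x - p))\<^sup>2 / (y \<bullet> y) \<le> 0" by simp
    then show ?thesis using False
      by (auto simp: divide_le_0_iff power2_less_eq_zero_iff) (metis inner_gt_zero_iff not_le)
  qed auto
  then show ?thesis using pM by (auto simp: orthogonal_comp_def orthogonal_def)
qed

lemma
  fixes M :: "'h::{real_inner, complete_space} set"
  assumes sub: "subspace M" and cl: "closed M"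
  shows orthogonal_projection_mem: "orthogonal_projection M x \<in> M"
    and orthogonal_projection_diff: "x - orthogonal_projection M x \<in> M\<^sup>\<bottom>"
    and orthogonal_projection_eqI: "p \<in> M \<Longrightarrow> x - p \<in> M\<^sup>\<bottom> \<Longrightarrow> orthogonal_projection M x = p"
proof -
  have unique: "p = q" if "p \<in> M" "x - p \<in> M\<^sup>\<bottom>" "q \<in> M" "x - q \<in> M\<^sup>\<bottom>" for p q
  proof -
    have "p - q \<in> M" using that sub by (intro subspace_diff) auto
    moreover have "(x - q) - (x - p) \<in> M\<^sup>\<bottom>"
      using that by (metis subspace_diff subspace_orthogonal_comp)
    ultimately show ?thesis using orthogonal_comp_Int[of "p - q" M] by simp
  qed
  have ex1: "\<exists>!p. p \<in> M \<and> x - p \<in> M\<^sup>\<bottom>"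
    using projection_theorem[OF assms, of x] unique by blast
  show "orthogonal_projection M x \<in> M" "x - orthogonal_projection M x \<in> M\<^sup>\<bottom>"
    using theI'[OF ex1] by (auto simp: orthogonal_projection_def)
  then show "p \<in> M \<Longrightarrow> x - p \<in> M\<^sup>\<bottom> \<Longrightarrow> orthogonal_projection M x = p"
    using unique by blast
qed

lemma orthogonal_comp_orthogonal_comp:
  fixes M :: "'h::{real_inner, complete_space} set"
  assumes "subspace M" "closed M"
  shows "M\<^sup>\<bottom>\<^sup>\<bottom> = M"
proof (rule antisym)
  show "M\<^sup>\<bottom>\<^sup>\<bottom> \<subseteq> M"
  proof
    fix x assume x: "x \<in> M\<^sup>\<bottom>\<^sup>\<bottom>"
    obtain p where p: "p \<in> M" "x - p \<in> M\<^sup>\<bottom>" using projection_theorem[OF assms] by blast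
    have "x - p \<in> M\<^sup>\<bottom>\<^sup>\<bottom>"
      using x p(1) orthogonal_comp_subset[of M]
      by (intro subspace_diff subspace_orthogonal_comp) auto
    then have "x = p" using orthogonal_comp_Int[OF p(2)] by simp
    then show "x \<in> M" using p(1) by simp
  qed
qed (rule orthogonal_comp_subset)

lemma bounded_linear_orthogonal_projection:
  fixes M :: "'h::{real_inner, complete_space} set"
  assumes M: "subspace M" "closed M"
  shows "bounded_linear (orthogonal_projection M)"
    and norm_orthogonal_projection_le: "norm (orthogonal_projection M x) \<le> norm x"
proof -
  let ?P = "orthogonal_projection M"
  note mem = orthogonal_projection_mem[OF M] and diff = orthogonal_projection_diff[OF M]
    and eqI = orthogonal_projection_eqI[OF M]
  have le: "norm (?P x) \<le> norm x" for x
  proof -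
    have "?P x \<bullet> (x - ?P x) = 0"
      using mem[of x] diff[of x] by (auto simp: orthogonal_comp_def orthogonal_def)
    then have "(norm (?P x))\<^sup>2 = ?P x \<bullet> x" by (simp add: power2_norm_eq_inner inner_diff_right)
    also have "\<dots> \<le> norm (?P x) * norm x" by (rule norm_cauchy_schwarz)
    finally show ?thesis by (simp add: power2_eq_square) (metis mult_le_cancel_left_pos norm_ge_zero order_le_less)
  qed
  then show "norm (?P x) \<le> norm x" .
  show "bounded_linear ?P"
  proof (rule bounded_linear_intro[where K = 1])
    fix x y :: 'h and r :: real
    have "(x - ?P x) + (y - ?P y) \<in> M\<^sup>\<bottom>"
      by (intro subspace_add subspace_orthogonal_comp diff)
    then show "?P (x + y) = ?P x + ?P y"
      by (intro eqI subspace_add M mem) (simp add: algebra_simps)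
    have "r *\<^sub>R (x - ?P x) \<in> M\<^sup>\<bottom>"
      by (intro subspace_scale subspace_orthogonal_comp diff)
    then show "?P (r *\<^sub>R x) = r *\<^sub>R ?P x"
      by (intro eqI subspace_scale M mem) (simp add: algebra_simps)
  qed (simp add: le)
qed

section \<open>Riesz representation and the adjoint\<close>

theorem Riesz_representation:
  fixes f :: "'h::{real_inner, complete_space} \<Rightarrow> real"
  assumes f: "bounded_linear f"
  shows "\<exists>z. \<forall>x. f x = x \<bullet> z"
proof (cases "\<forall>x. f x = 0")
  case True
  then show ?thesis by (auto intro!: exI[of _ 0])
next
  case False
  then obtain x0 where x0: "f x0 \<noteq> 0" by blast
  interpret bounded_linear f by fact
  define M where "M = {x. f x = 0}"
  have "subspace M" by (auto simp: M_def subspace_def zero add scaleR)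
  moreover have "closed M"
    unfolding M_def by (intro closed_Collect_eq continuous_intros continuous_on)
  ultimately obtain p where p: "f p = 0" "x0 - p \<in> M\<^sup>\<bottom>"
    using projection_theorem[of M x0] by (auto simp: M_def)
  define e where "e = x0 - p"
  have fe: "f e \<noteq> 0" using p x0 by (simp add: e_def diff)
  then have e: "e \<noteq> 0" using zero by auto
  have "f x = x \<bullet> ((f e / (e \<bullet> e)) *\<^sub>R e)" for x
  proof -
    \<comment> \<open>Removing the right multiple of \<open>e\<close> puts any vector into the
      kernel, to which \<open>e\<close> is orthogonal.\<close>
    have "x - (f x / f e) *\<^sub>R e \<in> M" using fe by (simp add: M_def diff scaleR)
    then have "(x - (f x / f e) *\<^sub>R e) \<bullet> e = 0"
      using p(2) by (auto simp: orthogonal_comp_def orthogonal_def e_def)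
    then show ?thesis using fe e by (simp add: inner_diff_left field_simps)
  qed
  then show ?thesis by blast
qed

text \<open>\<open>adjoint\<close> is a Hilbert choice, so its defining equation holds only once
  some adjoint exists; Riesz representation supplies its value at each point.\<close>

lemma
  fixes L :: "'u::{real_inner, complete_space} \<Rightarrow> 'h::real_inner"
  assumes L: "bounded_linear L"
  shows inner_adjoint: "L u \<bullet> x = u \<bullet> adjoint L x"
    and bounded_linear_adjoint: "bounded_linear (adjoint L)"
proof -
  interpret L: bounded_linear L by fact
  have "\<exists>z. \<forall>u. L u \<bullet> x = u \<bullet> z" for x
    using Riesz_representation[OF bounded_linear_inner_left_comp[OF L]] .
  then have "\<exists>L'. \<forall>u x. L u \<bullet> x = u \<bullet> L' x" by metis
  then have *: "L u \<bullet> x = u \<bullet> adjoint L x" for u x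
    unfolding adjoint_def by (rule someI2_ex) blast
  then show "L u \<bullet> x = u \<bullet> adjoint L x" .
  obtain K where K: "norm (L x) \<le> norm x * K" "0 < K" for x using L.pos_bounded by metis
  show "bounded_linear (adjoint L)"
  proof (rule bounded_linear_intro)
    show "adjoint L (x + y) = adjoint L x + adjoint L y" for x y
      by (rule vector_eq_ldot[THEN iffD1]) (simp add: inner_add_right flip: *)
    show "adjoint L (r *\<^sub>R x) = r *\<^sub>R adjoint L x" for r x
      by (rule vector_eq_ldot[THEN iffD1]) (simp flip: *)
    show "norm (adjoint L x) \<le> norm x * K" for x
    proof -
      have "(norm (adjoint L x))\<^sup>2 = L (adjoint L x) \<bullet> x"
        by (simp add: * power2_norm_eq_inner)
      also have "\<dots> \<le> norm (adjoint L x) * K * norm x"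
        using norm_cauchy_schwarz K(1) by (meson mult_right_mono norm_ge_zero order_trans)
      finally have "norm (adjoint L x) * norm (adjoint L x) \<le> norm (adjoint L x) * (norm x * K)"
        by (simp add: power2_eq_square mult_ac)
      then show ?thesis
        using K(2) by (cases "norm (adjoint L x) = 0") (auto simp: mult_le_cancel_left_pos)
    qed
  qed
qed

section \<open>Absolutely continuous functions\<close>

lemma abs_continuous_onE:
  assumes f: "abs_continuous_on K f" and "\<epsilon> > 0"
  obtains \<delta> where "\<delta> > 0" "\<forall>(n::nat) a b. (\<forall>i<n. a i \<in> K \<and> b i \<in> K \<and> a i \<le> b i) \<and>
        (\<forall>i<n. \<forall>j<n. i \<noteq> j \<longrightarrow> {a i<..<b i} \<inter> {a j<..<b j} = {}) \<and>
        (\<Sum>i<n. b i - a i) < \<delta> \<longrightarrow> (\<Sum>i<n. dist (f (a i)) (f (b i))) < \<epsilon>"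
  using f[unfolded abs_continuous_on_def, rule_format, OF \<open>\<epsilon> > 0\<close>] by (elim exE conjE)

text \<open>Common source of the closure properties: differences, weighted norms and squared norms
  all have increments dominated by those of two functions already known to be absolutely
  continuous.\<close>

lemma abs_continuous_onI_dist:
  fixes f :: "real \<Rightarrow> 'a::metric_space"
  assumes g: "abs_continuous_on K g" and h: "abs_continuous_on K h"
    and C: "C1 \<ge> 0" "C2 \<ge> 0"
    and le: "\<And>x y. x \<in> K \<Longrightarrow> y \<in> K \<Longrightarrow> x \<le> y \<Longrightarrow>
      dist (f x) (f y) \<le> C1 * dist (g x) (g y) + C2 * dist (h x) (h y)"
  shows "abs_continuous_on K f"
  unfolding abs_continuous_on_def
proof (intro allI impI)
  fix \<epsilon> :: real assume "\<epsilon> > 0"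
  define \<eta> where "\<eta> = \<epsilon> / (C1 + C2 + 1)"
  have "\<eta> > 0" using \<open>\<epsilon> > 0\<close> C by (simp add: \<eta>_def)
  obtain d1 where d1: "d1 > 0" "\<forall>(n::nat) a b. (\<forall>i<n. a i \<in> K \<and> b i \<in> K \<and> a i \<le> b i) \<and>
        (\<forall>i<n. \<forall>j<n. i \<noteq> j \<longrightarrow> {a i<..<b i} \<inter> {a j<..<b j} = {}) \<and>
        (\<Sum>i<n. b i - a i) < d1 \<longrightarrow> (\<Sum>i<n. dist (g (a i)) (g (b i))) < \<eta>"
    by (rule abs_continuous_onE[OF g \<open>\<eta> > 0\<close>])
  obtain d2 where d2: "d2 > 0" "\<forall>(n::nat) a b. (\<forall>i<n. a i \<in> K \<and> b i \<in> K \<and> a i \<le> b i) \<and>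
        (\<forall>i<n. \<forall>j<n. i \<noteq> j \<longrightarrow> {a i<..<b i} \<inter> {a j<..<b j} = {}) \<and>
        (\<Sum>i<n. b i - a i) < d2 \<longrightarrow> (\<Sum>i<n. dist (h (a i)) (h (b i))) < \<eta>"
    by (rule abs_continuous_onE[OF h \<open>\<eta> > 0\<close>])
  show "\<exists>\<delta>>0. \<forall>(n::nat) a b. (\<forall>i<n. a i \<in> K \<and> b i \<in> K \<and> a i \<le> b i) \<and>
        (\<forall>i<n. \<forall>j<n. i \<noteq> j \<longrightarrow> {a i<..<b i} \<inter> {a j<..<b j} = {}) \<and>
        (\<Sum>i<n. b i - a i) < \<delta> \<longrightarrow> (\<Sum>i<n. dist (f (a i)) (f (b i))) < \<epsilon>"
  proof (intro exI[of _ "min d1 d2"] conjI allI impI)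
    fix n :: nat and a b
    assume *: "(\<forall>i<n. a i \<in> K \<and> b i \<in> K \<and> a i \<le> b i) \<and>
        (\<forall>i<n. \<forall>j<n. i \<noteq> j \<longrightarrow> {a i<..<b i} \<inter> {a j<..<b j} = {}) \<and>
        (\<Sum>i<n. b i - a i) < min d1 d2"
    have 1: "(\<Sum>i<n. dist (g (a i)) (g (b i))) < \<eta>" by (rule d1(2)[rule_format]) (use * in auto)
    have 2: "(\<Sum>i<n. dist (h (a i)) (h (b i))) < \<eta>" by (rule d2(2)[rule_format]) (use * in auto)
    have "(\<Sum>i<n. dist (f (a i)) (f (b i)))
        \<le> (\<Sum>i<n. C1 * dist (g (a i)) (g (b i)) + C2 * dist (h (a i)) (h (b i)))"
      using * by (intro sum_mono le) auto
    also have "\<dots> = C1 * (\<Sum>i<n. dist (g (a i)) (g (b i))) + C2 * (\<Sum>i<n. dist (h (a i)) (h (b i)))"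
      by (simp add: sum.distrib sum_distrib_left)
    also have "\<dots> \<le> C1 * \<eta> + C2 * \<eta>"
      using 1 2 C by (intro add_mono mult_left_mono) auto
    also have "\<dots> < (C1 + C2 + 1) * \<eta>" using \<open>\<eta> > 0\<close> by (simp add: algebra_simps)
    also have "\<dots> = \<epsilon>" using C by (simp add: \<eta>_def)
    finally show "(\<Sum>i<n. dist (f (a i)) (f (b i))) < \<epsilon>" .
  qed (use d1 d2 in auto)
qed

lemma abs_continuous_on_ident: "abs_continuous_on K (\<lambda>x. x)"
  unfolding abs_continuous_on_def
proof (intro allI impI)
  fix \<epsilon> :: real assume "\<epsilon> > 0"
  have "(\<Sum>i<n. dist (a i) (b i)) = (\<Sum>i<n. b i - a i)"
    if "\<forall>i<n. a i \<le> b i" for n :: nat and a b :: "nat \<Rightarrow> real"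
    using that by (intro sum.cong) (auto simp: dist_real_def)
  then show "\<exists>\<delta>>0. \<forall>(n::nat) a b. (\<forall>i<n. a i \<in> K \<and> b i \<in> K \<and> a i \<le> b i) \<and>
        (\<forall>i<n. \<forall>j<n. i \<noteq> j \<longrightarrow> {a i<..<b i} \<inter> {a j<..<b j} = {}) \<and>
        (\<Sum>i<n. b i - a i) < \<delta> \<longrightarrow> (\<Sum>i<n. dist (a i) (b i)) < \<epsilon>"
    using \<open>\<epsilon> > 0\<close> by (intro exI[of _ \<epsilon>]) auto
qed

lemma lipschitz_on_imp_abs_continuous_on:
  "C-lipschitz_on K f \<Longrightarrow> abs_continuous_on K f"
  by (rule abs_continuous_onI_dist[OF abs_continuous_on_ident abs_continuous_on_ident, of C 0])
    (auto dest: lipschitz_onD lipschitz_on_nonneg)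

text \<open>The definition numbers the intervals, whereas divisions index them by tagged pairs; the
  sums are transferred along a bijection.\<close>

lemma abs_continuous_on_finite_sum:
  assumes "abs_continuous_on K u" "\<epsilon> > 0"
  obtains \<delta> where "\<delta> > 0" "\<forall>I a b. finite I \<and> (\<forall>i\<in>I. a i \<in> K \<and> b i \<in> K \<and> a i \<le> b i) \<and>
        (\<forall>i\<in>I. \<forall>j\<in>I. i \<noteq> j \<longrightarrow> {a i<..<b i} \<inter> {a j<..<b j} = {}) \<and>
        (\<Sum>i\<in>I. b i - a i) < \<delta> \<longrightarrow> (\<Sum>i\<in>I. dist (u (a i)) (u (b i))) < \<epsilon>"
proof -
  obtain \<delta> where \<delta>: "\<delta> > 0" "\<forall>(n::nat) a b. (\<forall>i<n. a i \<in> K \<and> b i \<in> K \<and> a i \<le> b i) \<and>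
        (\<forall>i<n. \<forall>j<n. i \<noteq> j \<longrightarrow> {a i<..<b i} \<inter> {a j<..<b j} = {}) \<and>
        (\<Sum>i<n. b i - a i) < \<delta> \<longrightarrow> (\<Sum>i<n. dist (u (a i)) (u (b i))) < \<epsilon>"
    by (rule abs_continuous_onE[OF assms])
  have "(\<Sum>i\<in>I. dist (u (a i)) (u (b i))) < \<epsilon>"
    if I: "finite I" "\<And>i. i \<in> I \<Longrightarrow> a i \<in> K \<and> b i \<in> K \<and> a i \<le> b i"
      "\<And>i j. i \<in> I \<Longrightarrow> j \<in> I \<Longrightarrow> i \<noteq> j \<Longrightarrow> {a i<..<b i} \<inter> {a j<..<b j} = {}"
      "(\<Sum>i\<in>I. b i - a i) < \<delta>" for I :: "'b set" and a b
  proof -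
    obtain f where f: "bij_betw f {..<card I} I"
      using ex_bij_betw_nat_finite[OF I(1)] by (auto simp: atLeast0LessThan)
    have reindex: "(\<Sum>i\<in>I. F i) = (\<Sum>n<card I. F (f n))" for F :: "'b \<Rightarrow> real"
      by (rule sum.reindex_bij_betw[OF f, symmetric])
    have "f n \<in> I" if "n < card I" for n using f that by (auto dest: bij_betwE)
    moreover have "f n \<noteq> f m" if "n < card I" "m < card I" "n \<noteq> m" for n m
      using f that by (auto simp: bij_betw_def inj_on_def)
    moreover have "(\<Sum>n<card I. b (f n) - a (f n)) < \<delta>" using I(4) reindex[of "\<lambda>i. b i - a i"] by simp
    ultimately have "(\<Sum>n<card I. dist (u (a (f n))) (u (b (f n)))) < \<epsilon>"
      using I(2,3) by (intro \<delta>(2)[rule_format]) simp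
    then show ?thesis using reindex[of "\<lambda>i. dist (u (a i)) (u (b i))"] by simp
  qed
  with \<delta>(1) show ?thesis by (intro that[of \<delta>]) auto
qed

text \<open>The gauge keeps every interval tagged in the exceptional null set inside an open set of small
  measure, where absolute continuity controls the increments.\<close>

theorem abs_continuous_has_integral:
  fixes u u' :: "real \<Rightarrow> real"
  assumes ab: "a \<le> b" and ac: "abs_continuous_on {a..b} u" and N: "negligible N"
    and u': "\<And>x. x \<in> {a..b} - N \<Longrightarrow> (u has_real_derivative u' x) (at x within {a..b})"
    and u'N: "\<And>x. x \<in> N \<Longrightarrow> u' x = 0"
  shows "(u' has_integral (u b - u a)) {a..b}"
  unfolding has_integral_real
proof (intro allI impI)
  fix e :: real assume "e > 0"
  \<comment> \<open>Half of \<open>e\<close> pays for the intervals with tag outside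
    \<open>N\<close>; the \<open>+ 1\<close> keeps the denominator positive when
    \<open>a = b\<close>.\<close>
  define e1 where "e1 = e / (2 * (b - a + 1))"
  have e1: "e1 > 0" "e1 * (b - a) < e / 2"
    using \<open>e > 0\<close> ab by (auto simp: e1_def field_simps)
  have "e / 2 > 0" using \<open>e > 0\<close> by simp
  then obtain \<delta> where
    \<delta>: "\<delta> > 0" "\<forall>(I::(real \<times> real set) set) a' b'. finite I \<and>
        (\<forall>i\<in>I. a' i \<in> {a..b} \<and> b' i \<in> {a..b} \<and> a' i \<le> b' i) \<and>
        (\<forall>i\<in>I. \<forall>j\<in>I. i \<noteq> j \<longrightarrow> {a' i<..<b' i} \<inter> {a' j<..<b' j} = {}) \<and>
        (\<Sum>i\<in>I. b' i - a' i) < \<delta> \<longrightarrow> (\<Sum>i\<in>I. dist (u (a' i)) (u (b' i))) < e / 2"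
    by (rule abs_continuous_on_finite_sum[OF ac])
  have N': "N \<in> sets lebesgue" "emeasure lebesgue N = 0"
    using N by (auto simp: negligible_iff_null_sets)
  obtain V where V: "open V" "N \<subseteq> V" "V - N \<in> lmeasurable" "emeasure lebesgue (V - N) < ennreal \<delta>"
    using sets_lebesgue_outer_open[OF N'(1) \<delta>(1)] by metis
  have VN: "V = (V - N) \<union> N" using V(2) by auto
  have Vm: "V \<in> lmeasurable" "measure lebesgue V < \<delta>"
  proof -
    show "V \<in> lmeasurable"
      by (subst VN) (intro fmeasurable.Un V negligible_imp_measurable N)
    have "measure lebesgue V \<le> measure lebesgue (V - N) + measure lebesgue N"
      by (subst VN) (rule measure_Un_le; use V(3) N' in auto)
    also have "measure lebesgue N = 0" using N by (rule negligible_imp_measure0)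
    also have "measure lebesgue (V - N) < \<delta>"
      using V(3,4) \<delta>(1) by (auto simp: emeasure_eq_measure2 ennreal_less_iff)
    finally show "measure lebesgue V < \<delta>" by simp
  qed
  have "\<exists>d>0. \<forall>y\<in>{a..b}. \<bar>y - x\<bar> < d \<longrightarrow> \<bar>u y - u x - u' x * (y - x)\<bar> \<le> e1 * \<bar>y - x\<bar>"
    if "x \<in> {a..b} - N" for x
    using u'[OF that] e1(1) unfolding has_field_derivative_def has_derivative_within_alt
    by (fastforce simp: mult.commute)
  then obtain d where d: "\<And>x. x \<in> {a..b} - N \<Longrightarrow> d x > 0"
    "\<And>x y. x \<in> {a..b} - N \<Longrightarrow> y \<in> {a..b} \<Longrightarrow> \<bar>y - x\<bar> < d x \<Longrightarrow>
        \<bar>u y - u x - u' x * (y - x)\<bar> \<le> e1 * \<bar>y - x\<bar>"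
    by metis
  define \<gamma> where "\<gamma> x = (if x \<in> N then V else if x \<in> {a..b} then ball x (d x) else ball x 1)" for x
  have "gauge \<gamma>" using V d(1) by (auto simp: gauge_def \<gamma>_def)
  moreover have "norm ((\<Sum>(x,k)\<in>p. measure lborel k *\<^sub>R u' x) - (u b - u a)) < e"
    if p: "p tagged_division_of {a..b}" and fine: "\<gamma> fine p" for p
  proof -
    have fin: "finite p" using p by auto
    have K: "x \<in> {a..b} \<and> x \<in> K \<and> Inf K \<le> x \<and> x \<le> Sup K \<and> Inf K \<in> K \<and> Sup K \<in> K \<and> Inf K \<in> {a..b} \<and> Sup K \<in> {a..b}
       \<and> K = {Inf K..Sup K} \<and> measure lborel K = Sup K - Inf K" if xK: "(x, K) \<in> p" for x K
    proof -
      obtain l r where lr: "K = cbox l r" using p xK by blast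
      have "x \<in> K" "K \<subseteq> {a..b}" using p xK by auto
      moreover from this have "l \<le> r" by (auto simp: lr)
      ultimately show ?thesis by (auto simp: lr)
    qed
    define p1 where "p1 = {(x, K) \<in> p. x \<notin> N}"
    define p2 where "p2 = {(x, K) \<in> p. x \<in> N}"
    have pp: "p = p1 \<union> p2" "p1 \<inter> p2 = {}" "p1 \<subseteq> p" "p2 \<subseteq> p" by (auto simp: p1_def p2_def)
    have fin12: "finite p1" "finite p2" using fin pp finite_subset by blast+
    let ?T = "\<lambda>(x, K). measure lborel K *\<^sub>R u' x - (u (Sup K) - u (Inf K))"
    have "(\<Sum>(x,k)\<in>p. measure lborel k *\<^sub>R u' x) - (u b - u a) = (\<Sum>z\<in>p. ?T z)"
      using additive_tagged_division_1[OF ab p, of u] by (simp add: sum_subtractf split_def)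
    also have "\<dots> = (\<Sum>z\<in>p1. ?T z) + (\<Sum>z\<in>p2. ?T z)"
      unfolding pp(1) by (rule sum.union_disjoint) (use fin12 pp in auto)
    finally have "norm ((\<Sum>(x,k)\<in>p. measure lborel k *\<^sub>R u' x) - (u b - u a))
        \<le> norm (\<Sum>z\<in>p1. ?T z) + norm (\<Sum>z\<in>p2. ?T z)"
      by (simp only: norm_triangle_ineq)
    also have "\<dots> < e / 2 + e / 2"
    proof (rule add_strict_mono)
      \<comment> \<open>Splitting each interval at its tag, both pieces contribute an error
        proportional to their length, and the lengths add up to at most
        \<open>b - a\<close>.\<close>
      have "norm (\<Sum>z\<in>p1. ?T z) \<le> (\<Sum>z\<in>p1. e1 * (case z of (x, K) \<Rightarrow> Sup K - Inf K))"
      proof (rule sum_norm_le, clarify)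
        fix x K assume "(x, K) \<in> p1"
        then have xK: "(x, K) \<in> p" "x \<notin> N" by (auto simp: p1_def)
        note k = K[OF xK(1)]
        have "K \<subseteq> ball x (d x)"
          using fineD[OF fine xK(1)] xK(2) k by (simp add: \<gamma>_def)
        then have "\<bar>Inf K - x\<bar> < d x" "\<bar>Sup K - x\<bar> < d x"
          using k by (auto simp: dist_real_def)
        then have "\<bar>u (Inf K) - u x - u' x * (Inf K - x)\<bar> \<le> e1 * \<bar>Inf K - x\<bar>"
          "\<bar>u (Sup K) - u x - u' x * (Sup K - x)\<bar> \<le> e1 * \<bar>Sup K - x\<bar>"
          by (intro d(2); use k xK in auto)+
        then have "\<bar>u' x * (Sup K - Inf K) - (u (Sup K) - u (Inf K))\<bar>
            \<le> e1 * \<bar>Inf K - x\<bar> + e1 * \<bar>Sup K - x\<bar>"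
          by (simp add: algebra_simps)
        also have "\<dots> = e1 * (Sup K - Inf K)" using k by (simp add: algebra_simps)
        finally show "norm (measure lborel K *\<^sub>R u' x - (u (Sup K) - u (Inf K))) \<le> e1 * (Sup K - Inf K)"
          using k by (simp add: mult.commute)
      qed
      also have "\<dots> \<le> (\<Sum>z\<in>p. e1 * (case z of (x, K) \<Rightarrow> Sup K - Inf K))"
        using e1(1) by (intro sum_mono2 fin pp) (auto simp: p1_def p2_def dest!: K)
      also have "\<dots> = e1 * (b - a)"
        using additive_tagged_division_1[OF ab p, of "\<lambda>x. x"] by (simp flip: sum_distrib_left)
      finally show "norm (\<Sum>z\<in>p1. ?T z) < e / 2" using e1(2) by linarith
    next
      \<comment> \<open>Here \<open>u'\<close> is zero, so only increments of \<open>u\<close>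
        remain, over intervals inside \<open>V\<close>, whose measure is below
        \<open>\<delta>\<close>.\<close>
      have "norm (\<Sum>z\<in>p2. ?T z) \<le> (\<Sum>z\<in>p2. dist (u (Inf (snd z))) (u (Sup (snd z))))"
        by (rule sum_norm_le) (auto simp: p2_def u'N dist_real_def)
      also have "\<dots> < e / 2"
      proof (rule \<delta>(2)[rule_format], intro conjI ballI impI)
        fix z assume "z \<in> p2"
        then show "Inf (snd z) \<in> {a..b}" "Sup (snd z) \<in> {a..b}" "Inf (snd z) \<le> Sup (snd z)"
          using K[of "fst z" "snd z"] by (auto simp: p2_def)
      next
        fix z w assume zw: "z \<in> p2" "w \<in> p2" "z \<noteq> w"
        have int: "interior (snd z) = {Inf (snd z)<..<Sup (snd z)}" if "z \<in> p2" for z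
        proof -
          have "snd z = {Inf (snd z)..Sup (snd z)}" using that K[of "fst z" "snd z"] by (auto simp: p2_def)
          then show ?thesis by (metis interior_atLeastAtMost_real)
        qed
        have "interior (snd z) \<inter> interior (snd w) = {}"
          using tagged_division_ofD(5)[OF p, of "fst z" "snd z" "fst w" "snd w"] zw
          by (auto simp: p2_def prod_eq_iff)
        then show "{Inf (snd z)<..<Sup (snd z)} \<inter> {Inf (snd w)<..<Sup (snd w)} = {}"
          using int zw by simp
      next
        have t2: "p2 tagged_partial_division_of {a..b}"
          using p pp tagged_partial_division_subset by (metis tagged_division_of_def)
        then have "(\<Sum>z\<in>p2. Sup (snd z) - Inf (snd z)) = (\<Sum>(x, k)\<in>p2. measure lborel k)"
          by (intro sum.cong) (auto simp: p2_def dest!: K)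
        also have "\<dots> = sum (measure lborel) (snd ` p2)"
          using tagged_partial_division_of_Union_self[OF t2]
          by (intro sum.over_tagged_division_lemma) (auto simp: content_eq_0_interior)
        also have "\<dots> = (\<Sum>k\<in>snd ` p2. measure lebesgue k)"
        proof (rule sum.cong)
          fix k assume "k \<in> snd ` p2"
          then obtain x where "(x, k) \<in> p" by (auto simp: p2_def)
          then obtain l r where "k = cbox l r" using p by blast
          then show "measure lborel k = measure lebesgue k" by simp
        qed simp
        also have "\<dots> = measure lebesgue (\<Union> (snd ` p2))"
          using partial_division_of_tagged_division[OF t2] by (rule content_division)
        also have "\<dots> \<le> measure lebesgue V"
        proof (rule measure_mono_fmeasurable)
          show "\<Union> (snd ` p2) \<subseteq> V"
            using fine by (fastforce simp: p2_def fine_def \<gamma>_def)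
          show "\<Union> (snd ` p2) \<in> sets lebesgue"
            using partial_division_of_tagged_division[OF t2] lmeasurable_division by blast
        qed fact
        also have "\<dots> < \<delta>" by fact
        finally show "(\<Sum>z\<in>p2. Sup (snd z) - Inf (snd z)) < \<delta>" .
      qed fact
      finally show "norm (\<Sum>z\<in>p2. ?T z) < e / 2" .
    qed
    finally show ?thesis by simp
  qed
  ultimately show "\<exists>\<gamma>. gauge \<gamma> \<and> (\<forall>\<D>. \<D> tagged_division_of {a..b} \<and> \<gamma> fine \<D> \<longrightarrow>
      norm ((\<Sum>(x,k)\<in>\<D>. measure lborel k *\<^sub>R u' x) - (u b - u a)) < e)"
    by (intro exI[of _ \<gamma>] conjI allI impI) simp_all
qed

text \<open>No measurability of \<open>g\<close> is assumed: only monotonicity of the nonnegative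
  integral is applied to it. Measurability comes from the derivative, which is gauge integrable by
  the preceding theorem, and its positive part is the function that gets compared with
  \<open>g\<close>.\<close>

lemma abs_continuous_increment_le:
  fixes u g :: "real \<Rightarrow> real"
  assumes st: "s \<le> t" and ac: "abs_continuous_on {s..t} u" and N: "negligible N"
    and u': "\<And>x. x \<in> {s..t} - N \<Longrightarrow> \<exists>d\<le>g x. (u has_real_derivative d) (at x)"
    and g: "\<And>x. g x \<ge> 0"
  shows "ennreal (u t - u s) \<le> (\<integral>\<^sup>+x. ennreal (g x) \<partial>lebesgue_on {s..t})"
proof -
  obtain d where d: "\<And>x. x \<in> {s..t} - N \<Longrightarrow> d x \<le> g x \<and> (u has_real_derivative d x) (at x)"
    using u' by metis
  define f where "f x = (if x \<in> {s..t} then (if x \<in> N then 0 else d x) else 0)" for x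
  have "((\<lambda>x. if x \<in> N then 0 else d x) has_integral (u t - u s)) {s..t}"
  proof (rule abs_continuous_has_integral[OF st ac N])
    show "(u has_real_derivative (if x \<in> N then 0 else d x)) (at x within {s..t})" if "x \<in> {s..t} - N" for x
      using d[OF that] that by (auto intro: has_field_derivative_at_within)
  qed auto
  then have I: "(f has_integral (u t - u s)) UNIV"
    unfolding f_def by (simp only: has_integral_restrict_UNIV)
  have meas: "f \<in> borel_measurable lebesgue"
    using has_integral_implies_lebesgue_measurable[OF I] by simp
  define G where "G = (\<integral>\<^sup>+x. ennreal (g x) \<partial>lebesgue_on {s..t})"
  have G: "(\<integral>\<^sup>+x. ennreal (max 0 (f x)) \<partial>lebesgue) \<le> G"
    unfolding G_def
    by (subst nn_integral_restrict_space)
      (auto intro!: nn_integral_mono simp: f_def indicator_def max_def g d ennreal_leI)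
  show ?thesis
  proof (cases "G = \<infinity>")
    case True
    then show ?thesis by (simp add: G_def)
  next
    case False
    then obtain r where r: "(\<integral>\<^sup>+x. ennreal (max 0 (f x)) \<partial>lebesgue) = ennreal r" "0 \<le> r"
      using G by (cases "\<integral>\<^sup>+x. ennreal (max 0 (f x)) \<partial>lebesgue") (auto simp: top_unique)
    then have "((\<lambda>x. max 0 (f x)) has_integral r) UNIV"
      using meas by (subst has_integral_iff_nn_integral_lebesgue) auto
    then have "u t - u s \<le> r" by (rule has_integral_le[OF I]) auto
    then have "ennreal (u t - u s) \<le> ennreal r" by (rule ennreal_leI)
    also have "\<dots> \<le> G" using G r by simp
    finally show ?thesis by (simp add: G_def)
  qed
qed

text \<open>A derivative bound where \<open>u\<close> is positive suffices: integrate from the last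
  time before \<open>t\<close> at which \<open>u\<close> is nonpositive, or from \<open>a\<close> if
  there is none. This suits norms, which are not differentiable at zero.\<close>

lemma abs_continuous_growth:
  fixes u g :: "real \<Rightarrow> real"
  assumes cont: "continuous_on {a..b} u"
    and ac: "\<And>s t. a < s \<Longrightarrow> s \<le> t \<Longrightarrow> t < b \<Longrightarrow> abs_continuous_on {s..t} u" and N: "negligible N"
    and u': "\<And>x. x \<in> {a<..<b} - N \<Longrightarrow> u x > 0 \<Longrightarrow> \<exists>d\<le>g x. (u has_real_derivative d) (at x)"
    and g: "\<And>x. g x \<ge> 0" and t: "t \<in> {a..b}"
  shows "ennreal (u t) \<le> ennreal (u a) + (\<integral>\<^sup>+x. ennreal (g x) \<partial>lebesgue_on {a..b})"
proof (cases "u t \<le> 0")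
  case True
  then show ?thesis by (simp add: ennreal_neg)
next
  case False
  define G where "G = (\<integral>\<^sup>+x. ennreal (g x) \<partial>lebesgue_on {a..b})"
  \<comment> \<open>\<open>a\<close> is inserted so that the set is nonempty even when
    \<open>u\<close> is positive on all of \<open>{a..t}\<close>.\<close>
  define Z where "Z = insert a {z \<in> {a..t}. u z \<le> 0}"
  have "closed Z" unfolding Z_def
    using continuous_closed_preimage[OF continuous_on_subset[OF cont, of "{a..t}"], of "{..0}"] t
    by (auto simp: vimage_def Int_def)
  moreover have bdd: "bdd_above Z" using t by (auto simp: Z_def intro!: bdd_aboveI[of _ t])
  ultimately have Sup_Z: "Sup Z \<in> Z" by (intro closed_contains_Sup) (auto simp: Z_def)
  define s0 where "s0 = Sup Z"
  have s0: "s0 \<in> {a..t}" "u s0 \<le> max 0 (u a)" using Sup_Z t by (auto simp: s0_def Z_def)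
  have pos: "u z > 0" if "s0 < z" "z \<le> t" for z
    using cSup_upper[OF _ bdd, of z] that s0 by (force simp: s0_def Z_def not_le[symmetric])
  have key: "ennreal (u t' - u s) \<le> G" if "s0 < s" "s \<le> t'" "t' < t" for s t'
  proof -
    have "ennreal (u t' - u s) \<le> (\<integral>\<^sup>+x. ennreal (g x) \<partial>lebesgue_on {s..t'})"
      by (rule abs_continuous_increment_le[OF _ ac N u' g]) (use that s0 t pos in auto)
    also have "\<dots> \<le> G" unfolding G_def
      using that s0 t by (subst (1 2) nn_integral_restrict_space)
        (auto intro!: nn_integral_mono simp: indicator_def)
    finally show ?thesis .
  qed
  show ?thesis
  proof (cases "G = \<infinity> \<or> s0 = t")
    case True
    then show ?thesis
    proof
      assume "s0 = t"
      then have "u t \<le> u a" using s0 False by auto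
      then show ?thesis by (intro add_increasing2 ennreal_leI) auto
    qed (simp add: G_def)
  next
    case False2: False
    then obtain r where r: "G = ennreal r" "0 \<le> r" by (cases G) auto
    have st: "s0 < t" "a \<le> s0" "t \<le> b" using s0 t False2 by auto
    \<comment> \<open>Absolute continuity is available only on compact subintervals of the open
      interval, so both ends are approached from inside; a step of at most a third of the length
      keeps them in order.\<close>
    define h where "h n = (t - s0) * (1 / (real n + 3))" for n
    have h: "h n > 0" "h n \<le> (t - s0) / 3" for n
      using st(1) mult_left_mono[of "1 / (real n + 3)" "1 / 3" "t - s0"] by (auto simp: h_def)
    have "(\<lambda>n. 1 / (real n + 3)) \<longlonglongrightarrow> 0"
      using LIMSEQ_ignore_initial_segment[OF lim_inverse_n', of 3] by (simp add: add.commute)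
    from tendsto_mult_right[OF this, of "t - s0"] have lim0: "h \<longlonglongrightarrow> 0" by (simp add: h_def[abs_def])
    have "u (t - h n) - u (s0 + h n) \<le> r" for n
      using key[of "s0 + h n" "t - h n"] h[of n] r st(1) by (simp add: field_simps)
    moreover have "(\<lambda>n. u (t - h n)) \<longlonglongrightarrow> u t"
    proof (rule continuous_on_tendsto_compose[OF cont])
      show "(\<lambda>n. t - h n) \<longlonglongrightarrow> t" using tendsto_diff[OF tendsto_const lim0] by simp
      show "\<forall>\<^sub>F n in sequentially. t - h n \<in> {a..b}"
      proof (intro always_eventually allI)
        fix n show "t - h n \<in> {a..b}" using h[of n] st by (auto simp: field_simps)
      qed
    qed (use t in auto)
    moreover have "(\<lambda>n. u (s0 + h n)) \<longlonglongrightarrow> u s0"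
    proof (rule continuous_on_tendsto_compose[OF cont])
      show "(\<lambda>n. s0 + h n) \<longlonglongrightarrow> s0" using tendsto_add[OF tendsto_const lim0] by simp
      show "\<forall>\<^sub>F n in sequentially. s0 + h n \<in> {a..b}"
      proof (intro always_eventually allI)
        fix n show "s0 + h n \<in> {a..b}" using h[of n] st by (auto simp: field_simps)
      qed
    qed (use s0 t in auto)
    ultimately have "u t - u s0 \<le> r"
      by (intro tendsto_upperbound[where F = sequentially, OF tendsto_diff]) auto
    then have "u t \<le> max 0 (u a) + r" using s0 by simp
    then have "ennreal (u t) \<le> ennreal (max 0 (u a) + r)" by (rule ennreal_leI)
    also have "\<dots> = ennreal (u a) + ennreal r"
      using r by (subst ennreal_plus) (auto simp: max_def ennreal_neg)
    finally show ?thesis using r by (simp add: G_def)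
  qed
qed

text \<open>Gronwall in differential form: the weight \<open>exp (- (c * (x - a)))\<close> absorbs
  the quadratic term, and division by \<open>norm (w x)\<close> leaves \<open>g x\<close>. The bound
  is thus linear in the integral of \<open>g\<close>.\<close>

theorem abs_continuous_energy:
  fixes w :: "real \<Rightarrow> 'h::real_inner"
  assumes cont: "continuous_on {a..b} w"
    and ac: "\<And>s t. a < s \<Longrightarrow> s \<le> t \<Longrightarrow> t < b \<Longrightarrow> abs_continuous_on {s..t} w" and N: "negligible N"
    and w': "\<And>x. x \<in> {a<..<b} - N \<Longrightarrow>
      \<exists>d. (w has_vector_derivative d) (at x) \<and> w x \<bullet> d \<le> c * (norm (w x))\<^sup>2 + g x * norm (w x)"
    and g: "\<And>x. g x \<ge> 0" and c: "c \<ge> 0" and t: "t \<in> {a..b}"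
  shows "ennreal (norm (w t)) \<le>
    ennreal (exp (c * (b - a))) * (ennreal (norm (w a)) + (\<integral>\<^sup>+x. ennreal (g x) \<partial>lebesgue_on {a..b}))"
proof -
  define u where "u x = exp (- (c * (x - a))) * norm (w x)" for x
  obtain M where M: "\<And>x. x \<in> {a..b} \<Longrightarrow> norm (w x) \<le> M" "M \<ge> 0"
  proof -
    have "bounded (w ` {a..b})"
      using compact_imp_bounded[OF compact_continuous_image[OF cont]] by simp
    then show ?thesis using that unfolding bounded_pos by (metis imageI less_imp_le)
  qed
  have "ennreal (u t) \<le> ennreal (u a) + (\<integral>\<^sup>+x. ennreal (g x) \<partial>lebesgue_on {a..b})"
  proof (rule abs_continuous_growth[OF _ _ N _ g t])
    show "continuous_on {a..b} u" unfolding u_def by (intro continuous_intros cont)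
    fix s t assume st: "a < s" "s \<le> t" "t < b"
    have exp_le: "\<bar>exp (- (c * (x - a))) - exp (- (c * (y - a)))\<bar> \<le> c * \<bar>x - y\<bar>"
      if xy: "x \<in> {s..t}" "y \<in> {s..t}" for x y
    proof -
      have "norm (exp (- (c * (x - a))) - exp (- (c * (y - a)))) \<le> c * norm (x - y)"
      proof (rule field_differentiable_bound[where S = "{s..t}" and f' = "\<lambda>x. - c * exp (- (c * (x - a)))"])
        fix z assume z: "z \<in> {s..t}"
        then have "exp (- (c * (z - a))) \<le> 1" using c st by auto
        then have "c * exp (- (c * (z - a))) \<le> c * 1" using c by (intro mult_left_mono) auto
        then show "norm (- c * exp (- (c * (z - a)))) \<le> c" using c by (simp add: abs_mult)
        show "((\<lambda>z. exp (- (c * (z - a)))) has_field_derivative - c * exp (- (c * (z - a)))) (at z within {s..t})"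
          by (auto intro!: derivative_eq_intros)
      qed (use xy in auto)
      then show ?thesis by simp
    qed
    \<comment> \<open>Product rule for increments: the weight is at most \<open>1\<close> with
      Lipschitz constant \<open>c\<close>, and the norm is at most \<open>M\<close>.\<close>
    show "abs_continuous_on {s..t} u"
    proof (rule abs_continuous_onI_dist[OF ac[OF st] abs_continuous_on_ident, of 1 "M * c"])
      fix x y assume xy: "x \<in> {s..t}" "y \<in> {s..t}"
      have "u x - u y = exp (- (c * (x - a))) * (norm (w x) - norm (w y))
          + (exp (- (c * (x - a))) - exp (- (c * (y - a)))) * norm (w y)"
        by (simp add: u_def algebra_simps)
      then have "\<bar>u x - u y\<bar> \<le> exp (- (c * (x - a))) * \<bar>norm (w x) - norm (w y)\<bar>
          + \<bar>exp (- (c * (x - a))) - exp (- (c * (y - a)))\<bar> * norm (w y)"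
        using abs_triangle_ineq by (metis abs_exp_cancel abs_mult abs_norm_cancel)
      also have "\<dots> \<le> 1 * norm (w x - w y) + (c * \<bar>x - y\<bar>) * M"
        using xy st c M by (intro add_mono mult_mono exp_le) (auto simp: norm_triangle_ineq3)
      finally show "dist (u x) (u y) \<le> 1 * dist (w x) (w y) + M * c * dist x y"
        by (simp add: dist_norm mult_ac)
    qed (use c M in auto)
  next
    fix x assume x: "x \<in> {a<..<b} - N" and "u x > 0"
    then have wx: "w x \<noteq> 0" by (auto simp: u_def)
    obtain d where d: "(w has_vector_derivative d) (at x)" "w x \<bullet> d \<le> c * (norm (w x))\<^sup>2 + g x * norm (w x)"
      using w'[OF x] by blast
    have "((\<lambda>x. norm (w x)) has_derivative (\<lambda>h. (h *\<^sub>R d) \<bullet> sgn (w x))) (at x)"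
      using has_derivative_compose[OF d(1)[unfolded has_vector_derivative_def] has_derivative_norm[OF wx]] .
    then have "((\<lambda>x. norm (w x)) has_real_derivative (sgn (w x) \<bullet> d)) (at x)"
      unfolding has_field_derivative_def
      by (rule has_derivative_eq_rhs) (auto simp: inner_commute mult.commute)
    then have "(u has_real_derivative
        exp (- (c * (x - a))) * (sgn (w x) \<bullet> d) + (- c * exp (- (c * (x - a)))) * norm (w x)) (at x)"
      unfolding u_def by (auto intro!: derivative_eq_intros)
    moreover have "exp (- (c * (x - a))) * (sgn (w x) \<bullet> d) + (- c * exp (- (c * (x - a)))) * norm (w x) \<le> g x"
    proof -
      have "sgn (w x) \<bullet> d \<le> c * norm (w x) + g x"
        using d(2) wx by (simp add: sgn_div_norm inverse_eq_divide power2_eq_square field_simps)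
      then have "exp (- (c * (x - a))) * (sgn (w x) \<bullet> d - c * norm (w x)) \<le> exp (- (c * (x - a))) * g x"
        by (intro mult_left_mono) auto
      also have "\<dots> \<le> 1 * g x" using x c by (intro mult_right_mono g) auto
      finally show ?thesis by (simp add: algebra_simps)
    qed
    ultimately show "\<exists>d\<le>g x. (u has_real_derivative d) (at x)" by blast
  qed
  then have "ennreal (exp (c * (t - a))) * ennreal (u t) \<le> ennreal (exp (c * (b - a))) *
      (ennreal (norm (w a)) + (\<integral>\<^sup>+x. ennreal (g x) \<partial>lebesgue_on {a..b}))"
    using t c by (intro mult_mono ennreal_leI) (auto simp: u_def mult_left_mono)
  also have "ennreal (exp (c * (t - a))) * ennreal (u t) = ennreal (norm (w t))"
    by (simp add: u_def exp_minus flip: ennreal_mult)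
  finally show ?thesis .
qed

section \<open>Null sets and integrals of norms of forcing terms\<close>

lemma AE_lebesgue_on_negligible:
  assumes "AE t in lebesgue_on {a<..<b::real}. Q t"
  obtains N where "negligible N" "\<And>t. t \<in> {a<..<b} - N \<Longrightarrow> Q t"
proof -
  have "AE t in lebesgue. t \<in> {a<..<b} \<longrightarrow> Q t"
    using assms by (subst (asm) AE_restrict_space_iff) auto
  then obtain N where "N \<in> null_sets lebesgue" "{t \<in> space lebesgue. \<not> (t \<in> {a<..<b} \<longrightarrow> Q t)} \<subseteq> N"
    by (auto simp: eventually_ae_filter)
  then show ?thesis using that[of N] by (auto simp: negligible_iff_null_sets)
qed

text \<open>Additivity of the nonnegative integral requires measurable integrands; the limit of the
  norms of the simple functions is a measurable real version of \<open>norm (f t)\<close>, also when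
  the space is not separable.\<close>

lemma in_L1_AE_borel_measurable:
  assumes "in_L1 T f"
  obtains h :: "real \<Rightarrow> real" where "h \<in> borel_measurable (lebesgue_on {0..T})"
    "AE t in lebesgue_on {0..T}. norm (f t) = h t"
proof -
  obtain s where s: "\<And>n::nat. simple_function (lebesgue_on {0..T}) (s n)"
    "AE t in lebesgue_on {0..T}. (\<lambda>n. s n t) \<longlonglongrightarrow> f t"
    using assms by (auto simp: in_L1_def strongly_measurable_def)
  show ?thesis
  proof
    show "(\<lambda>t. lim (\<lambda>n. norm (s n t))) \<in> borel_measurable (lebesgue_on {0..T})"
      by (intro borel_measurable_lim_metric borel_measurable_simple_function
          simple_function_compose1[OF s(1)])
    show "AE t in lebesgue_on {0..T}. norm (f t) = lim (\<lambda>n. norm (s n t))"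
      using s(2) by eventually_elim (metis limI tendsto_norm)
  qed
qed

lemma nn_integral_affine_L1_le:
  assumes f: "in_L1 T f" and ab: "0 \<le> a" "a \<le> b" "b \<le> T" and c: "c \<ge> 0" "d \<ge> 0"
  shows "(\<integral>\<^sup>+t. ennreal (c * norm (f t) + d) \<partial>lebesgue_on {a..b}) \<le>
    ennreal c * L1_norm T f + ennreal (d * (b - a))"
proof -
  obtain h :: "real \<Rightarrow> real" where h: "h \<in> borel_measurable (lebesgue_on {0..T})"
    "AE t in lebesgue_on {0..T}. norm (f t) = h t"
    using in_L1_AE_borel_measurable[OF f] by blast
  have "(\<integral>\<^sup>+t. ennreal (c * norm (f t) + d) \<partial>lebesgue_on {a..b})
      = (\<integral>\<^sup>+t. ennreal (c * norm (f t) + d) * indicator {a..b} t \<partial>lebesgue_on {0..T})"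
    using ab by (subst (1 2) nn_integral_restrict_space) (auto intro!: nn_integral_cong simp: indicator_def)
  also have "\<dots> \<le> (\<integral>\<^sup>+t. ennreal c * ennreal (norm (f t)) + ennreal d * indicator {a..b} t \<partial>lebesgue_on {0..T})"
    using c by (intro nn_integral_mono) (auto simp: indicator_def ennreal_mult)
  also have "\<dots> = (\<integral>\<^sup>+t. ennreal c * ennreal (h t) + ennreal d * indicator {a..b} t \<partial>lebesgue_on {0..T})"
    using h(2) by (intro nn_integral_cong_AE) auto
  also have "\<dots> = ennreal c * (\<integral>\<^sup>+t. ennreal (h t) \<partial>lebesgue_on {0..T}) + ennreal d * emeasure (lebesgue_on {0..T}) {a..b}"
  proof -
    have [measurable]: "{a..b} \<in> sets (lebesgue_on {0..T})"
      using ab by (subst sets_restrict_space_iff) auto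
    show ?thesis using h(1)
      by (subst nn_integral_add) (auto simp: nn_integral_cmult nn_integral_cmult_indicator)
  qed
  also have "(\<integral>\<^sup>+t. ennreal (h t) \<partial>lebesgue_on {0..T}) = L1_norm T f"
    unfolding L1_norm_def using h(2) by (intro nn_integral_cong_AE) auto
  also have "emeasure (lebesgue_on {0..T}) {a..b} = ennreal (b - a)"
    using ab by (subst emeasure_restrict_space) auto
  finally show ?thesis using c ab by (simp add: ennreal_mult)
qed

lemma nn_integral_L1_add:
  assumes f: "in_L1 T f" and g: "in_L1 T g"
  shows "(\<integral>\<^sup>+t. ennreal (norm (f t) + norm (g t)) \<partial>lebesgue_on {0..T}) = L1_norm T f + L1_norm T g"
proof -
  obtain h where h: "h \<in> borel_measurable (lebesgue_on {0..T})" "AE t in lebesgue_on {0..T}. norm (f t) = h t"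
    using in_L1_AE_borel_measurable[OF f] by blast
  obtain k where k: "k \<in> borel_measurable (lebesgue_on {0..T})" "AE t in lebesgue_on {0..T}. norm (g t) = k t"
    using in_L1_AE_borel_measurable[OF g] by blast
  have "(\<integral>\<^sup>+t. ennreal (norm (f t) + norm (g t)) \<partial>lebesgue_on {0..T})
      = (\<integral>\<^sup>+t. ennreal (norm (f t)) + ennreal (norm (g t)) \<partial>lebesgue_on {0..T})" by simp
  also have "\<dots> = (\<integral>\<^sup>+t. ennreal (h t) + ennreal (k t) \<partial>lebesgue_on {0..T})"
    using h(2) k(2) by (intro nn_integral_cong_AE) auto
  also have "\<dots> = (\<integral>\<^sup>+t. ennreal (h t) \<partial>lebesgue_on {0..T}) + (\<integral>\<^sup>+t. ennreal (k t) \<partial>lebesgue_on {0..T})"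
    using h(1) k(1) by (intro nn_integral_add) auto
  also have "(\<integral>\<^sup>+t. ennreal (h t) \<partial>lebesgue_on {0..T}) = L1_norm T f"
    unfolding L1_norm_def using h(2) by (intro nn_integral_cong_AE) auto
  also have "(\<integral>\<^sup>+t. ennreal (k t) \<partial>lebesgue_on {0..T}) = L1_norm T g"
    unfolding L1_norm_def using k(2) by (intro nn_integral_cong_AE) auto
  finally show ?thesis .
qed

section \<open>Semigroups with dissipative generator\<close>

text \<open>Banach-Steinhaus by Baire: the closed sets \<open>E k\<close> cover the space, so one of
  them contains a ball, and a bound on a ball scales to all vectors.\<close>

theorem uniform_boundedness:
  fixes T :: "nat \<Rightarrow> 'a::{real_normed_vector, complete_space} \<Rightarrow> 'b::real_normed_vector"
  assumes T: "\<And>n. bounded_linear (T n)" and bdd: "\<And>x. bounded (range (\<lambda>n. T n x))"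
  shows "\<exists>M. \<forall>n x. norm (T n x) \<le> M * norm x"
proof -
  define E where "E k = {x. \<forall>n. norm (T n x) \<le> real k}" for k
  have cl: "closed (E k)" for k
  proof -
    have "E k = (\<Inter>n. {x. norm (T n x) \<le> real k})" by (auto simp: E_def)
    then show ?thesis
      by (auto intro!: closed_INT closed_Collect_le continuous_on_norm
          bounded_linear.continuous_on[OF T] continuous_on_id continuous_on_const)
  qed
  have cover: "\<Union> (range E) = UNIV"
  proof -
    have "\<exists>k. x \<in> E k" for x
    proof -
      obtain B where "\<And>n. norm (T n x) \<le> B" using bdd[of x] by (auto simp: bounded_iff)
      moreover obtain k where "B \<le> real k" using real_arch_simple by blast
      ultimately show ?thesis unfolding E_def by (blast intro: order_trans)
    qed
    then show ?thesis by blast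
  qed
  have "\<exists>k. interior (E k) \<noteq> {}"
  proof (rule ccontr)
    assume "\<not> ?thesis"
    then have "euclidean interior_of \<Union> (range E) = {}"
      using cl by (intro Baire_category_alt) (auto simp: completely_metrizable_space_euclidean)
    then show False using cover by simp
  qed
  then obtain k a where "a \<in> interior (E k)" by blast
  then obtain r where r: "r > 0" "ball a r \<subseteq> E k" by (auto simp: mem_interior)
  have "norm (T n x) \<le> (4 * real k / r) * norm x" for n x
  proof (cases "x = 0")
    case True
    then show ?thesis using linear_0[OF bounded_linear.linear[OF T]] by simp
  next
    case False
    interpret bounded_linear "T n" by (rule T)
    \<comment> \<open>Scales \<open>x\<close> to length \<open>r / 2\<close>, so that
      \<open>a + c *\<^sub>R x\<close> stays in the ball.\<close>
    define c where "c = r / (2 * norm x)"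
    have c: "c > 0" using False r by (simp add: c_def)
    have "a \<in> E k" "a + c *\<^sub>R x \<in> E k" using r False by (auto simp: c_def dist_norm intro!: subsetD[OF r(2)])
    then have "norm (T n a) \<le> k" "norm (T n (a + c *\<^sub>R x)) \<le> k" by (auto simp: E_def)
    moreover have "c *\<^sub>R T n x = T n (a + c *\<^sub>R x) - T n a" by (simp add: add scaleR)
    ultimately have "norm (c *\<^sub>R T n x) \<le> 2 * real k"
      using norm_triangle_ineq4[of "T n (a + c *\<^sub>R x)" "T n a"] by simp
    then have "c * norm (T n x) \<le> 2 * real k" using c by simp
    then show ?thesis using False r by (simp add: c_def field_simps)
  qed
  then show ?thesis by blast
qed

lemma has_vector_derivative_norm_bound:
  fixes f :: "real \<Rightarrow> 'a::real_normed_vector"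
  assumes "a \<le> b" and f': "\<And>x. x \<in> {a..b} \<Longrightarrow> (f has_vector_derivative f' x) (at x)"
    and B: "\<And>x. x \<in> {a..b} \<Longrightarrow> norm (f' x) \<le> B"
  shows "norm (f b - f a) \<le> B * (b - a)"
proof -
  have "norm (f b - f a) \<le> B * norm (b - a)"
  proof (rule differentiable_bound[where S = "{a..b}"])
    fix x assume x: "x \<in> {a..b}"
    show "(f has_derivative (\<lambda>h. h *\<^sub>R f' x)) (at x within {a..b})"
      using f'[OF x] by (auto simp: has_vector_derivative_def intro: has_derivative_at_withinI)
    show "onorm (\<lambda>h. h *\<^sub>R f' x) \<le> B"
      by (rule onorm_le) (use mult_right_mono[OF B[OF x] abs_ge_zero] in \<open>simp add: mult.commute\<close>)
  qed (use assms in auto)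
  then show ?thesis using assms by simp
qed

lemma has_vector_derivative_zero_const:
  fixes f :: "real \<Rightarrow> 'a::real_normed_vector"
  assumes "a \<le> b" "\<And>x. x \<in> {a..b} \<Longrightarrow> (f has_vector_derivative 0) (at x)"
  shows "f b = f a"
  using has_vector_derivative_norm_bound[of a b f "\<lambda>_. 0" 0] assms by simp

lemma has_vector_derivative_right_quotient:
  fixes f :: "real \<Rightarrow> 'a::real_normed_vector"
  assumes "(f has_vector_derivative d) (at t)"
  shows "((\<lambda>h. (f (t + h) - f t) /\<^sub>R h) \<longlongrightarrow> d) (at_right 0)"
proof -
  have "((\<lambda>h. norm (f (t + h) - f t - h *\<^sub>R d) / norm h) \<longlongrightarrow> 0) (at 0)"
    using assms unfolding has_vector_derivative_def has_derivative_at by blast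
  moreover have "\<forall>\<^sub>F h in at 0. norm (f (t + h) - f t - h *\<^sub>R d) / norm h = norm ((f (t + h) - f t) /\<^sub>R h - d)"
  proof (rule eventually_at_filter[THEN iffD2], rule always_eventually, intro allI impI)
    fix h :: real assume h: "h \<noteq> 0"
    have "(f (t + h) - f t) /\<^sub>R h - d = (f (t + h) - f t - h *\<^sub>R d) /\<^sub>R h"
      using h by (simp add: scaleR_diff_right)
    then show "norm (f (t + h) - f t - h *\<^sub>R d) / norm h = norm ((f (t + h) - f t) /\<^sub>R h - d)"
      by (simp add: divide_inverse mult.commute)
  qed
  ultimately have "((\<lambda>h. norm ((f (t + h) - f t) /\<^sub>R h - d)) \<longlongrightarrow> 0) (at 0)"
    by (rule Lim_transform_eventually)
  then have "((\<lambda>h. (f (t + h) - f t) /\<^sub>R h) \<longlongrightarrow> d) (at 0)"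
    by (simp add: tendsto_norm_zero_iff LIM_zero_iff)
  then show ?thesis by (rule filterlim_mono) (auto simp: at_le)
qed

text \<open>A larger rate only weakens the dissipativity bound, so a nonnegative one can be chosen;
  it makes the growth factor \<open>exp (\<omega> * t)\<close> monotone in \<open>t\<close>.\<close>

locale quasi_contractive_semigroup =
  fixes D :: "'h::{real_inner, complete_space} set" and A :: "'h \<Rightarrow> 'h"
    and S :: "real \<Rightarrow> 'h \<Rightarrow> 'h" and \<omega> :: real
  assumes generates: "generates D A S"
    and \<omega>_nonneg: "0 \<le> \<omega>"
    and dissipative: "x \<in> D \<Longrightarrow> A x \<bullet> x \<le> \<omega> * (norm x)\<^sup>2"
begin

lemma bounded_linear_S: "0 \<le> t \<Longrightarrow> bounded_linear (S t)"
  and S_0 [simp]: "S 0 x = x"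
  and S_add: "0 \<le> s \<Longrightarrow> 0 \<le> t \<Longrightarrow> S (s + t) x = S s (S t x)"
  and tendsto_S_0: "((\<lambda>t. S t x) \<longlongrightarrow> x) (at_right 0)"
  using generates by (auto simp: generates_def C0_semigroup_def)

lemma generator_lim: "x \<in> D \<Longrightarrow> ((\<lambda>h. (S h x - x) /\<^sub>R h) \<longlongrightarrow> A x) (at_right 0)"
  using generates by (auto simp: generates_def)

lemma
  assumes "((\<lambda>h. (S h x - x) /\<^sub>R h) \<longlongrightarrow> l) (at_right 0)"
  shows generator_domI: "x \<in> D" and generator_eqI: "A x = l"
proof -
  show "x \<in> D" using assms generates by (auto simp: generates_def)
  then show "A x = l" using assms tendsto_unique generator_lim by (metis trivial_limit_at_right_real)
qed

lemma S_diff: "0 \<le> t \<Longrightarrow> S t (x - y) = S t x - S t y"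
  and S_plus: "0 \<le> t \<Longrightarrow> S t (x + y) = S t x + S t y"
  and S_scaleR: "0 \<le> t \<Longrightarrow> S t (r *\<^sub>R x) = r *\<^sub>R S t x"
  and S_zero: "0 \<le> t \<Longrightarrow> S t 0 = 0"
  using bounded_linear.linear[OF bounded_linear_S]
  by (auto simp: linear_diff linear_add linear_scale linear_0)

lemma
  assumes "x \<in> D" "y \<in> D"
  shows generator_dom_add: "x + y \<in> D" and generator_add: "A (x + y) = A x + A y"
proof -
  have "((\<lambda>h. (S h x - x) /\<^sub>R h + (S h y - y) /\<^sub>R h) \<longlongrightarrow> A x + A y) (at_right 0)"
    by (intro tendsto_add generator_lim assms)
  moreover have "\<forall>\<^sub>F h in at_right 0. (S h x - x) /\<^sub>R h + (S h y - y) /\<^sub>R h = (S h (x + y) - (x + y)) /\<^sub>R h"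
    by (rule eventually_at_right_less[THEN eventually_mono]) (simp add: S_plus algebra_simps)
  ultimately have "((\<lambda>h. (S h (x + y) - (x + y)) /\<^sub>R h) \<longlongrightarrow> A x + A y) (at_right 0)"
    by (rule Lim_transform_eventually)
  then show "x + y \<in> D" "A (x + y) = A x + A y" by (rule generator_domI, rule generator_eqI)
qed

lemma
  assumes "x \<in> D"
  shows generator_dom_scaleR: "r *\<^sub>R x \<in> D" and generator_scaleR: "A (r *\<^sub>R x) = r *\<^sub>R A x"
proof -
  have "((\<lambda>h. r *\<^sub>R ((S h x - x) /\<^sub>R h)) \<longlongrightarrow> r *\<^sub>R A x) (at_right 0)"
    by (intro tendsto_scaleR tendsto_const generator_lim assms)
  moreover have "\<forall>\<^sub>F h in at_right 0. r *\<^sub>R ((S h x - x) /\<^sub>R h) = (S h (r *\<^sub>R x) - r *\<^sub>R x) /\<^sub>R h"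
    by (rule eventually_at_right_less[THEN eventually_mono]) (simp add: S_scaleR algebra_simps)
  ultimately have "((\<lambda>h. (S h (r *\<^sub>R x) - r *\<^sub>R x) /\<^sub>R h) \<longlongrightarrow> r *\<^sub>R A x) (at_right 0)"
    by (rule Lim_transform_eventually)
  then show "r *\<^sub>R x \<in> D" "A (r *\<^sub>R x) = r *\<^sub>R A x" by (rule generator_domI, rule generator_eqI)
qed

lemma
  assumes "x \<in> D" "y \<in> D"
  shows generator_dom_diff: "x - y \<in> D" and generator_diff: "A (x - y) = A x - A y"
  using generator_dom_add[OF assms(1) generator_dom_scaleR[OF assms(2), of "-1"]]
    generator_add[OF assms(1) generator_dom_scaleR[OF assms(2), of "-1"]]
    generator_scaleR[OF assms(2), of "-1"]
  by auto

lemma generator_dom_0: "0 \<in> D" and generator_0: "A 0 = 0"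
proof -
  have "((\<lambda>h. (S h 0 - 0) /\<^sub>R h) \<longlongrightarrow> 0) (at_right 0)"
    by (rule tendsto_eventually, rule eventually_at_right_less[THEN eventually_mono]) (simp add: S_zero)
  then show "0 \<in> D" "A 0 = 0" by (rule generator_domI, rule generator_eqI)
qed

text \<open>Otherwise times tending to \<open>0\<close> carry operators of unbounded norm, although
  strong continuity makes every orbit converge along them, against uniform boundedness.\<close>

lemma S_bounded_near_0: "\<exists>h>0. \<exists>M. \<forall>t\<in>{0..h}. \<forall>x. norm (S t x) \<le> M * norm x"
proof (rule ccontr)
  assume contra: "\<not> ?thesis"
  have "\<exists>t x. 0 \<le> t \<and> t \<le> 1 / Suc n \<and> norm (S t x) > real n * norm x" for n
  proof -
    have "1 / real (Suc n) > 0" by simp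
    then show ?thesis using contra by (metis atLeastAtMost_iff not_le)
  qed
  then obtain t x where t: "\<And>n. 0 \<le> t n" "\<And>n. t n \<le> 1 / Suc n"
    and big: "\<And>n. norm (S (t n) (x n)) > real n * norm (x n)" by metis
  have t0: "t \<longlonglongrightarrow> 0"
    by (rule tendsto_sandwich[OF _ _ tendsto_const LIMSEQ_inverse_real_of_nat])
      (use t in \<open>auto simp: inverse_eq_divide\<close>)
  have "(\<lambda>n. S (t n) y) \<longlonglongrightarrow> y" for y
  proof -
    have "((\<lambda>s. S s y) \<longlongrightarrow> S 0 y) (at 0 within {0..})"
      using tendsto_S_0[of y] by (simp add: at_within_Ici_at_right)
    then have "continuous (at 0 within {0..}) (\<lambda>s. S s y)"
      by (simp add: continuous_within)
    then show ?thesis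
      using t0 t(1) unfolding continuous_within_sequentially by (auto simp: o_def)
  qed
  then have "bounded (range (\<lambda>n. S (t n) y))" for y by (rule convergent_imp_bounded)
  then obtain M where M: "\<And>n y. norm (S (t n) y) \<le> M * norm y"
    using uniform_boundedness[of "\<lambda>n. S (t n)"] bounded_linear_S t(1) by blast
  obtain n where n: "M \<le> real n" using real_arch_simple by blast
  have "M * norm (x n) \<le> real n * norm (x n)" by (intro mult_right_mono n) auto
  then show False using M[of n "x n"] big[of n] by linarith
qed

lemma S_locally_bounded: "\<exists>M. \<forall>t\<in>{0..b}. \<forall>x. norm (S t x) \<le> M * norm x"
proof -
  obtain h M0 where h: "h > 0" and M0: "\<And>t x. t \<in> {0..h} \<Longrightarrow> norm (S t x) \<le> M0 * norm x"
    using S_bounded_near_0 by metis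
  define M where "M = max M0 0"
  have M: "norm (S t x) \<le> M * norm x" if "t \<in> {0..h}" for t x
    using M0[OF that, of x] by (rule order_trans) (auto simp: M_def intro: mult_right_mono)
  have step: "\<exists>M'\<ge>0. \<forall>t\<in>{0..real n * h}. \<forall>x. norm (S t x) \<le> M' * norm x" for n
  proof (induction n)
    case 0
    show ?case by (intro exI[of _ 1]) auto
  next
    case (Suc n)
    then obtain M' where M': "M' \<ge> 0" "\<And>t x. t \<in> {0..real n * h} \<Longrightarrow> norm (S t x) \<le> M' * norm x" by metis
    have "norm (S t x) \<le> max M' (M * M') * norm x" if t: "t \<in> {0..real (Suc n) * h}" for t x
    proof (cases "t \<le> real n * h")
      case True
      then have "norm (S t x) \<le> M' * norm x" using t by (intro M') auto
      also have "\<dots> \<le> max M' (M * M') * norm x" by (intro mult_right_mono) auto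
      finally show ?thesis .
    next
      case False
      have th: "t - real n * h \<in> {0..h}" using False t by (auto simp: algebra_simps)
      have nh: "0 \<le> real n * h" using h by simp
      have "S t x = S (t - real n * h) (S (real n * h) x)"
        using S_add[of "t - real n * h" "real n * h" x] th nh by simp
      then have "norm (S t x) \<le> M * norm (S (real n * h) x)" using M[OF th] by simp
      also have "\<dots> \<le> M * (M' * norm x)" using nh by (intro mult_left_mono M') (auto simp: M_def)
      also have "\<dots> \<le> max M' (M * M') * norm x" by (simp add: mult.assoc[symmetric] mult_right_mono)
      finally show ?thesis .
    qed
    then show ?case using M'(1) by (intro exI[of _ "max M' (M * M')"]) auto
  qed
  obtain n where "b / h \<le> real n" using real_arch_simple by blast
  then have "b \<le> real n * h" using h by (simp add: field_simps)
  then show ?thesis using step[of n] by (meson atLeastAtMost_iff order_trans)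
qed

text \<open>Right continuity at \<open>0\<close> yields continuity from both sides: the operator at
  the smaller time is factored out of the difference, at the cost of its local bound.\<close>

lemma continuous_on_S: "continuous_on {0..} (\<lambda>t. S t x)"
proof -
  have "continuous (at t within {0..}) (\<lambda>t. S t x)" if t: "t \<ge> 0" for t
  proof -
    obtain M where M: "\<And>s y. s \<in> {0..t+1} \<Longrightarrow> norm (S s y) \<le> M * norm y"
      using S_locally_bounded[of "t + 1"] by metis
    have le: "norm (S r x - S s x) \<le> M * norm (S (s - r) x - x)" if "0 \<le> r" "r \<le> s" "s \<le> t + 1" for r s
    proof -
      have "S s x = S r (S (s - r) x)" using S_add[of r "s - r" x] that by simp
      then have "S r x - S s x = S r (x - S (s - r) x)" using that by (simp add: S_diff)
      then show ?thesis using M[of r "x - S (s - r) x"] that by (simp add: norm_minus_commute)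
    qed
    have "((\<lambda>s. S \<bar>s - t\<bar> x) \<longlongrightarrow> x) (at t within {0..})"
    proof -
      have "((\<lambda>r. S r x) \<longlongrightarrow> S 0 x) (at 0 within {0..})"
        using tendsto_S_0[of x] by (simp add: at_within_Ici_at_right)
      then have c: "continuous (at 0 within {0..}) (\<lambda>r. S r x)"
        by (simp add: continuous_within)
      have a: "((\<lambda>s. \<bar>s - t\<bar>) \<longlongrightarrow> 0) (at t within {0..})"
        by (rule tendsto_eq_intros refl | simp)+
      show ?thesis
        using continuous_within_tendsto_compose'[OF c _ a] by simp
    qed
    then have "((\<lambda>s. M * norm (S \<bar>s - t\<bar> x - x)) \<longlongrightarrow> M * norm (x - x)) (at t within {0..})"
      by (intro tendsto_intros)
    then have lim: "((\<lambda>s. M * norm (S \<bar>s - t\<bar> x - x)) \<longlongrightarrow> 0) (at t within {0..})" by simp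
    have "\<forall>\<^sub>F s in at t within {0..}. norm (S s x - S t x) \<le> M * norm (S \<bar>s - t\<bar> x - x)"
    proof (rule eventually_mono)
      show "\<forall>\<^sub>F s in at t within {0..}. dist s t < 1 \<and> 0 \<le> s"
        by (auto simp: eventually_at intro!: exI[of _ 1])
      fix s assume s: "dist s t < 1 \<and> 0 \<le> s"
      then show "norm (S s x - S t x) \<le> M * norm (S \<bar>s - t\<bar> x - x)"
        using le[of s t] le[of t s] t
        by (cases "s \<le> t") (auto simp: dist_real_def norm_minus_commute abs_if)
    qed
    then have "((\<lambda>s. S s x - S t x) \<longlongrightarrow> 0) (at t within {0..})"
      by (rule Lim_null_comparison) (rule lim)
    then show ?thesis by (simp add: continuous_within LIM_zero_iff)
  qed
  then show ?thesis by (simp add: continuous_on_eq_continuous_within)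
qed

section \<open>The integrated semigroup\<close>

text \<open>The integral of \<open>S\<close> from \<open>0\<close> to \<open>t\<close>, as an antiderivative; \<open>max\<close> extends the orbit
  to negative times, so that all derivatives are two-sided.\<close>

definition J :: "real \<Rightarrow> 'h \<Rightarrow> 'h" where
  "J t x = (let g = (SOME g. \<forall>t. (g has_vector_derivative S (max 0 t) x) (at t)) in g t - g 0)"

lemma J_0 [simp]: "J 0 x = 0"
  by (simp add: J_def Let_def)

lemma J_deriv: "0 \<le> t \<Longrightarrow> ((\<lambda>t. J t x) has_vector_derivative S t x) (at t)"
proof -
  assume t: "0 \<le> t"
  have "continuous_on UNIV ((\<lambda>t. S t x) \<circ> (\<lambda>t. max 0 t))"
    by (intro continuous_on_compose continuous_intros continuous_on_subset[OF continuous_on_S]) auto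
  then have "\<exists>g. \<forall>t. (g has_vector_derivative S (max 0 t) x) (at t)"
    by (intro ex_antiderivative) (simp add: o_def)
  from someI_ex[OF this] have
    "((SOME g. \<forall>t. (g has_vector_derivative S (max 0 t) x) (at t)) has_vector_derivative S (max 0 t) x) (at t)"
    by blast
  then show ?thesis
    using t unfolding J_def Let_def by (auto intro!: derivative_eq_intros)
qed

lemma J_deriv_shift:
  assumes "0 \<le> t + s"
  shows "((\<lambda>t. J (t + s) x) has_vector_derivative S (t + s) x) (at t)"
proof -
  have "((\<lambda>t. t + s) has_vector_derivative 1) (at t)"
    by (auto intro!: derivative_eq_intros simp: has_real_derivative_iff_has_vector_derivative[symmetric])
  from vector_diff_chain_at[OF this J_deriv[OF assms]] show ?thesis by (simp add: o_def)
qed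

text \<open>As for the algebraic identities that follow, both sides agree at \<open>0\<close> and
  have equal derivatives in \<open>t\<close>.\<close>

lemma S_J:
  assumes "0 \<le> s" "0 \<le> t"
  shows "S s (J t x) = J (t + s) x - J s x"
proof -
  have "S s (J t x) - J (t + s) x = S s (J 0 x) - J (0 + s) x"
  proof (rule has_vector_derivative_zero_const[OF assms(2)])
    fix r assume "r \<in> {0..t}"
    then have r: "0 \<le> r" "0 \<le> r + s" using assms by auto
    have "((\<lambda>t. S s (J t x) - J (t + s) x) has_vector_derivative S s (S r x) - S (r + s) x) (at r)"
      by (intro has_vector_derivative_diff J_deriv_shift J_deriv r
          bounded_linear.has_vector_derivative[OF bounded_linear_S[OF assms(1)]])
    then show "((\<lambda>t. S s (J t x) - J (t + s) x) has_vector_derivative 0) (at r)"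
      using S_add[OF assms(1) r(1), of x] by (simp add: add.commute)
  qed
  then show ?thesis using assms by (simp add: S_zero algebra_simps)
qed

lemma J_S:
  assumes "0 \<le> s" "0 \<le> t"
  shows "J t (S s x) = J (t + s) x - J s x"
proof -
  have "J t (S s x) - J (t + s) x = J 0 (S s x) - J (0 + s) x"
  proof (rule has_vector_derivative_zero_const[OF assms(2)])
    fix r assume "r \<in> {0..t}"
    then have r: "0 \<le> r" "0 \<le> r + s" using assms by auto
    have "((\<lambda>t. J t (S s x) - J (t + s) x) has_vector_derivative S r (S s x) - S (r + s) x) (at r)"
      by (intro has_vector_derivative_diff J_deriv_shift J_deriv r)
    then show "((\<lambda>t. J t (S s x) - J (t + s) x) has_vector_derivative 0) (at r)"
      using S_add[OF r(1) assms(1), of x] by simp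
  qed
  then show ?thesis by (simp add: algebra_simps)
qed

lemma J_plus:
  assumes "0 \<le> t"
  shows "J t (x + y) = J t x + J t y"
proof -
  have "J t (x + y) - (J t x + J t y) = J 0 (x + y) - (J 0 x + J 0 y)"
  proof (rule has_vector_derivative_zero_const[OF assms])
    fix r assume "r \<in> {0..t}"
    then have r: "0 \<le> r" by auto
    have "((\<lambda>t. J t (x + y) - (J t x + J t y)) has_vector_derivative S r (x + y) - (S r x + S r y)) (at r)"
      by (intro has_vector_derivative_diff has_vector_derivative_add J_deriv r)
    then show "((\<lambda>t. J t (x + y) - (J t x + J t y)) has_vector_derivative 0) (at r)"
      using S_plus[OF r, of x y] by simp
  qed
  then show ?thesis by simp
qed

lemma J_scaleR:
  assumes "0 \<le> t"
  shows "J t (c *\<^sub>R x) = c *\<^sub>R J t x"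
proof -
  have "J t (c *\<^sub>R x) - c *\<^sub>R J t x = J 0 (c *\<^sub>R x) - c *\<^sub>R J 0 x"
  proof (rule has_vector_derivative_zero_const[OF assms])
    fix r assume "r \<in> {0..t}"
    then have r: "0 \<le> r" by auto
    have "((\<lambda>t. J t (c *\<^sub>R x) - c *\<^sub>R J t x) has_vector_derivative S r (c *\<^sub>R x) - c *\<^sub>R S r x) (at r)"
      by (intro has_vector_derivative_diff J_deriv r
          bounded_linear.has_vector_derivative[OF bounded_linear_scaleR_right])
    then show "((\<lambda>t. J t (c *\<^sub>R x) - c *\<^sub>R J t x) has_vector_derivative 0) (at r)"
      using S_scaleR[OF r, of c x] by simp
  qed
  then show ?thesis by simp
qed

lemma bounded_linear_J: assumes t: "0 \<le> t" shows "bounded_linear (J t)"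
proof -
  obtain M where M: "\<And>s y. s \<in> {0..t} \<Longrightarrow> norm (S s y) \<le> M * norm y"
    using S_locally_bounded by metis
  show ?thesis
  proof (rule bounded_linear_intro)
    show "norm (J t x) \<le> norm x * (M * t)" for x
      using has_vector_derivative_norm_bound[of 0 t "\<lambda>t. J t x" "\<lambda>t. S t x" "M * norm x"] t M J_deriv
      by (simp add: mult_ac)
  qed (use t in \<open>auto simp: J_plus J_scaleR\<close>)
qed

lemma J_quotient: "((\<lambda>h. J h x /\<^sub>R h) \<longlongrightarrow> x) (at_right 0)"
  using has_vector_derivative_right_quotient[OF J_deriv[of 0 x]] by simp

text \<open>By \<open>S_J\<close>, the difference quotient of \<open>J t x\<close> is the average of
  the orbit just after \<open>t\<close> minus its average just after \<open>0\<close>.\<close>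

lemma
  assumes t: "0 \<le> t"
  shows J_in_dom: "J t x \<in> D" and generator_J: "A (J t x) = S t x - x"
proof -
  have "((\<lambda>h. (J (t + h) x - J t x) /\<^sub>R h - J h x /\<^sub>R h) \<longlongrightarrow> S t x - x) (at_right 0)"
    by (intro tendsto_diff has_vector_derivative_right_quotient[OF J_deriv] J_quotient t)
  moreover have "\<forall>\<^sub>F h in at_right 0. (J (t + h) x - J t x) /\<^sub>R h - J h x /\<^sub>R h = (S h (J t x) - J t x) /\<^sub>R h"
    by (rule eventually_at_right_less[THEN eventually_mono]) (use t in \<open>simp add: S_J algebra_simps\<close>)
  ultimately have "((\<lambda>h. (S h (J t x) - J t x) /\<^sub>R h) \<longlongrightarrow> S t x - x) (at_right 0)"
    by (rule Lim_transform_eventually)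
  then show "J t x \<in> D" "A (J t x) = S t x - x" by (rule generator_domI, rule generator_eqI)
qed

text \<open>\<open>J t\<close> is bounded and commutes with the semigroup, hence with difference quotients.\<close>

lemma J_generator:
  assumes t: "0 \<le> t" and x: "x \<in> D"
  shows "J t (A x) = S t x - x"
proof -
  have "((\<lambda>h. J t ((S h x - x) /\<^sub>R h)) \<longlongrightarrow> J t (A x)) (at_right 0)"
    by (intro bounded_linear.tendsto[OF bounded_linear_J[OF t]] generator_lim x)
  moreover have "\<forall>\<^sub>F h in at_right 0. J t ((S h x - x) /\<^sub>R h) = (S h (J t x) - J t x) /\<^sub>R h"
  proof (rule eventually_at_right_less[THEN eventually_mono])
    fix h :: real assume "0 < h"
    then show "J t ((S h x - x) /\<^sub>R h) = (S h (J t x) - J t x) /\<^sub>R h"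
      using t linear_diff[OF bounded_linear.linear[OF bounded_linear_J[OF t]]]
      by (simp add: J_scaleR J_S S_J)
  qed
  ultimately have "((\<lambda>h. (S h (J t x) - J t x) /\<^sub>R h) \<longlongrightarrow> J t (A x)) (at_right 0)"
    by (rule Lim_transform_eventually)
  then show ?thesis using generator_eqI generator_J[OF t] by metis
qed

lemma S_eq_J: "0 \<le> t \<Longrightarrow> x \<in> D \<Longrightarrow> S t x = x + J t (A x)"
  by (simp add: J_generator)

text \<open>The orbit point is \<open>x\<close> plus an integral, and both lie in \<open>D\<close>;
  the generator maps the sum to \<open>A x + (S t (A x) - A x)\<close>.\<close>

lemma
  assumes t: "0 \<le> t" and x: "x \<in> D"
  shows S_in_dom: "S t x \<in> D" and generator_S: "A (S t x) = S t (A x)"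
  using t x generator_dom_add[OF x J_in_dom[OF t]] generator_add[OF x J_in_dom[OF t]]
  by (auto simp: S_eq_J[OF t x] generator_J)

text \<open>The squared norm weighted by \<open>exp (- (2 * \<omega> * s))\<close> is nonincreasing.
  The orbit is written as \<open>x + J s (A x)\<close>, which is differentiable from both sides also
  at \<open>s = 0\<close>.\<close>

lemma norm_S_le_dom:
  assumes t: "0 \<le> t" and x: "x \<in> D"
  shows "norm (S t x) \<le> exp (\<omega> * t) * norm x"
proof -
  define v where "v s = exp (- (2 * \<omega> * s)) * ((x + J s (A x)) \<bullet> (x + J s (A x)))" for s
  have "\<exists>d. (v has_real_derivative d) (at s) \<and> d \<le> 0" if s: "0 \<le> s" for s
  proof -
    have "((\<lambda>s. x + J s (A x)) has_derivative (\<lambda>h. h *\<^sub>R S s (A x))) (at s)"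
      using J_deriv[OF s, of "A x"] unfolding has_vector_derivative_def[symmetric]
      by (auto intro!: derivative_eq_intros)
    then have "((\<lambda>s. (x + J s (A x)) \<bullet> (x + J s (A x))) has_derivative
        (\<lambda>h. (x + J s (A x)) \<bullet> (h *\<^sub>R S s (A x)) + (h *\<^sub>R S s (A x)) \<bullet> (x + J s (A x)))) (at s)"
      by (rule has_derivative_inner) fact
    then have "((\<lambda>s. (x + J s (A x)) \<bullet> (x + J s (A x))) has_real_derivative
        2 * (A (S s x) \<bullet> S s x)) (at s)"
      unfolding has_field_derivative_def
      by (rule has_derivative_eq_rhs)
        (auto simp: S_eq_J[OF s x, symmetric] generator_S[OF s x] inner_commute algebra_simps)
    then have "(v has_real_derivative exp (- (2 * \<omega> * s)) * (2 * (A (S s x) \<bullet> S s x))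
        + (- (2 * \<omega>) * exp (- (2 * \<omega> * s))) * ((x + J s (A x)) \<bullet> (x + J s (A x)))) (at s)"
      unfolding v_def by (auto intro!: derivative_eq_intros)
    moreover have "exp (- (2 * \<omega> * s)) * (2 * (A (S s x) \<bullet> S s x))
        + (- (2 * \<omega>) * exp (- (2 * \<omega> * s))) * ((x + J s (A x)) \<bullet> (x + J s (A x))) \<le> 0"
    proof -
      have "exp (- (2 * \<omega> * s)) * (2 * (A (S s x) \<bullet> S s x - \<omega> * (norm (S s x))\<^sup>2)) \<le> 0"
        using dissipative[OF S_in_dom[OF s x]] by (intro mult_nonneg_nonpos) auto
      then show ?thesis
        by (simp add: S_eq_J[OF s x, symmetric] power2_norm_eq_inner algebra_simps)
    qed
    ultimately show ?thesis by blast
  qed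
  then have "v t \<le> v 0" using t by (intro DERIV_nonpos_imp_nonincreasing[of 0 t v]) auto
  then have "exp (- (2 * \<omega> * t)) * (norm (S t x))\<^sup>2 \<le> (norm x)\<^sup>2"
    by (simp add: v_def S_eq_J[OF t x] power2_norm_eq_inner)
  then have "exp (2 * \<omega> * t) * (exp (- (2 * \<omega> * t)) * (norm (S t x))\<^sup>2) \<le> exp (2 * \<omega> * t) * (norm x)\<^sup>2"
    by (intro mult_left_mono) auto
  then have "(norm (S t x))\<^sup>2 \<le> (exp (\<omega> * t) * norm x)\<^sup>2"
    by (simp add: mult.assoc[symmetric] exp_minus power_mult_distrib exp_double[symmetric])
  then show ?thesis by (rule power2_le_imp_le) simp
qed

lemma generator_dom_seq: "\<exists>d. (\<forall>n. d n \<in> D) \<and> d \<longlonglongrightarrow> x"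
proof -
  \<comment> \<open>Averages of the orbit over shrinking time intervals.\<close>
  define d where "d n = J (1 / Suc n) x /\<^sub>R (1 / Suc n)" for n
  have "filterlim (\<lambda>n. 1 / real (Suc n)) (at_right 0) sequentially"
    using LIMSEQ_inverse_real_of_nat
    by (auto simp: filterlim_at inverse_eq_divide intro!: always_eventually)
  from filterlim_compose[OF J_quotient this] have "d \<longlonglongrightarrow> x" by (simp add: d_def[abs_def])
  moreover have "d n \<in> D" for n unfolding d_def by (intro generator_dom_scaleR J_in_dom) simp
  ultimately show ?thesis by blast
qed

lemma generator_dom_dense: "\<epsilon> > 0 \<Longrightarrow> \<exists>d\<in>D. norm (x - d) < \<epsilon>"
  using generator_dom_seq[of x] by (metis LIMSEQ_iff le_refl norm_minus_commute)

lemma norm_S_le: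
  assumes t: "0 \<le> t"
  shows "norm (S t x) \<le> exp (\<omega> * t) * norm x"
proof -
  obtain d where d: "\<And>n. d n \<in> D" "d \<longlonglongrightarrow> x" using generator_dom_seq by metis
  show ?thesis
  proof (rule LIMSEQ_le)
    show "(\<lambda>n. norm (S t (d n))) \<longlonglongrightarrow> norm (S t x)"
      by (intro tendsto_norm bounded_linear.tendsto[OF bounded_linear_S[OF t]] d)
    show "(\<lambda>n. exp (\<omega> * t) * norm (d n)) \<longlonglongrightarrow> exp (\<omega> * t) * norm x"
      by (intro tendsto_intros d)
  qed (use norm_S_le_dom[OF t d(1)] in blast)
qed

lemma norm_J_diff_le:
  assumes "0 \<le> s" "s \<le> t"
  shows "norm (J t x - J s x) \<le> exp (\<omega> * t) * norm x * (t - s)"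
proof (rule has_vector_derivative_norm_bound[OF assms(2)])
  fix r assume r: "r \<in> {s..t}"
  then show "((\<lambda>t. J t x) has_vector_derivative S r x) (at r)" using assms by (intro J_deriv) auto
  have "norm (S r x) \<le> exp (\<omega> * r) * norm x" using r assms by (intro norm_S_le) auto
  also have "\<dots> \<le> exp (\<omega> * t) * norm x"
    using r \<omega>_nonneg by (intro mult_right_mono) (auto intro: mult_left_mono)
  finally show "norm (S r x) \<le> exp (\<omega> * t) * norm x" .
qed

lemma norm_J_le: "0 \<le> t \<Longrightarrow> norm (J t x) \<le> exp (\<omega> * t) * norm x * t"
  using norm_J_diff_le[of 0 t x] by simp

end

section \<open>Weak solutions of perturbed equations\<close>

text \<open>Sampling at the left end of the grid cell of width \<open>1 / Suc n\<close> gives a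
  simple function, as finitely many cells meet \<open>{0..T}\<close>, and it converges wherever
  \<open>f\<close> is continuous.\<close>

lemma strongly_measurable_AE_continuous:
  fixes f :: "real \<Rightarrow> 'a::topological_space"
  assumes N: "negligible N" and f: "\<And>t. t \<in> {0<..<T} - N \<Longrightarrow> isCont f t"
  shows "strongly_measurable (lebesgue_on {0..T}) f"
  unfolding strongly_measurable_def
proof (intro exI[of _ "\<lambda>n t. f (real_of_int \<lfloor>real (Suc n) * t\<rfloor> / real (Suc n))"] conjI allI)
  fix n
  have "simple_function (lebesgue_on {0..T}) (\<lambda>t. \<lfloor>real (Suc n) * t\<rfloor>)"
    unfolding simple_function_def
  proof (intro conjI ballI)
    have "(\<lambda>t. \<lfloor>real (Suc n) * t\<rfloor>) ` {0..T} \<subseteq> {0..\<lfloor>real (Suc n) * T\<rfloor>}"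
      by (auto intro!: floor_mono mult_left_mono simp del: of_nat_Suc)
    then show "finite ((\<lambda>t. \<lfloor>real (Suc n) * t\<rfloor>) ` space (lebesgue_on {0..T}))"
      by (simp add: finite_subset)
    have "(\<lambda>t. \<lfloor>real (Suc n) * t\<rfloor>) \<in> measurable (lebesgue_on {0..T}) (count_space UNIV)"
      by (intro measurable_restrict_space1 measurable_completion) measurable
    then show "(\<lambda>t. \<lfloor>real (Suc n) * t\<rfloor>) -` {x} \<inter> space (lebesgue_on {0..T}) \<in> sets (lebesgue_on {0..T})" for x
      by (rule measurable_sets) simp
  qed
  then show "simple_function (lebesgue_on {0..T}) (\<lambda>t. f (real_of_int \<lfloor>real (Suc n) * t\<rfloor> / real (Suc n)))"
    by (rule simple_function_compose1)
next
  have *: "(\<lambda>n. f (real_of_int \<lfloor>real (Suc n) * t\<rfloor> / real (Suc n))) \<longlonglongrightarrow> f t" if "isCont f t" for t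
  proof (rule isCont_tendsto_compose[OF that])
    show "(\<lambda>n. real_of_int \<lfloor>real (Suc n) * t\<rfloor> / real (Suc n)) \<longlonglongrightarrow> t"
    proof (rule tendsto_sandwich)
      show "(\<lambda>n. t - 1 / real (Suc n)) \<longlonglongrightarrow> t"
        using tendsto_diff[OF tendsto_const LIMSEQ_inverse_real_of_nat, of t] by (simp add: inverse_eq_divide)
      show "\<forall>\<^sub>F n in sequentially. t - 1 / real (Suc n) \<le> real_of_int \<lfloor>real (Suc n) * t\<rfloor> / real (Suc n)"
      proof (intro always_eventually allI)
        fix n
        have "t - 1 / real (Suc n) = (real (Suc n) * t - 1) / real (Suc n)"
          by (simp add: diff_divide_distrib del: of_nat_Suc)
        also have "\<dots> \<le> real_of_int \<lfloor>real (Suc n) * t\<rfloor> / real (Suc n)"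
          by (intro divide_right_mono) linarith+
        finally show "t - 1 / real (Suc n) \<le> real_of_int \<lfloor>real (Suc n) * t\<rfloor> / real (Suc n)" .
      qed
      show "\<forall>\<^sub>F n in sequentially. real_of_int \<lfloor>real (Suc n) * t\<rfloor> / real (Suc n) \<le> t"
      proof (intro always_eventually allI)
        fix n
        have "real_of_int \<lfloor>real (Suc n) * t\<rfloor> / real (Suc n) \<le> (real (Suc n) * t) / real (Suc n)"
          by (intro divide_right_mono) linarith+
        also have "\<dots> = t" by (simp del: of_nat_Suc)
        finally show "real_of_int \<lfloor>real (Suc n) * t\<rfloor> / real (Suc n) \<le> t" .
      qed
    qed simp
  qed
  have "negligible (N \<union> {0, T})" by (rule negligible_Un[OF N negligible_finite]) simp
  then have "AE t in lebesgue. t \<notin> N \<union> {0, T}"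
    by (intro AE_not_in) (simp add: negligible_iff_null_sets)
  then have "AE t in lebesgue_on {0..T}. t \<notin> N \<union> {0, T}"
    by (subst AE_restrict_space_iff) auto
  moreover have "AE t in lebesgue_on {0..T}. t \<in> {0..T}"
    by (rule AE_I2) simp
  ultimately show "AE t in lebesgue_on {0..T}. (\<lambda>n. f (real_of_int \<lfloor>real (Suc n) * t\<rfloor> / real (Suc n))) \<longlonglongrightarrow> f t"
  proof eventually_elim
    case (elim t)
    then show ?case by (intro * f) (auto simp: less_le)
  qed
qed

lemma lipschitz_on_join:
  fixes f :: "real \<Rightarrow> 'a::metric_space"
  assumes "C-lipschitz_on {a..b} f" "C-lipschitz_on {b..c} f"
  shows "C-lipschitz_on {a..c} f"
  using lipschitz_on_concat[OF assms refl] by simp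

lemma L1_norm_le:
  assumes "\<And>t. t \<in> {0..T} \<Longrightarrow> norm (f t) \<le> B" "0 \<le> B" "0 \<le> T"
  shows "L1_norm T f \<le> ennreal (B * T)"
proof -
  have "L1_norm T f \<le> (\<integral>\<^sup>+t. ennreal B \<partial>lebesgue_on {0..T})"
    unfolding L1_norm_def by (rule nn_integral_mono, rule ennreal_leI, rule assms(1)) simp
  also have "\<dots> = ennreal (B * T)"
    using assms by (simp add: emeasure_restrict_space ennreal_mult)
  finally show ?thesis .
qed

lemma continuous_on_atLeastI:
  fixes f :: "real \<Rightarrow> 'a::topological_space"
  assumes "\<And>T. T > a \<Longrightarrow> continuous_on {a..T} f"
  shows "continuous_on {a..} f"
  unfolding continuous_on_eq_continuous_within
proof
  fix t assume t: "t \<in> {a..}"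
  have "continuous (at t within {a..t+1}) f"
    using assms[of "t + 1"] t by (auto simp: continuous_on_eq_continuous_within)
  moreover have "at t within {a..} = at t within {a..t+1}"
    by (rule at_within_nhd[of t "{..<t+1}"]) auto
  ultimately show "continuous (at t within {a..}) f" by simp
qed

lemma ex_antiderivative_atLeast:
  fixes f :: "real \<Rightarrow> 'h::{real_normed_vector, complete_space}"
  assumes "continuous_on {0..} f"
  shows "\<exists>g. \<forall>t\<ge>0. (g has_vector_derivative f t) (at t)"
proof -
  have "continuous_on UNIV (f \<circ> (\<lambda>t. max 0 t))"
    by (intro continuous_on_compose continuous_intros continuous_on_subset[OF assms]) auto
  from ex_antiderivative[OF this]
  obtain g where "\<forall>t. (g has_vector_derivative (f \<circ> (\<lambda>t. max 0 t)) t) (at t)" by blast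
  then have "\<forall>t\<ge>0. (g has_vector_derivative f t) (at t)"
    by (metis comp_apply max_absorb2)
  then show ?thesis by blast
qed

text \<open>The properties of the feedback loop that give well-posedness. \<open>F\<close> is total
  and carries the estimates, whereas \<open>G\<close> is tied to \<open>A - F\<close> only on
  \<open>D\<close>, outside of which the values of \<open>A\<close> have no meaning.\<close>

locale perturbed_semigroup = quasi_contractive_semigroup D A S \<omega>
  for D :: "'h::{real_inner, complete_space} set" and A S \<omega> +
  fixes F G :: "'h \<Rightarrow> 'h" and c :: real
  assumes c_nonneg: "0 \<le> c"
    and monotone: "- c * (norm (x - y))\<^sup>2 \<le> (F x - F y) \<bullet> (x - y)"
    and lipschitz_approx: "0 < \<epsilon> \<Longrightarrow> \<exists>F' \<Lambda>. \<Lambda>-lipschitz_on UNIV F' \<and> (\<forall>x. norm (F x - F' x) \<le> \<epsilon>)"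
    and G_eq: "x \<in> D \<Longrightarrow> G x = A x - F x"
begin

lemma uniformly_continuous_F: "uniformly_continuous_on UNIV F"
  unfolding uniformly_continuous_on_def
proof (intro allI impI)
  fix e :: real assume e: "0 < e"
  then obtain F' \<Lambda> where F': "\<Lambda>-lipschitz_on UNIV F'" "\<And>x. norm (F x - F' x) \<le> e / 4"
    using lipschitz_approx[of "e / 4"] by auto
  have \<Lambda>: "\<Lambda> \<ge> 0" using F'(1) by (rule lipschitz_on_nonneg)
  have "dist (F y) (F x) < e" if "dist y x < e / (4 * (\<Lambda> + 1))" for x y
  proof -
    have "norm (F' y - F' x) \<le> \<Lambda> * norm (y - x)"
      using lipschitz_onD[OF F'(1), of y x] by (simp add: dist_norm)
    also have "\<dots> \<le> (\<Lambda> + 1) * (e / (4 * (\<Lambda> + 1)))"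
      using that \<Lambda> by (intro mult_mono) (auto simp: dist_norm)
    also have "\<dots> = e / 4"
      using \<Lambda> by (subst times_divide_eq_right, subst nonzero_divide_eq_eq) (auto simp: algebra_simps)
    finally have 1: "norm (F' y - F' x) \<le> e / 4" .
    have eq: "F y - F x = (F y - F' y) + (F' y - F' x) - (F x - F' x)" by simp
    have "norm (F y - F x) \<le> norm (F y - F' y) + norm (F' y - F' x) + norm (F x - F' x)"
      unfolding eq using norm_triangle_ineq[of "F y - F' y" "F' y - F' x"]
        norm_triangle_ineq4[of "F y - F' y + (F' y - F' x)" "F x - F' x"] by linarith
    also have "\<dots> < e" using 1 F'(2)[of x] F'(2)[of y] e by linarith
    finally show ?thesis by (simp add: dist_norm)
  qed
  moreover have "e / (4 * (\<Lambda> + 1)) > 0" using e \<Lambda> by simp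
  ultimately show "\<exists>d>0. \<forall>x\<in>UNIV. \<forall>x'\<in>UNIV. dist x' x < d \<longrightarrow> dist (F x') (F x) < e" by blast
qed

lemma continuous_on_F: "continuous_on UNIV F"
  by (rule uniformly_continuous_imp_continuous[OF uniformly_continuous_F])

lemma strong_solutionE:
  assumes "strong_solution D G f T y"
  obtains N where "continuous_on {0..T} y"
    "\<And>s t. 0 < s \<Longrightarrow> s \<le> t \<Longrightarrow> t < T \<Longrightarrow> abs_continuous_on {s..t} y" "negligible N"
    "\<And>t. t \<in> {0<..<T} - N \<Longrightarrow> y t \<in> D \<and> (y has_vector_derivative A (y t) - F (y t) + f t) (at t)"
proof -
  from assms have ae: "AE t in lebesgue_on {0<..<T}. y t \<in> D \<and> (y has_vector_derivative (G (y t) + f t)) (at t)"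
    and c: "continuous_on {0..T} y" and ac: "\<And>K. compact K \<Longrightarrow> K \<subseteq> {0<..<T} \<Longrightarrow> abs_continuous_on K y"
    by (auto simp: strong_solution_def)
  obtain N where N: "negligible N" "\<And>t. t \<in> {0<..<T} - N \<Longrightarrow> y t \<in> D \<and> (y has_vector_derivative (G (y t) + f t)) (at t)"
    using AE_lebesgue_on_negligible[OF ae] by blast
  show ?thesis
  proof (rule that[OF c _ N(1)])
    show "abs_continuous_on {s..t} y" if "0 < s" "s \<le> t" "t < T" for s t
      using that by (intro ac) auto
    show "y t \<in> D \<and> (y has_vector_derivative A (y t) - F (y t) + f t) (at t)" if "t \<in> {0<..<T} - N" for t
      using N(2)[OF that] G_eq by auto
  qed
qed

text \<open>When the equation for the difference is tested with the difference itself, dissipativity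
  contributes the rate \<open>\<omega>\<close>, monotonicity the rate \<open>c\<close>, and the
  forcings enter linearly.\<close>

lemma strong_solution_diff_le:
  assumes Y: "strong_solution D G f T Y" "in_L1 T f" and Z: "strong_solution D G g T Z" "in_L1 T g"
    and t: "t \<in> {0..T}"
  shows "ennreal (norm (Y t - Z t)) \<le>
    ennreal (exp ((\<omega> + c) * T)) * (ennreal (norm (Y 0 - Z 0)) + (L1_norm T f + L1_norm T g))"
proof -
  obtain N1 where N1: "continuous_on {0..T} Y"
    "\<And>s t. 0 < s \<Longrightarrow> s \<le> t \<Longrightarrow> t < T \<Longrightarrow> abs_continuous_on {s..t} Y" "negligible N1"
    "\<And>t. t \<in> {0<..<T} - N1 \<Longrightarrow> Y t \<in> D \<and> (Y has_vector_derivative A (Y t) - F (Y t) + f t) (at t)"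
    using strong_solutionE[OF Y(1)] by metis
  obtain N2 where N2: "continuous_on {0..T} Z"
    "\<And>s t. 0 < s \<Longrightarrow> s \<le> t \<Longrightarrow> t < T \<Longrightarrow> abs_continuous_on {s..t} Z" "negligible N2"
    "\<And>t. t \<in> {0<..<T} - N2 \<Longrightarrow> Z t \<in> D \<and> (Z has_vector_derivative A (Z t) - F (Z t) + g t) (at t)"
    using strong_solutionE[OF Z(1)] by metis
  have "ennreal (norm (Y t - Z t)) \<le> ennreal (exp ((\<omega> + c) * (T - 0))) * (ennreal (norm (Y 0 - Z 0)) +
      (\<integral>\<^sup>+x. ennreal (norm (f x) + norm (g x)) \<partial>lebesgue_on {0..T}))"
  proof (rule abs_continuous_energy[where N = "N1 \<union> N2"])
    show "continuous_on {0..T} (\<lambda>t. Y t - Z t)" by (intro continuous_intros N1 N2)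
    show "abs_continuous_on {s..t} (\<lambda>t. Y t - Z t)" if st: "0 < s" "s \<le> t" "t < T" for s t
    proof (rule abs_continuous_onI_dist[OF N1(2)[OF st] N2(2)[OF st], of 1 1])
      show "dist (Y x - Z x) (Y y - Z y) \<le> 1 * dist (Y x) (Y y) + 1 * dist (Z x) (Z y)" for x y
        using norm_triangle_ineq4[of "Y x - Y y" "Z x - Z y"] by (simp add: dist_norm algebra_simps)
    qed auto
    fix r assume r: "r \<in> {0<..<T} - (N1 \<union> N2)"
    then have y: "Y r \<in> D" "(Y has_vector_derivative A (Y r) - F (Y r) + f r) (at r)"
      and z: "Z r \<in> D" "(Z has_vector_derivative A (Z r) - F (Z r) + g r) (at r)"
      using N1(4)[of r] N2(4)[of r] by auto
    let ?w = "Y r - Z r"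
    let ?d = "A (Y r) - F (Y r) + f r - (A (Z r) - F (Z r) + g r)"
    have d: "?d = A ?w - (F (Y r) - F (Z r)) + (f r - g r)"
      using y(1) z(1) by (simp add: generator_diff)
    have "?w \<bullet> ?d = A ?w \<bullet> ?w - (F (Y r) - F (Z r)) \<bullet> ?w + ?w \<bullet> (f r - g r)"
      unfolding d by (simp add: inner_diff_right inner_add_right inner_commute)
    also have "\<dots> \<le> \<omega> * (norm ?w)\<^sup>2 + c * (norm ?w)\<^sup>2 + (norm (f r) + norm (g r)) * norm ?w"
    proof -
      have "?w \<bullet> (f r - g r) \<le> norm ?w * norm (f r - g r)" by (rule norm_cauchy_schwarz)
      also have "\<dots> \<le> norm ?w * (norm (f r) + norm (g r))"
        by (intro mult_left_mono norm_triangle_ineq4) auto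
      finally show ?thesis
        using dissipative[OF generator_dom_diff[OF y(1) z(1)]] monotone[of "Y r" "Z r"]
        by (simp add: algebra_simps)
    qed
    finally show "\<exists>d. ((\<lambda>t. Y t - Z t) has_vector_derivative d) (at r) \<and>
        ?w \<bullet> d \<le> (\<omega> + c) * (norm ?w)\<^sup>2 + (norm (f r) + norm (g r)) * norm ?w"
      using has_vector_derivative_diff[OF y(2) z(2)] by (auto simp: algebra_simps intro!: exI[of _ ?d])
  qed (use N1(3) N2(3) c_nonneg \<omega>_nonneg t in auto)
  then show ?thesis using nn_integral_L1_add[OF Y(2) Z(2)] by simp
qed

lemma weak_solutionE:
  assumes "weak_solution D G y0 y" "0 < T"
  obtains Y f where "\<And>n::nat. in_L1 T (f n)" "\<And>n. strong_solution D G (f n) T (Y n)"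
    "(\<lambda>n. L1_norm T (f n)) \<longlonglongrightarrow> 0" "uniform_limit {0..T} Y y sequentially"
proof -
  from assms obtain Y f where "\<forall>n. in_L1 T (f n) \<and> strong_solution D G (f n) T (Y n)"
    "(\<lambda>n. L1_norm T (f n)) \<longlonglongrightarrow> 0" "uniform_limit {0..T} Y y sequentially"
    unfolding weak_solution_def by blast
  then show ?thesis using that[of f Y] by blast
qed

lemma weak_solution_diff_le:
  assumes y: "weak_solution D G y0 y" and z: "weak_solution D G z0 z" and t: "0 \<le> t" "t \<le> T" and T: "0 < T"
  shows "norm (y t - z t) \<le> exp ((\<omega> + c) * T) * norm (y0 - z0)"
proof -
  obtain Y f where Y: "\<And>n::nat. in_L1 T (f n)" "\<And>n. strong_solution D G (f n) T (Y n)"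
    "(\<lambda>n. L1_norm T (f n)) \<longlonglongrightarrow> 0" "uniform_limit {0..T} Y y sequentially"
    using weak_solutionE[OF y T] by metis
  obtain Z g where Z: "\<And>n::nat. in_L1 T (g n)" "\<And>n. strong_solution D G (g n) T (Z n)"
    "(\<lambda>n. L1_norm T (g n)) \<longlonglongrightarrow> 0" "uniform_limit {0..T} Z z sequentially"
    using weak_solutionE[OF z T] by metis
  have lim: "(\<lambda>n. norm (Y n s - Z n s)) \<longlonglongrightarrow> norm (y s - z s)" if "s \<in> {0..T}" for s
    by (intro tendsto_intros tendsto_uniform_limitI[OF Y(4) that] tendsto_uniform_limitI[OF Z(4) that])
  have "ennreal (norm (y t - z t)) \<le> ennreal (exp ((\<omega> + c) * T)) * (ennreal (norm (y 0 - z 0)) + (0 + 0))"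
  proof (rule LIMSEQ_le)
    show "(\<lambda>n. ennreal (norm (Y n t - Z n t))) \<longlonglongrightarrow> ennreal (norm (y t - z t))"
      using t by (intro tendsto_ennrealI lim) auto
    show "(\<lambda>n. ennreal (exp ((\<omega> + c) * T)) * (ennreal (norm (Y n 0 - Z n 0)) + (L1_norm T (f n) + L1_norm T (g n))))
      \<longlonglongrightarrow> ennreal (exp ((\<omega> + c) * T)) * (ennreal (norm (y 0 - z 0)) + (0 + 0))"
      using T by (intro ennreal_tendsto_cmult tendsto_add tendsto_ennrealI lim Y Z) auto
    show "\<exists>N. \<forall>n\<ge>N. ennreal (norm (Y n t - Z n t)) \<le> ennreal (exp ((\<omega> + c) * T)) *
        (ennreal (norm (Y n 0 - Z n 0)) + (L1_norm T (f n) + L1_norm T (g n)))"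
      using t by (intro exI allI impI strong_solution_diff_le Y Z) auto
  qed
  moreover have "y 0 = y0" "z 0 = z0" using y z by (auto simp: weak_solution_def)
  ultimately show ?thesis by (simp flip: ennreal_mult)
qed

section \<open>Existence and uniqueness of weak solutions\<close>

text \<open>Explicit Euler scheme: the nonlinearity is frozen on every time step, so that the step is solved
  by \<open>J\<close>.  Since \<open>v\<close> is the initial velocity of a step, the steps have size \<open>O(h)\<close>.\<close>

primrec euler :: "('h \<Rightarrow> 'h) \<Rightarrow> 'h \<Rightarrow> real \<Rightarrow> nat \<Rightarrow> 'h" where
  "euler F' x h 0 = x"
| "euler F' x h (Suc k) = euler F' x h k + J h (A (euler F' x h k) - F' (euler F' x h k))"

text \<open>On a step from \<open>X k\<close>, the curve \<open>X k + J s (v k)\<close> solves the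
  equation with the nonlinear term frozen at \<open>F' (X k)\<close>. The defect \<open>f\<close> is
  therefore \<open>F\<close> at the moving point minus \<open>F'\<close> at the start of the step,
  at most \<open>\<epsilon>\<close> plus \<open>\<Lambda>\<close> times the displacement, and the
  displacement is controlled by the velocities.\<close>

lemma euler_solution:
  assumes x: "x \<in> D" and F': "\<Lambda>-lipschitz_on UNIV F'" "\<And>x. norm (F x - F' x) \<le> \<epsilon>" and h: "0 < h"
  shows "\<exists>Y f. Y 0 = x \<and> (\<forall>T>0. in_L1 T f \<and> strong_solution D G f T Y) \<and>
    (\<forall>T\<ge>0. \<forall>t\<in>{0..T}. norm (f t) \<le> \<epsilon> + \<Lambda> * h * (exp (\<omega> * h) * (exp ((\<omega> + \<Lambda>) * T) * norm (A x - F' x))))"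
proof -
  define X where "X = euler F' x h"
  define v where "v k = A (X k) - F' (X k)" for k
  define Y where "Y t = X (nat \<lfloor>t / h\<rfloor>) + J (t - real (nat \<lfloor>t / h\<rfloor>) * h) (v (nat \<lfloor>t / h\<rfloor>))" for t
  define f where "f t = F (Y t) - F' (X (nat \<lfloor>t / h\<rfloor>))" for t
  define V where "V T = exp ((\<omega> + \<Lambda>) * T) * norm (A x - F' x)" for T
  have \<Lambda>: "\<Lambda> \<ge> 0" using F'(1) by (rule lipschitz_on_nonneg)
  have F'_le: "norm (F' a - F' b) \<le> \<Lambda> * norm (a - b)" for a b
    using lipschitz_onD[OF F'(1), of a b] by (simp add: dist_norm)
  have \<epsilon>: "\<epsilon> \<ge> 0" using F'(2)[of 0] norm_ge_zero order_trans by blast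
  have X_Suc: "X (Suc k) = X k + J h (v k)" for k by (simp add: X_def v_def)
  have X_dom: "X k \<in> D" for k
    using x h by (induction k) (auto simp: X_Suc intro!: generator_dom_add J_in_dom, simp add: X_def)
  have v_Suc: "v (Suc k) = S h (v k) + (F' (X k) - F' (X (Suc k)))" for k
    using h X_dom[of k] by (simp add: v_def[of "Suc k"] X_Suc generator_add J_in_dom generator_J)
      (simp add: v_def)
  have v_le: "norm (v k) \<le> V (real k * h)" for k
  proof (induction k)
    case 0
    show ?case by (simp add: V_def v_def X_def)
  next
    case (Suc k)
    have "norm (v (Suc k)) \<le> norm (S h (v k)) + norm (F' (X k) - F' (X (Suc k)))"
      unfolding v_Suc by (rule norm_triangle_ineq)
    also have "\<dots> \<le> exp (\<omega> * h) * norm (v k) + \<Lambda> * (exp (\<omega> * h) * norm (v k) * h)"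
    proof (rule add_mono)
      show "norm (S h (v k)) \<le> exp (\<omega> * h) * norm (v k)" using h by (intro norm_S_le) simp
      have "norm (F' (X k) - F' (X (Suc k))) \<le> \<Lambda> * norm (J h (v k))"
        using F'_le[of "X k" "X (Suc k)"] by (simp add: X_Suc)
      also have "\<dots> \<le> \<Lambda> * (exp (\<omega> * h) * norm (v k) * h)"
        using h \<Lambda> by (intro mult_left_mono norm_J_le) auto
      finally show "norm (F' (X k) - F' (X (Suc k))) \<le> \<Lambda> * (exp (\<omega> * h) * norm (v k) * h)" .
    qed
    also have "\<dots> = (1 + \<Lambda> * h) * (exp (\<omega> * h) * norm (v k))" by (simp add: algebra_simps)
    also have "\<dots> \<le> exp (\<Lambda> * h) * (exp (\<omega> * h) * norm (v k))"
      by (intro mult_right_mono exp_ge_add_one_self) auto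
    also have "\<dots> \<le> exp (\<Lambda> * h) * (exp (\<omega> * h) * V (real k * h))"
      by (intro mult_left_mono Suc) auto
    also have "\<dots> = V (real (Suc k) * h)"
    proof -
      have "exp (\<Lambda> * h) * (exp (\<omega> * h) * exp ((\<omega> + \<Lambda>) * (real k * h))) = exp ((\<omega> + \<Lambda>) * (real (Suc k) * h))"
        unfolding exp_add[symmetric] by (simp add: algebra_simps)
      then show ?thesis unfolding V_def by (metis mult.assoc)
    qed
    finally show ?case .
  qed
  have V_mono: "V s \<le> V t" if "s \<le> t" for s t
    unfolding V_def using that \<Lambda> \<omega>_nonneg by (intro mult_right_mono) (auto intro: mult_left_mono)
  have V_nonneg: "V t \<ge> 0" for t by (simp add: V_def)
  have floor_eq: "nat \<lfloor>t / h\<rfloor> = k" if "real k * h \<le> t" "t < real (Suc k) * h" for t k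
  proof -
    have "\<lfloor>t / h\<rfloor> = int k" using that h by (intro floor_unique) (auto simp: field_simps)
    then show ?thesis by simp
  qed
  have floor_bounds: "real (nat \<lfloor>t / h\<rfloor>) * h \<le> t" "t < real (Suc (nat \<lfloor>t / h\<rfloor>)) * h" if "0 \<le> t" for t
  proof -
    have "real (nat \<lfloor>t / h\<rfloor>) = real_of_int \<lfloor>t / h\<rfloor>" using that h by simp
    then have "real (nat \<lfloor>t / h\<rfloor>) \<le> t / h" "t / h < real (nat \<lfloor>t / h\<rfloor>) + 1" by linarith+
    then show "real (nat \<lfloor>t / h\<rfloor>) * h \<le> t" "t < real (Suc (nat \<lfloor>t / h\<rfloor>)) * h"
      using h by (auto simp: field_simps)
  qed
  have Y_eq: "Y t = X k + J (t - real k * h) (v k)" if "real k * h \<le> t" "t \<le> real (Suc k) * h" for t k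
  proof (cases "t = real (Suc k) * h")
    case True
    then have "nat \<lfloor>t / h\<rfloor> = Suc k" using h by (intro floor_eq) (auto simp: algebra_simps)
    then show ?thesis using True by (simp add: Y_def X_Suc) (simp add: algebra_simps)
  next
    case False
    then have "nat \<lfloor>t / h\<rfloor> = k" using that by (intro floor_eq) auto
    then show ?thesis by (simp add: Y_def)
  qed
  have lip_step: "(exp (\<omega> * h) * V (real k * h))-lipschitz_on {real k * h..real (Suc k) * h} Y" for k
  proof (rule lipschitz_on_leI)
    fix s t assume st: "s \<in> {real k * h..real (Suc k) * h}" "t \<in> {real k * h..real (Suc k) * h}" "s \<le> t"
    then have "dist (Y s) (Y t) = norm (J (t - real k * h) (v k) - J (s - real k * h) (v k))"
      using Y_eq[where k = k and t = s] Y_eq[where k = k and t = t]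
      by (simp add: dist_norm norm_minus_commute del: of_nat_Suc)
    also have "\<dots> \<le> exp (\<omega> * (t - real k * h)) * norm (v k) * ((t - real k * h) - (s - real k * h))"
      using st by (intro norm_J_diff_le) auto
    also have "\<dots> \<le> exp (\<omega> * h) * V (real k * h) * (t - s)"
    proof -
      have "t - real k * h \<le> h" using st by (simp add: algebra_simps)
      then have "exp (\<omega> * (t - real k * h)) \<le> exp (\<omega> * h)"
        using \<omega>_nonneg by (simp add: mult_left_mono)
      then show ?thesis using st v_le[of k] V_nonneg by (intro mult_mono) auto
    qed
    finally show "dist (Y s) (Y t) \<le> exp (\<omega> * h) * V (real k * h) * dist s t"
      using st(3) by (simp add: dist_real_def)
  qed (simp add: V_nonneg)
  have lip_n: "(exp (\<omega> * h) * V (real n * h))-lipschitz_on {0..real n * h} Y" for n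
  proof (induction n)
    case 0
    show ?case by (rule lipschitz_onI) (auto simp: V_nonneg)
  next
    case (Suc n)
    have le: "exp (\<omega> * h) * V (real n * h) \<le> exp (\<omega> * h) * V (real (Suc n) * h)"
      using h by (intro mult_left_mono V_mono) (auto simp: algebra_simps)
    show ?case
      by (rule lipschitz_on_join[where b = "real n * h"])
        (use Suc lip_step[of n] le in \<open>auto intro: lipschitz_on_le\<close>)
  qed
  have lip: "\<exists>C. C-lipschitz_on {0..T} Y" for T
  proof -
    obtain n where "T / h \<le> real n" using real_arch_simple by blast
    then have "{0..T} \<subseteq> {0..real n * h}" using h by (auto simp: field_simps)
    then show ?thesis using lip_n lipschitz_on_subset by blast
  qed
  \<comment> \<open>The grid times, where \<open>Y\<close> may have corners and \<open>f\<close> may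
    jump.\<close>
  define N where "N = range (\<lambda>k::nat. real k * h)"
  have N: "negligible N" unfolding N_def negligible_iff_null_sets
    by (intro null_sets_completionI countable_imp_null_set_lborel) simp
  have inner: "real (nat \<lfloor>t / h\<rfloor>) * h < t" "t < real (Suc (nat \<lfloor>t / h\<rfloor>)) * h" if "0 < t" "t \<notin> N" for t
  proof -
    have "real (nat \<lfloor>t / h\<rfloor>) * h \<noteq> t" using that(2) unfolding N_def by (metis rangeI)
    then show "real (nat \<lfloor>t / h\<rfloor>) * h < t" "t < real (Suc (nat \<lfloor>t / h\<rfloor>)) * h"
      using floor_bounds[of t] that(1) by auto
  qed
  have nbhd: "\<forall>\<^sub>F s in nhds t. nat \<lfloor>s / h\<rfloor> = nat \<lfloor>t / h\<rfloor> \<and>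
      Y s = X (nat \<lfloor>t / h\<rfloor>) + J (s - real (nat \<lfloor>t / h\<rfloor>) * h) (v (nat \<lfloor>t / h\<rfloor>))"
    if "0 < t" "t \<notin> N" for t
  proof -
    have "\<forall>\<^sub>F s in nhds t. s \<in> {real (nat \<lfloor>t / h\<rfloor>) * h<..<real (Suc (nat \<lfloor>t / h\<rfloor>)) * h}"
      by (rule eventually_nhds_in_open) (use inner[OF that] in auto)
    then show ?thesis
      by eventually_elim (use floor_eq Y_eq in \<open>auto simp del: of_nat_Suc\<close>)
  qed
  have Y_deriv: "(Y has_vector_derivative S (t - real (nat \<lfloor>t / h\<rfloor>) * h) (v (nat \<lfloor>t / h\<rfloor>))) (at t)"
    if t: "0 < t" "t \<notin> N" for t
  proof -
    let ?k = "nat \<lfloor>t / h\<rfloor>"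
    have "((\<lambda>s. X ?k + J (s + - (real ?k * h)) (v ?k)) has_vector_derivative 0 + S (t + - (real ?k * h)) (v ?k)) (at t)"
      using floor_bounds(1)[of t] t
      by (intro has_vector_derivative_add has_vector_derivative_const J_deriv_shift) auto
    then have *: "((\<lambda>s. X ?k + J (s - real ?k * h) (v ?k)) has_vector_derivative S (t - real ?k * h) (v ?k)) (at t)"
      by simp
    have "((\<lambda>s. X ?k + J (s - real ?k * h) (v ?k)) has_vector_derivative S (t - real ?k * h) (v ?k)) (at t)
      \<longleftrightarrow> (Y has_vector_derivative S (t - real ?k * h) (v ?k)) (at t)"
      by (rule has_vector_derivative_cong_ev)
        (use nbhd[OF t] in \<open>auto elim: eventually_mono simp: Y_def\<close>)
    with * show ?thesis by simp
  qed
  have Y_dom: "Y t \<in> D" and f_eq: "G (Y t) + f t = S (t - real (nat \<lfloor>t / h\<rfloor>) * h) (v (nat \<lfloor>t / h\<rfloor>))"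
    if t: "0 \<le> t" for t
  proof -
    let ?k = "nat \<lfloor>t / h\<rfloor>"
    have s: "0 \<le> t - real ?k * h" using floor_bounds(1)[OF t] by simp
    show dom: "Y t \<in> D" unfolding Y_def by (intro generator_dom_add X_dom J_in_dom s)
    have "A (Y t) = F' (X ?k) + S (t - real ?k * h) (v ?k)"
      unfolding Y_def using s X_dom[of ?k]
      by (simp add: generator_add J_in_dom generator_J) (simp add: v_def)
    then show "G (Y t) + f t = S (t - real ?k * h) (v ?k)" by (simp add: G_eq[OF dom] f_def)
  qed
  have f_bound: "norm (f t) \<le> \<epsilon> + \<Lambda> * h * (exp (\<omega> * h) * V T)" if t: "t \<in> {0..T}" for t T
  proof -
    let ?k = "nat \<lfloor>t / h\<rfloor>"
    let ?s = "t - real ?k * h"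
    have t0: "0 \<le> t" "t \<le> T" using t by auto
    have s: "0 \<le> ?s" "?s \<le> h"
      using floor_bounds[OF t0(1)] unfolding of_nat_Suc distrib_right mult_1 by linarith+
    have "norm (Y t - X ?k) = norm (J ?s (v ?k))" by (simp add: Y_def)
    also have "\<dots> \<le> exp (\<omega> * ?s) * norm (v ?k) * ?s" by (rule norm_J_le) fact
    also have "\<dots> \<le> exp (\<omega> * h) * V (real ?k * h) * h"
      using s \<omega>_nonneg v_le V_nonneg h by (intro mult_mono) (auto simp: mult_left_mono)
    also have "\<dots> \<le> exp (\<omega> * h) * V T * h"
      using floor_bounds[of t] t h by (intro mult_right_mono mult_left_mono V_mono) auto
    finally have "norm (F' (Y t) - F' (X ?k)) \<le> \<Lambda> * (exp (\<omega> * h) * V T * h)"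
      using F'_le[of "Y t" "X ?k"] \<Lambda> by (meson mult_left_mono order_trans)
    moreover have "norm (f t) \<le> norm (F (Y t) - F' (Y t)) + norm (F' (Y t) - F' (X ?k))"
      unfolding f_def using norm_triangle_ineq[of "F (Y t) - F' (Y t)" "F' (Y t) - F' (X ?k)"] by simp
    ultimately show ?thesis using F'(2)[of "Y t"] by (simp add: algebra_simps)
  qed
  have Y_cont: "isCont Y t" if "0 < t" "t \<notin> N" for t
    using Y_deriv[OF that] has_vector_derivative_continuous by blast
  have f_cont: "isCont f t" if t: "0 < t" "t \<notin> N" for t
  proof -
    have "isCont (\<lambda>s. F (Y s)) t"
      using continuous_on_F by (intro isCont_o2[OF Y_cont[OF t]]) (auto simp: continuous_on_eq_continuous_at)
    then have "isCont (\<lambda>s. F (Y s) - F' (X (nat \<lfloor>t / h\<rfloor>))) t"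
      by (intro continuous_diff continuous_const)
    moreover have "\<forall>\<^sub>F s in nhds t. F (Y s) - F' (X (nat \<lfloor>t / h\<rfloor>)) = f s"
      using nbhd[OF t] by eventually_elim (simp add: f_def)
    ultimately show ?thesis using isCont_cong by metis
  qed
  have L1: "in_L1 T f" if "0 < T" for T
    unfolding in_L1_def
  proof
    show "strongly_measurable (lebesgue_on {0..T}) f"
      by (rule strongly_measurable_AE_continuous[OF N]) (auto intro: f_cont)
    have "L1_norm T f \<le> ennreal ((\<epsilon> + \<Lambda> * h * (exp (\<omega> * h) * V T)) * T)"
      using that h \<Lambda> \<epsilon> V_nonneg by (intro L1_norm_le f_bound) auto
    then show "L1_norm T f < \<infinity>" by (simp add: le_less_trans)
  qed
  have strong: "strong_solution D G f T Y" if "0 < T" for T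
    unfolding strong_solution_def
  proof (intro conjI allI impI)
    obtain C where C: "C-lipschitz_on {0..T} Y" using lip by blast
    then show "continuous_on {0..T} Y" by (rule lipschitz_on_continuous_on)
    fix K assume "compact K \<and> K \<subseteq> {0<..<T}"
    then have "K \<subseteq> {0..T}" by force
    then show "abs_continuous_on K Y"
      using lipschitz_on_imp_abs_continuous_on lipschitz_on_subset[OF C] by blast
  next
    have "AE t in lebesgue. t \<notin> N"
      using N by (intro AE_not_in) (simp add: negligible_iff_null_sets)
    then show "AE t in lebesgue_on {0<..<T}. Y t \<in> D \<and> (Y has_vector_derivative G (Y t) + f t) (at t)"
      by (subst AE_restrict_space_iff) (auto elim!: eventually_mono simp: Y_dom f_eq Y_deriv)
  qed
  have "Y 0 = x" using Y_eq[of 0 0] h by (simp add: X_def)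
  then show ?thesis using L1 strong f_bound unfolding V_def by blast
qed

lemma approximate_solution:
  assumes \<epsilon>: "0 < \<epsilon>"
  shows "\<exists>Y f. norm (Y 0 - y0) \<le> \<epsilon> \<and> (\<forall>T>0. in_L1 T f \<and> strong_solution D G f T Y) \<and>
    (\<forall>t\<in>{0..T0}. norm (f t) \<le> \<epsilon>)"
proof -
  obtain x where x: "x \<in> D" "norm (y0 - x) < \<epsilon>" using generator_dom_dense[OF \<epsilon>] by blast
  obtain F' \<Lambda> where F': "\<Lambda>-lipschitz_on UNIV F'" "\<And>x. norm (F x - F' x) \<le> \<epsilon> / 2"
    using lipschitz_approx[of "\<epsilon> / 2"] \<epsilon> by auto
  have \<Lambda>: "\<Lambda> \<ge> 0" using F'(1) by (rule lipschitz_on_nonneg)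
  define V where "V = exp ((\<omega> + \<Lambda>) * max 0 T0) * norm (A x - F' x)"
  define C where "C = \<Lambda> * (exp \<omega> * V)"
  have V: "V \<ge> 0" by (simp add: V_def)
  have C: "C \<ge> 0" using \<Lambda> V by (simp add: C_def)
  \<comment> \<open>\<open>C * h\<close> bounds the freezing error on \<open>{0..T0}\<close>, and
    \<open>C\<close> is fixed before \<open>h\<close>, so the error can be made at most
    \<open>\<epsilon> / 2\<close>; the other half is the distance from \<open>F\<close> to
    \<open>F'\<close>. The cap \<open>1\<close> allows \<open>exp (\<omega> * h)\<close> to be
    replaced by \<open>exp \<omega>\<close>.\<close>
  define h where "h = min 1 (\<epsilon> / (2 * (C + 1)))"
  have h: "0 < h" "h \<le> 1" "h \<le> \<epsilon> / (2 * (C + 1))" using \<epsilon> C by (auto simp: h_def)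
  have small: "\<Lambda> * h * (exp (\<omega> * h) * V) \<le> \<epsilon> / 2"
  proof -
    have "\<omega> * h \<le> \<omega>" using h \<omega>_nonneg by (simp add: mult_left_le)
    then have "\<Lambda> * h * (exp (\<omega> * h) * V) \<le> \<Lambda> * h * (exp \<omega> * V)"
      using \<Lambda> h V by (intro mult_left_mono mult_right_mono) auto
    also have "\<dots> = C * h" by (simp add: C_def)
    also have "\<dots> \<le> (C + 1) * (\<epsilon> / (2 * (C + 1)))"
      using h C by (intro mult_mono) auto
    also have "\<dots> = \<epsilon> / 2"
      using C by (subst times_divide_eq_right, subst nonzero_divide_eq_eq) (auto simp: algebra_simps)
    finally show ?thesis .
  qed
  obtain Y f where Y: "Y 0 = x" "\<And>T. T > 0 \<Longrightarrow> in_L1 T f \<and> strong_solution D G f T Y"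
    "\<And>T t. T \<ge> 0 \<Longrightarrow> t \<in> {0..T} \<Longrightarrow> norm (f t) \<le> \<epsilon> / 2 + \<Lambda> * h * (exp (\<omega> * h) * (exp ((\<omega> + \<Lambda>) * T) * norm (A x - F' x)))"
    using euler_solution[OF x(1) F' h(1)] by blast
  have "norm (f t) \<le> \<epsilon>" if t: "t \<in> {0..T0}" for t
  proof -
    have T0: "0 \<le> T0" using t by simp
    have "norm (f t) \<le> \<epsilon> / 2 + \<Lambda> * h * (exp (\<omega> * h) * V)"
      using Y(3)[OF T0 t] T0 by (simp add: V_def)
    with small show ?thesis by linarith
  qed
  then show ?thesis
    using Y(1,2) x by (intro exI[of _ Y] exI[of _ f]) (auto simp: norm_minus_commute)
qed

text \<open>The \<open>n\<close>-th approximation is accurate on \<open>{0..real n}\<close>, so a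
  single sequence serves every time horizon; the energy estimate makes it uniformly Cauchy on
  each.\<close>

theorem weak_solution_exists: "\<exists>y. weak_solution D G y0 y"
proof -
  have "\<exists>Y f. norm (Y 0 - y0) \<le> 1 / Suc n \<and> (\<forall>T>0. in_L1 T f \<and> strong_solution D G f T Y) \<and>
    (\<forall>t\<in>{0..real n}. norm (f t) \<le> 1 / Suc n)" for n
    by (rule approximate_solution) simp
  then obtain Y f where Y0: "\<And>n. norm (Y n 0 - y0) \<le> 1 / Suc n"
    and Y: "\<And>n T. T > 0 \<Longrightarrow> in_L1 T (f n) \<and> strong_solution D G (f n) T (Y n)"
    and f: "\<And>n t. t \<in> {0..real n} \<Longrightarrow> norm (f n t) \<le> 1 / Suc n" by metis
  have L1: "L1_norm T (f n) \<le> ennreal (1 / Suc n * T)" if "0 \<le> T" "T \<le> real n" for T n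
    using that by (intro L1_norm_le f) auto
  have unif: "uniform_limit {0..T} Y (\<lambda>t. lim (\<lambda>n. Y n t)) sequentially" if T: "T > 0" for T
  proof -
    \<comment> \<open>Accounts for two initial errors of size \<open>1 / Suc k\<close> and two
      forcings of L1 norm at most \<open>T / Suc k\<close>.\<close>
    define C where "C = exp ((\<omega> + c) * T) * (2 + 2 * T)"
    have C: "C > 0" using T by (simp add: C_def)
    have diff: "norm (Y n t - Y m t) \<le> C / Suc k" if k: "T \<le> real k" "k \<le> n" "k \<le> m" and t: "t \<in> {0..T}" for k n m t
    proof -
      have le: "1 / real (Suc n) \<le> 1 / real (Suc k)" "1 / real (Suc m) \<le> 1 / real (Suc k)"
        using k by (auto intro!: divide_left_mono)
      have "norm (Y n 0 - Y m 0) \<le> norm (Y n 0 - y0) + norm (Y m 0 - y0)"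
        using norm_triangle_ineq4[of "Y n 0 - y0" "Y m 0 - y0"] by simp
      also have "\<dots> \<le> 2 / real (Suc k)" using Y0[of n] Y0[of m] le by simp
      finally have 0: "ennreal (norm (Y n 0 - Y m 0)) \<le> ennreal (2 / real (Suc k))" by (rule ennreal_leI)
      have 1: "L1_norm T (f n) \<le> ennreal (1 / real (Suc k) * T)" if "k \<le> n" for n
      proof -
        have "L1_norm T (f n) \<le> ennreal (1 / real (Suc n) * T)" using k that T by (intro L1) auto
        also have "\<dots> \<le> ennreal (1 / real (Suc k) * T)"
          using that T by (intro ennreal_leI mult_right_mono divide_left_mono) auto
        finally show ?thesis .
      qed
      have "ennreal (norm (Y n t - Y m t)) \<le> ennreal (exp ((\<omega> + c) * T)) *
          (ennreal (norm (Y n 0 - Y m 0)) + (L1_norm T (f n) + L1_norm T (f m)))"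
        using Y[OF T] t by (intro strong_solution_diff_le) auto
      also have "\<dots> \<le> ennreal (exp ((\<omega> + c) * T)) *
          (ennreal (2 / real (Suc k)) + (ennreal (1 / real (Suc k) * T) + ennreal (1 / real (Suc k) * T)))"
        by (intro mult_left_mono add_mono 0 1 k) auto
      also have "\<dots> = ennreal (C / Suc k)"
        using T by (simp add: C_def add_divide_distrib ring_distribs flip: ennreal_plus ennreal_mult)
      finally show ?thesis using C by (simp add: ennreal_le_iff)
    qed
    have "uniformly_Cauchy_on {0..T} Y"
    proof (rule uniformly_Cauchy_onI)
      fix e :: real assume e: "e > 0"
      obtain k1 where k1: "T \<le> real k1" using real_arch_simple by blast
      obtain k2 where k2: "C / e < real k2" using reals_Archimedean2 by blast
      define k where "k = max k1 k2"
      have "C / e < real (Suc k)" "T \<le> real k" using k1 k2 by (auto simp: k_def)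
      then have "C / Suc k < e" using e C by (simp add: field_simps)
      then show "\<exists>M. \<forall>t\<in>{0..T}. \<forall>m\<ge>M. \<forall>n\<ge>M. dist (Y m t) (Y n t) < e"
        using diff[OF \<open>T \<le> real k\<close>] by (intro exI[of _ k]) (force simp: dist_norm)
    qed
    then show ?thesis
      using Cauchy_uniformly_convergent uniformly_convergent_uniform_limit_iff by blast
  qed
  define y where "y t = lim (\<lambda>n. Y n t)" for t
  have unif: "uniform_limit {0..T} Y y sequentially" if "T > 0" for T
    using unif[OF that] by (simp add: y_def[abs_def])
  have "weak_solution D G y0 y"
    unfolding weak_solution_def
  proof (intro conjI allI impI)
    show "continuous_on {0..} y"
    proof (rule continuous_on_atLeastI)
      fix T :: real assume T: "T > 0"
      show "continuous_on {0..T} y"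
        by (rule uniform_limit_theorem[OF _ unif[OF T]])
          (use Y[OF T] in \<open>auto simp: strong_solution_def\<close>)
    qed
    have "(\<lambda>n. Y n 0) \<longlonglongrightarrow> y0"
      by (rule LIM_zero_cancel, rule Lim_null_comparison[OF _ LIMSEQ_inverse_real_of_nat])
        (use Y0 in \<open>auto simp: inverse_eq_divide\<close>)
    moreover have "(\<lambda>n. Y n 0) \<longlonglongrightarrow> y 0"
      by (rule tendsto_uniform_limitI[OF unif[of 1]]) auto
    ultimately show "y 0 = y0" by (rule LIMSEQ_unique[THEN sym])
    fix T :: real assume T: "T > 0"
    have "(\<lambda>n. L1_norm T (f n)) \<longlonglongrightarrow> 0"
    proof (rule tendsto_sandwich[where f = "\<lambda>_. 0" and h = "\<lambda>n. ennreal (1 / Suc n * T)"])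
      show "(\<lambda>n. ennreal (1 / Suc n * T)) \<longlonglongrightarrow> 0"
      proof -
        have "(\<lambda>n. inverse (real (Suc n)) * T) \<longlonglongrightarrow> 0 * T"
          by (intro tendsto_mult LIMSEQ_inverse_real_of_nat tendsto_const)
        then have "(\<lambda>n. ennreal (inverse (real (Suc n)) * T)) \<longlonglongrightarrow> ennreal (0 * T)" by (rule tendsto_ennrealI)
        then show ?thesis by (simp add: inverse_eq_divide)
      qed
      obtain k where "T \<le> real k" using real_arch_simple by blast
      then show "\<forall>\<^sub>F n in sequentially. L1_norm T (f n) \<le> ennreal (1 / Suc n * T)"
        using T by (intro eventually_sequentiallyI[of k] L1) auto
    qed auto
    then show "\<exists>(Y :: nat \<Rightarrow> real \<Rightarrow> 'h) F. (\<forall>n. in_L1 T (F n) \<and> strong_solution D G (F n) T (Y n)) \<and>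
        (\<lambda>n. L1_norm T (F n)) \<longlonglongrightarrow> 0 \<and> uniform_limit {0..T} Y y sequentially"
      using Y[OF T] unif[OF T] by blast
  qed
  then show ?thesis by blast
qed

lemma well_posed: "well_posed D G"
  unfolding well_posed_def
proof
  fix y0
  obtain y where y: "weak_solution D G y0 y" using weak_solution_exists by blast
  have "z t = y t" if "weak_solution D G y0 z" "t \<ge> 0" for z t
    using weak_solution_diff_le[OF that(1) y that(2), of "t + 1"] that(2) by simp
  with y show "\<exists>y. weak_solution D G y0 y \<and> (\<forall>z. weak_solution D G y0 z \<longrightarrow> (\<forall>t\<ge>0. z t = y t))" by blast
qed

end

section \<open>Short-time behaviour of weak solutions\<close>

context perturbed_semigroup
begin

text \<open>With \<open>R\<close> the identity and \<open>k = - F (y t)\<close> this is the consistency of a step of the linear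
  equation; with \<open>R\<close> a projection onto an invariant subspace missed by \<open>F\<close>, and \<open>k = 0\<close>, it says that
  \<open>R \<circ> y\<close> is an orbit of the semigroup.\<close>

lemma weak_solution_step:
  assumes y: "weak_solution D G y0 y" and t: "0 \<le> t" and s: "0 \<le> s"
    and R: "bounded_linear R" "\<And>x. norm (R x) \<le> norm x" "\<And>x. x \<in> D \<Longrightarrow> R x \<in> D \<and> A (R x) = R (A x)"
    and \<eta>: "\<And>r. r \<in> {t..t+s} \<Longrightarrow> norm (R (F (y r)) + k) \<le> \<eta>"
  shows "norm (R (y (t + s)) - S s (R (y t)) - J s k) \<le> exp (\<omega> * s) * (\<eta> * s)"
proof -
  interpret R: bounded_linear R by (rule R(1))
  have \<eta>0: "\<eta> \<ge> 0" using \<eta>[of t] s norm_ge_zero by (meson atLeastAtMost_iff order_refl le_add_same_cancel1 order_trans)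
  define C where "C = exp (\<omega> * s)"
  have C: "C > 0" by (simp add: C_def)
  have main: "norm (R (y (t + s)) - S s (R (y t)) - J s k) \<le> C * (\<eta> * s) + e * (C * (4 + s) + 1)"
    if e: "e > 0" for e
  proof -
    define T where "T = t + s + 1"
    have T: "T > 0" "t + s < T" using t s by (auto simp: T_def)
    obtain Y f where Y: "\<And>n::nat. in_L1 T (f n)" "\<And>n. strong_solution D G (f n) T (Y n)"
      "(\<lambda>n. L1_norm T (f n)) \<longlonglongrightarrow> 0" "uniform_limit {0..T} Y y sequentially"
      using weak_solutionE[OF y T(1)] by metis
    obtain d where d: "d > 0" "\<And>a b. dist a b < d \<Longrightarrow> dist (F a) (F b) < e"
      using uniformly_continuous_F e unfolding uniformly_continuous_on_def by (metis UNIV_I)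
    have "\<forall>\<^sub>F n in sequentially. \<forall>r\<in>{0..T}. dist (Y n r) (y r) < min d e"
      using Y(4) d(1) e by (intro uniform_limitD) auto
    moreover have "\<forall>\<^sub>F n in sequentially. L1_norm T (f n) < ennreal e"
      using e by (intro order_tendstoD(2)[OF Y(3)]) auto
    ultimately have "\<forall>\<^sub>F n in sequentially. (\<forall>r\<in>{0..T}. dist (Y n r) (y r) < min d e) \<and> L1_norm T (f n) < ennreal e"
      by eventually_elim auto
    then obtain n where "(\<forall>r\<in>{0..T}. dist (Y n r) (y r) < min d e) \<and> L1_norm T (f n) < ennreal e"
      using eventually_happens'[OF sequentially_bot] by blast
    then have n: "\<And>r. r \<in> {0..T} \<Longrightarrow> dist (Y n r) (y r) < min d e" "L1_norm T (f n) < ennreal e"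
      by blast+
    obtain N where N: "continuous_on {0..T} (Y n)"
      "\<And>s t. 0 < s \<Longrightarrow> s \<le> t \<Longrightarrow> t < T \<Longrightarrow> abs_continuous_on {s..t} (Y n)" "negligible N"
      "\<And>t. t \<in> {0<..<T} - N \<Longrightarrow> Y n t \<in> D \<and> (Y n has_vector_derivative A (Y n t) - F (Y n t) + f n t) (at t)"
      using strong_solutionE[OF Y(2)] by metis
    \<comment> \<open>\<open>R (y t)\<close> need not lie in \<open>D\<close>, so the comparison
      curve starts at a nearby element of \<open>D\<close>.\<close>
    obtain x where x: "x \<in> D" "norm (R (y t) - x) < e" using generator_dom_dense[OF e] by blast
    \<comment> \<open>The subtracted curve equals \<open>S (r - t) x + J (r - t) k\<close>, the
      orbit from \<open>x\<close> with constant forcing \<open>k\<close>. Hence \<open>w\<close>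
      solves the linear equation with remainder
      \<open>R (f n r) - (R (F (Y n r)) + k)\<close>.\<close>
    define w where "w r = R (Y n r) - (x + J (r - t) (A x + k))" for r
    have J_deriv': "((\<lambda>r. J (r - t) z) has_vector_derivative S (r - t) z) (at r)" if "t \<le> r" for r z
      using J_deriv_shift[of r "- t" z] that by simp
    have "ennreal (norm (w (t + s))) \<le> ennreal (exp (\<omega> * (t + s - t))) * (ennreal (norm (w t)) +
      (\<integral>\<^sup>+r. ennreal (1 * norm (f n r) + (\<eta> + e)) \<partial>lebesgue_on {t..t+s}))"
    proof (rule abs_continuous_energy[where N = N])
      have "continuous_on {t..t+s} (\<lambda>r. J (r - t) (A x + k))"
        by (intro continuous_at_imp_continuous_on ballI has_vector_derivative_continuous[OF J_deriv']) auto
      moreover have "continuous_on {t..t+s} (Y n)"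
        using t T by (intro continuous_on_subset[OF N(1)]) auto
      ultimately show "continuous_on {t..t+s} w"
        unfolding w_def by (intro continuous_intros R.continuous_on)
    next
      fix a b assume ab: "t < a" "a \<le> b" "b < t + s"
      have aY: "abs_continuous_on {a..b} (Y n)" using ab t T by (intro N(2)) auto
      show "abs_continuous_on {a..b} w"
      proof (rule abs_continuous_onI_dist[OF aY abs_continuous_on_ident, of 1 "exp (\<omega> * (b - t)) * norm (A x + k)"])
        fix p q assume pq: "p \<in> {a..b}" "q \<in> {a..b}" "p \<le> q"
        have "norm (J (q - t) (A x + k) - J (p - t) (A x + k)) \<le>
            exp (\<omega> * (q - t)) * norm (A x + k) * ((q - t) - (p - t))"
          using pq ab by (intro norm_J_diff_le) auto
        also have "\<dots> \<le> exp (\<omega> * (b - t)) * norm (A x + k) * (q - p)"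
          using pq \<omega>_nonneg by (intro mult_mono) (auto simp: mult_left_mono)
        finally have 1: "norm (J (q - t) (A x + k) - J (p - t) (A x + k)) \<le> exp (\<omega> * (b - t)) * norm (A x + k) * (q - p)" .
        have "w p - w q = R (Y n p - Y n q) + (J (q - t) (A x + k) - J (p - t) (A x + k))"
          by (simp add: w_def R.diff)
        then have "norm (w p - w q) \<le> norm (R (Y n p - Y n q)) + norm (J (q - t) (A x + k) - J (p - t) (A x + k))"
          by (simp only: norm_triangle_ineq)
        then show "dist (w p) (w q) \<le> 1 * dist (Y n p) (Y n q) + exp (\<omega> * (b - t)) * norm (A x + k) * dist p q"
          using 1 R(2)[of "Y n p - Y n q"] pq by (simp add: dist_norm)
      qed auto
    next
      fix r assume r: "r \<in> {t<..<t+s} - N"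
      then have Yr: "Y n r \<in> D" "(Y n has_vector_derivative A (Y n r) - F (Y n r) + f n r) (at r)"
        using N(4)[of r] t T by auto
      have rt: "0 \<le> r - t" using r by simp
      let ?d = "R (A (Y n r) - F (Y n r) + f n r) - S (r - t) (A x + k)"
      have "(w has_vector_derivative R (A (Y n r) - F (Y n r) + f n r) - (0 + S (r - t) (A x + k))) (at r)"
        unfolding w_def using rt
        by (intro has_vector_derivative_diff has_vector_derivative_add has_vector_derivative_const
            J_deriv' R.has_vector_derivative Yr) auto
      then have wd: "(w has_vector_derivative ?d) (at r)" by simp
      have w_dom: "w r \<in> D"
        unfolding w_def using R(3)[OF Yr(1)] x(1) J_in_dom[OF rt]
        by (intro generator_dom_diff generator_dom_add) auto
      have "A (w r) = R (A (Y n r)) - (A x + (S (r - t) (A x + k) - (A x + k)))"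
        unfolding w_def using R(3)[OF Yr(1)] x(1) J_in_dom[OF rt] generator_J[OF rt]
        by (simp add: generator_diff generator_add generator_dom_add)
      then have deq: "?d = A (w r) + (R (f n r) - (R (F (Y n r)) + k))"
        by (simp add: R.add R.diff)
      have nF: "norm (R (F (Y n r)) + k) \<le> \<eta> + e"
      proof -
        have "dist (Y n r) (y r) < d" using n(1)[of r] r t T by auto
        then have "norm (F (Y n r) - F (y r)) < e" using d(2) by (simp add: dist_norm)
        then have "norm (R (F (Y n r) - F (y r))) \<le> e" using R(2) by (meson less_imp_le order_trans)
        moreover have "norm (R (F (y r)) + k) \<le> \<eta>" using r by (intro \<eta>) auto
        moreover have "R (F (Y n r)) + k = R (F (Y n r) - F (y r)) + (R (F (y r)) + k)" by (simp add: R.diff)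
        ultimately show ?thesis by (metis add.commute add_mono norm_triangle_le)
      qed
      have "w r \<bullet> ?d = A (w r) \<bullet> w r + w r \<bullet> (R (f n r) - (R (F (Y n r)) + k))"
        unfolding deq by (simp add: inner_add_right inner_commute)
      also have "\<dots> \<le> \<omega> * (norm (w r))\<^sup>2 + norm (w r) * (norm (f n r) + (\<eta> + e))"
      proof (rule add_mono[OF dissipative[OF w_dom]])
        have "w r \<bullet> (R (f n r) - (R (F (Y n r)) + k)) \<le> norm (w r) * norm (R (f n r) - (R (F (Y n r)) + k))"
          by (rule norm_cauchy_schwarz)
        also have "\<dots> \<le> norm (w r) * (norm (R (f n r)) + norm (R (F (Y n r)) + k))"
          by (intro mult_left_mono norm_triangle_ineq4) auto
        also have "\<dots> \<le> norm (w r) * (norm (f n r) + (\<eta> + e))"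
          by (intro mult_left_mono add_mono R nF) auto
        finally show "w r \<bullet> (R (f n r) - (R (F (Y n r)) + k)) \<le> norm (w r) * (norm (f n r) + (\<eta> + e))" .
      qed
      finally show "\<exists>d. (w has_vector_derivative d) (at r) \<and>
          w r \<bullet> d \<le> \<omega> * (norm (w r))\<^sup>2 + (1 * norm (f n r) + (\<eta> + e)) * norm (w r)"
        using wd by (auto simp: mult.commute)
    qed (use N(3) \<omega>_nonneg s \<eta>0 e in auto)
    also have "\<dots> \<le> ennreal C * (ennreal (2 * e) + ennreal (e + (\<eta> + e) * s))"
    proof (intro mult_mono add_mono)
      have "norm (w t) \<le> norm (R (Y n t - y t)) + norm (R (y t) - x)"
        using norm_triangle_ineq[of "R (Y n t - y t)" "R (y t) - x"] by (simp add: w_def R.diff)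
      also have "\<dots> \<le> 2 * e"
        using R(2)[of "Y n t - y t"] x(2) n(1)[of t] t T s by (auto simp: dist_norm)
      finally show "ennreal (norm (w t)) \<le> ennreal (2 * e)" by (rule ennreal_leI)
      have "(\<integral>\<^sup>+r. ennreal (1 * norm (f n r) + (\<eta> + e)) \<partial>lebesgue_on {t..t+s})
          \<le> ennreal 1 * L1_norm T (f n) + ennreal ((\<eta> + e) * (t + s - t))"
        using t s T \<eta>0 e by (intro nn_integral_affine_L1_le Y) auto
      also have "\<dots> \<le> ennreal e + ennreal ((\<eta> + e) * s)"
        using n(2) by (intro add_mono) auto
      also have "\<dots> = ennreal (e + (\<eta> + e) * s)"
        using e \<eta>0 s by (subst ennreal_plus) auto
      finally show "(\<integral>\<^sup>+r. ennreal (1 * norm (f n r) + (\<eta> + e)) \<partial>lebesgue_on {t..t+s}) \<le> ennreal (e + (\<eta> + e) * s)" .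
    qed (auto simp: C_def)
    also have "\<dots> = ennreal (C * (2 * e + (e + (\<eta> + e) * s)))"
    proof -
      have "ennreal C * (ennreal p + ennreal q) = ennreal (C * (p + q))" if "p \<ge> 0" "q \<ge> 0" for p q
        using C that by (simp add: ennreal_mult)
      from this[of "2 * e" "e + (\<eta> + e) * s"] show ?thesis using e \<eta>0 s by (simp only: mult_nonneg_nonneg add_nonneg_nonneg less_imp_le zero_le_numeral)
    qed
    finally have w_le: "norm (w (t + s)) \<le> C * (2 * e + (e + (\<eta> + e) * s))"
      using C e \<eta>0 s by (simp add: ennreal_le_iff)
    have "w (t + s) = R (Y n (t + s)) - S s x - J s k"
      using s x(1) by (simp add: w_def J_plus J_generator)
    then have "R (y (t + s)) - S s (R (y t)) - J s k
        = R (y (t + s) - Y n (t + s)) + w (t + s) - S s (R (y t) - x)"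
      using s by (simp add: R.diff S_diff)
    then have "norm (R (y (t + s)) - S s (R (y t)) - J s k)
        \<le> norm (R (y (t + s) - Y n (t + s))) + norm (w (t + s)) + norm (S s (R (y t) - x))"
      using norm_triangle_ineq4[of "R (y (t + s) - Y n (t + s)) + w (t + s)" "S s (R (y t) - x)"]
        norm_triangle_ineq[of "R (y (t + s) - Y n (t + s))" "w (t + s)"] by simp
    also have "\<dots> \<le> e + C * (2 * e + (e + (\<eta> + e) * s)) + C * e"
    proof (intro add_mono w_le)
      show "norm (R (y (t + s) - Y n (t + s))) \<le> e"
        using R(2)[of "y (t + s) - Y n (t + s)"] n(1)[of "t + s"] t s T by (simp add: dist_norm norm_minus_commute)
      show "norm (S s (R (y t) - x)) \<le> C * e"
        using norm_S_le[OF s, of "R (y t) - x"] x(2) C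
        unfolding C_def[symmetric] by (meson less_imp_le mult_left_mono order_trans)
    qed
    also have "\<dots> = C * (\<eta> * s) + e * (C * (4 + s) + 1)" by (simp add: algebra_simps)
    finally show ?thesis .
  qed
  have K: "C * (4 + s) + 1 > 0" using C s by (simp add: add_nonneg_pos)
  show ?thesis
  proof (rule field_le_epsilon)
    fix e :: real assume "e > 0"
    then show "norm (R (y (t + s)) - S s (R (y t)) - J s k) \<le> exp (\<omega> * s) * (\<eta> * s) + e"
      using main[of "e / (C * (4 + s) + 1)"] K by (simp add: C_def)
  qed
qed

text \<open>Weak solutions need not enter \<open>D\<close>, but their time integrals do. Integrating
  the consistency of a step over time writes \<open>S s u - u\<close> as increments of
  \<open>I\<close> at both ends, plus \<open>J s\<close> of the integral of \<open>F\<close>, plus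
  an error \<open>o(s)\<close>; so the difference quotients of \<open>u\<close> converge.\<close>

lemma weak_solution_integral_in_dom:
  assumes y: "weak_solution D G y0 y" and a: "0 \<le> a" "a \<le> b"
    and I: "\<And>t. 0 \<le> t \<Longrightarrow> (I has_vector_derivative y t) (at t)"
  shows "I b - I a \<in> D"
proof -
  have y_cont: "continuous_on {0..} y" using y by (simp add: weak_solution_def)
  have Fy_cont: "continuous_on {0..} (\<lambda>t. F (y t))"
    using continuous_on_compose[OF y_cont continuous_on_subset[OF continuous_on_F]] by (simp add: o_def)
  obtain K where K: "\<And>t. 0 \<le> t \<Longrightarrow> (K has_vector_derivative F (y t)) (at t)"
    using ex_antiderivative_atLeast[OF Fy_cont] by blast
  define u where "u = I b - I a"
  \<comment> \<open>Its derivative in \<open>t\<close> is, up to sign, the error of one step of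
    length \<open>s\<close> with the nonlinearity frozen at \<open>y t\<close>.\<close>
  define E where "E s t = S s (I t) - I (t + s) - J s (K t)" for s t
  have E_le: "norm (E s b - E s a) \<le> exp (\<omega> * s) * (\<eta> * s) * (b - a)"
    if s: "0 \<le> s" and \<eta>: "\<And>t r. t \<in> {a..b} \<Longrightarrow> r \<in> {t..t+s} \<Longrightarrow> norm (F (y r) - F (y t)) \<le> \<eta>" for s \<eta>
  proof (rule has_vector_derivative_norm_bound[OF a(2)])
    fix t assume t: "t \<in> {a..b}"
    then have t0: "0 \<le> t" "0 \<le> t + s" using a s by auto
    have "((\<lambda>t. t + s) has_vector_derivative 1) (at t)"
      by (auto intro!: derivative_eq_intros simp: has_real_derivative_iff_has_vector_derivative[symmetric])
    from vector_diff_chain_at[OF this I[OF t0(2)]]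
    have "((\<lambda>t. I (t + s)) has_vector_derivative y (t + s)) (at t)" by (simp add: o_def)
    then show "(E s has_vector_derivative S s (y t) - y (t + s) - J s (F (y t))) (at t)"
      unfolding E_def
      by (intro has_vector_derivative_diff bounded_linear.has_vector_derivative[OF bounded_linear_S[OF s]]
          bounded_linear.has_vector_derivative[OF bounded_linear_J[OF s]] I K t0)
    have "norm (y (t + s) - S s (y t) - J s (- F (y t))) \<le> exp (\<omega> * s) * (\<eta> * s)"
      using weak_solution_step[OF y t0(1) s bounded_linear_ident, of "- F (y t)" \<eta>] \<eta>[OF t] by simp
    moreover have "J s (- F (y t)) = - J s (F (y t))"
      using J_scaleR[OF s, of "-1" "F (y t)"] by simp
    ultimately have "norm (- (S s (y t) - y (t + s) - J s (F (y t)))) \<le> exp (\<omega> * s) * (\<eta> * s)"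
      by (simp add: algebra_simps)
    then show "norm (S s (y t) - y (t + s) - J s (F (y t))) \<le> exp (\<omega> * s) * (\<eta> * s)"
      by (simp only: norm_minus_cancel)
  qed
  have E_lim: "((\<lambda>s. (E s b - E s a) /\<^sub>R s) \<longlongrightarrow> 0) (at_right 0)"
  proof (rule tendstoI)
    fix e :: real assume e: "e > 0"
    \<comment> \<open>For \<open>s < 1\<close> these constants keep the error over
      \<open>{a..b}\<close> below \<open>e / 2 * s\<close>; the \<open>+ 1\<close> makes
      \<open>M\<close> positive when \<open>a = b\<close>.\<close>
    define M where "M = exp \<omega> * (b - a + 1)"
    define \<eta> where "\<eta> = e / (2 * M)"
    have M: "M > 0" using a by (simp add: M_def)
    have \<eta>: "\<eta> > 0" using e M by (simp add: \<eta>_def)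
    have "uniformly_continuous_on {0..b+1} (\<lambda>t. F (y t))"
      by (rule compact_uniformly_continuous[OF continuous_on_subset[OF Fy_cont]]) auto
    then obtain d where d: "d > 0" "\<And>p q. p \<in> {0..b+1} \<Longrightarrow> q \<in> {0..b+1} \<Longrightarrow> dist p q < d \<Longrightarrow> dist (F (y p)) (F (y q)) < \<eta>"
      using \<eta> unfolding uniformly_continuous_on_def by metis
    have "dist ((E s b - E s a) /\<^sub>R s) 0 < e" if s: "0 < s" "s < min 1 d" for s
    proof -
      have "norm (E s b - E s a) \<le> exp (\<omega> * s) * (\<eta> * s) * (b - a)"
      proof (rule E_le)
        fix t r assume "t \<in> {a..b}" "r \<in> {t..t+s}"
        then have "dist (F (y r)) (F (y t)) < \<eta>"
          using s a by (intro d(2)) (auto simp: dist_real_def)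
        then show "norm (F (y r) - F (y t)) \<le> \<eta>" by (simp add: dist_norm)
      qed (use s in auto)
      also have "\<dots> \<le> exp \<omega> * (\<eta> * s) * (b - a + 1)"
        using s \<omega>_nonneg \<eta> a by (intro mult_mono) (auto simp: mult_left_le)
      also have "\<dots> = M * \<eta> * s" by (simp add: M_def)
      also have "\<dots> = e / 2 * s" using M by (simp add: \<eta>_def)
      finally have "norm (E s b - E s a) / s \<le> e / 2" using s by (simp add: field_simps)
      moreover have "dist ((E s b - E s a) /\<^sub>R s) 0 = norm (E s b - E s a) / s"
        using s by (simp add: divide_inverse_commute)
      ultimately show ?thesis using e by linarith
    qed
    then show "\<forall>\<^sub>F s in at_right 0. dist ((E s b - E s a) /\<^sub>R s) 0 < e"
      unfolding eventually_at_right_field using d(1) by (intro exI[of _ "min 1 d"]) auto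
  qed
  have "((\<lambda>s. (I (b + s) - I b) /\<^sub>R s - (I (a + s) - I a) /\<^sub>R s + J s (K b - K a) /\<^sub>R s + (E s b - E s a) /\<^sub>R s)
      \<longlongrightarrow> y b - y a + (K b - K a) + 0) (at_right 0)"
    using a by (intro tendsto_add tendsto_diff has_vector_derivative_right_quotient I J_quotient E_lim) auto
  moreover have "\<forall>\<^sub>F s in at_right 0. (I (b + s) - I b) /\<^sub>R s - (I (a + s) - I a) /\<^sub>R s + J s (K b - K a) /\<^sub>R s
      + (E s b - E s a) /\<^sub>R s = (S s u - u) /\<^sub>R s"
  proof (rule eventually_at_right_less[THEN eventually_mono])
    fix s :: real assume s: "0 < s"
    have "S s u = S s (I b) - S s (I a)" using s by (simp add: u_def S_diff)
    moreover have "J s (K b - K a) = J s (K b) - J s (K a)"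
      using s linear_diff[OF bounded_linear.linear[OF bounded_linear_J]] by simp
    ultimately have "(I (b + s) - I b) - (I (a + s) - I a) + J s (K b - K a) + (E s b - E s a) = S s u - u"
      by (simp add: E_def u_def)
    then show "(I (b + s) - I b) /\<^sub>R s - (I (a + s) - I a) /\<^sub>R s + J s (K b - K a) /\<^sub>R s
      + (E s b - E s a) /\<^sub>R s = (S s u - u) /\<^sub>R s"
      by (simp only: scaleR_diff_right[symmetric] scaleR_add_right[symmetric])
  qed
  ultimately have "((\<lambda>s. (S s u - u) /\<^sub>R s) \<longlongrightarrow> y b - y a + (K b - K a) + 0) (at_right 0)"
    by (rule Lim_transform_eventually)
  then show ?thesis unfolding u_def[symmetric] by (rule generator_domI)
qed

end

section \<open>The feedback nonlinearity\<close>

text \<open>\<open>truncated_sign m \<epsilon>\<close> is a Lipschitz regularisation of \<open>u / norm u powr m\<close>, which is the case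
  \<open>\<epsilon> = 0\<close>; there the value at \<open>0\<close> is \<open>0\<close>, because \<open>inverse 0 = 0\<close>.\<close>

definition truncated_sign :: "real \<Rightarrow> real \<Rightarrow> 'a::real_normed_vector \<Rightarrow> 'a" where
  "truncated_sign m \<epsilon> u = u /\<^sub>R (max (norm u) \<epsilon> powr m)"

context
  fixes m \<epsilon> :: real
  assumes m: "0 < m" "m < 1" and \<epsilon>: "0 \<le> \<epsilon>"
begin

text \<open>The ratio of the truncated radii lies between \<open>1\<close> and \<open>a / b\<close>,
  and a power \<open>m < 1\<close> keeps it below \<open>a / b\<close>.\<close>

lemma truncated_radial_mono:
  fixes a b :: real
  assumes "0 \<le> b" "b \<le> a"
  shows "b / max b \<epsilon> powr m \<le> a / max a \<epsilon> powr m"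
proof (cases "b = 0")
  case False
  define Ma Mb where "Ma = max a \<epsilon>" and "Mb = max b \<epsilon>"
  have b: "0 < b" "0 < a" using False assms by auto
  have M: "0 < Mb" "Mb \<le> Ma" "0 < Ma" using b assms by (auto simp: Ma_def Mb_def)
  have "b * Ma \<le> a * Mb"
    using assms \<epsilon> b by (auto simp: Ma_def Mb_def max_def mult_right_mono mult.commute)
  then have "Ma / Mb \<le> a / b" using b M by (simp add: field_simps)
  moreover have "(Ma / Mb) powr m \<le> (Ma / Mb) powr 1" using M m by (intro powr_mono) auto
  ultimately have "Ma powr m / Mb powr m \<le> a / b" using M by (simp add: powr_divide)
  then have "b / Mb powr m \<le> a / Ma powr m" using b M by (simp add: field_simps)
  then show ?thesis by (simp add: Ma_def Mb_def)
qed (use assms in auto)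

text \<open>A radial field whose length is nondecreasing in the radius is monotone: Cauchy-Schwarz
  reduces the claim to the radii.\<close>

lemma truncated_sign_monotone:
  fixes u v :: "'a::real_inner"
  shows "0 \<le> (truncated_sign m \<epsilon> u - truncated_sign m \<epsilon> v) \<bullet> (u - v)"
proof -
  define k where "k r = inverse (max r \<epsilon> powr m)" for r
  define a b where "a = norm u" and "b = norm v"
  have k: "k r \<ge> 0" for r by (simp add: k_def)
  have mono: "s * k s \<le> r * k r" if "0 \<le> s" "s \<le> r" for r s
    using truncated_radial_mono[OF that] by (simp add: k_def divide_inverse)
  have "0 \<le> (a * k a - b * k b) * (a - b)"
    using mono[of a b] mono[of b a]
    by (cases "a \<le> b") (auto simp: a_def b_def intro: mult_nonneg_nonneg mult_nonpos_nonpos)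
  also have "\<dots> = k a * a\<^sup>2 + k b * b\<^sup>2 - (k a + k b) * (a * b)"
    by (simp add: algebra_simps power2_eq_square)
  also have "\<dots> \<le> k a * a\<^sup>2 + k b * b\<^sup>2 - (k a + k b) * (u \<bullet> v)"
    using norm_cauchy_schwarz[of u v] k[of a] k[of b] by (simp add: a_def b_def mult_left_mono)
  also have "\<dots> = (k a *\<^sub>R u - k b *\<^sub>R v) \<bullet> (u - v)"
    by (simp add: a_def b_def power2_norm_eq_inner inner_diff_left inner_diff_right inner_commute algebra_simps)
  finally show ?thesis by (simp add: truncated_sign_def k_def a_def b_def)
qed

text \<open>With \<open>u\<close> the longer vector, the difference splits into a scaled
  \<open>u - v\<close> and a change of the scaling at \<open>v\<close>. Radial monotonicity bounds
  the second part by the same quantity as the first, hence the factor \<open>2\<close>.\<close>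

lemma truncated_sign_lipschitz:
  fixes u v :: "'a::real_normed_vector"
  assumes "0 < \<epsilon>"
  shows "norm (truncated_sign m \<epsilon> u - truncated_sign m \<epsilon> v) \<le> 2 / \<epsilon> powr m * norm (u - v)"
proof -
  define k where "k r = inverse (max r \<epsilon> powr m)" for r
  have mono: "s * k s \<le> r * k r" if "0 \<le> s" "s \<le> r" for r s
    using truncated_radial_mono[OF that] by (simp add: k_def divide_inverse)
  have anti: "k r \<le> k s" if "s \<le> r" for r s
    unfolding k_def using assms m that by (intro le_imp_inverse_le powr_mono2) auto
  have k_le: "0 \<le> k r" "k r \<le> 1 / \<epsilon> powr m" for r
    unfolding k_def inverse_eq_divide using assms m by (auto intro!: divide_left_mono powr_mono2)
  have *: "norm (k (norm u) *\<^sub>R u - k (norm v) *\<^sub>R v) \<le> 2 / \<epsilon> powr m * norm (u - v)"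
    if "norm v \<le> norm u" for u v :: 'a
  proof -
    have "k (norm u) *\<^sub>R u - k (norm v) *\<^sub>R v = k (norm u) *\<^sub>R (u - v) - (k (norm v) - k (norm u)) *\<^sub>R v"
      by (simp add: algebra_simps)
    then have "norm (k (norm u) *\<^sub>R u - k (norm v) *\<^sub>R v)
        \<le> norm (k (norm u) *\<^sub>R (u - v)) + norm ((k (norm v) - k (norm u)) *\<^sub>R v)"
      by (simp only: norm_triangle_ineq4)
    also have "\<dots> = k (norm u) * norm (u - v) + (k (norm v) - k (norm u)) * norm v"
      using k_le anti[OF that] by simp
    also have "\<dots> \<le> k (norm u) * norm (u - v) + k (norm u) * (norm u - norm v)"
      using mono[OF norm_ge_zero that] by (simp add: algebra_simps)
    also have "\<dots> \<le> k (norm u) * norm (u - v) + k (norm u) * norm (u - v)"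
      by (intro add_left_mono mult_left_mono norm_triangle_ineq2 k_le)
    also have "\<dots> = 2 * k (norm u) * norm (u - v)" by simp
    also have "\<dots> \<le> 2 / \<epsilon> powr m * norm (u - v)"
      using k_le(2)[of "norm u"] by (intro mult_right_mono) auto
    finally show ?thesis .
  qed
  show ?thesis
    using *[of u v] *[of v u]
    by (cases "norm v \<le> norm u") (auto simp: truncated_sign_def k_def norm_minus_commute)
qed

text \<open>The two fields differ only inside the ball of radius \<open>\<epsilon>\<close>, where
  each has norm at most \<open>\<epsilon> powr (1 - m)\<close>.\<close>

lemma truncated_sign_approx:
  fixes u :: "'a::real_normed_vector"
  shows "norm (truncated_sign m 0 u - truncated_sign m \<epsilon> u) \<le> 2 * \<epsilon> powr (1 - m)"
proof (cases "\<epsilon> \<le> norm u")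
  case True
  then show ?thesis by (simp add: truncated_sign_def max_absorb1)
next
  case False
  then have u: "norm u \<le> \<epsilon>" "0 < \<epsilon>" using norm_ge_zero[of u] by linarith+
  have 1: "norm (truncated_sign m 0 u) \<le> \<epsilon> powr (1 - m)"
  proof (cases "u = 0")
    case u0: False
    have "norm (truncated_sign m 0 u) = norm u powr (1 - m)"
      using u0 by (simp add: truncated_sign_def max_absorb1 powr_diff divide_inverse mult.commute)
    also have "\<dots> \<le> \<epsilon> powr (1 - m)" using u m by (intro powr_mono2) auto
    finally show ?thesis .
  qed (simp add: truncated_sign_def)
  have "norm (truncated_sign m \<epsilon> u) = norm u / \<epsilon> powr m"
    using u by (simp add: truncated_sign_def max_absorb2 divide_inverse mult.commute)
  also have "\<dots> \<le> \<epsilon> / \<epsilon> powr m" using u by (intro divide_right_mono) auto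
  also have "\<dots> = \<epsilon> powr (1 - m)" using u by (simp add: powr_diff)
  finally have 2: "norm (truncated_sign m \<epsilon> u) \<le> \<epsilon> powr (1 - m)" .
  show ?thesis
    using norm_triangle_ineq4[of "truncated_sign m 0 u" "truncated_sign m \<epsilon> u"] 1 2 by linarith
qed

end

text \<open>The exponent \<open>a > 1\<close> flattens the kink at \<open>0\<close>; this makes the
  profile defined next differentiable at the moment of extinction.\<close>

lemma has_real_derivative_max_powr:
  fixes x :: real
  assumes a: "a > 1"
  shows "((\<lambda>x. max 0 x powr a) has_real_derivative a * max 0 x powr (a - 1)) (at x)"
proof -
  consider "x > 0" | "x < 0" | "x = 0" by linarith
  then show ?thesis
  proof cases
    case 1
    have "((\<lambda>x. x powr a) has_real_derivative a * max 0 x powr (a - 1)) (at x)"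
      using 1 by (auto intro!: derivative_eq_intros)
    then show ?thesis
      by (rule has_field_derivative_transform_within_open[of _ _ _ "{0<..}"]) (use 1 in auto)
  next
    case 2
    have "((\<lambda>x. 0) has_real_derivative a * max 0 x powr (a - 1)) (at x)"
      using 2 by simp
    then show ?thesis
      by (rule has_field_derivative_transform_within_open[of _ _ _ "{..<0}"]) (use 2 in auto)
  next
    case 3
    have "((\<lambda>h. (max 0 h powr a) / h) \<longlongrightarrow> 0) (at 0)"
    proof (rule Lim_null_comparison)
      show "\<forall>\<^sub>F h in at 0. norm (max 0 h powr a / h) \<le> \<bar>h\<bar> powr (a - 1)"
      proof (rule always_eventually, rule allI)
        fix h :: real
        show "norm (max 0 h powr a / h) \<le> \<bar>h\<bar> powr (a - 1)"
          using powr_diff[of h a 1] by (cases "h > 0") auto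
      qed
      show "((\<lambda>h. \<bar>h\<bar> powr (a - 1)) \<longlongrightarrow> 0) (at (0::real))"
        by (rule tendsto_eq_intros refl | use a in simp)+
    qed
    then show ?thesis using 3 a by (simp add: has_field_derivative_iff)
  qed
qed

text \<open>The solution of \<open>p' = - 2 \<gamma> p powr (1 - \<mu>)\<close>, \<open>p 0 = q\<close>, continued by \<open>0\<close> after extinction.\<close>

definition extinction_profile :: "real \<Rightarrow> real \<Rightarrow> real \<Rightarrow> real \<Rightarrow> real" where
  "extinction_profile \<gamma> \<mu> q t = max 0 (q powr \<mu> - 2 * \<gamma> * \<mu> * t) powr (1 / \<mu>)"

lemma
  assumes \<mu>: "0 < \<mu>" "\<mu> < 1" and \<gamma>: "0 < \<gamma>" and q: "0 \<le> q"
  shows extinction_profile_nonneg: "0 \<le> extinction_profile \<gamma> \<mu> q t"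
    and extinction_profile_0: "extinction_profile \<gamma> \<mu> q 0 = q"
    and extinction_profile_eq_0: "q powr \<mu> / (2 * \<gamma> * \<mu>) \<le> t \<Longrightarrow> extinction_profile \<gamma> \<mu> q t = 0"
    and extinction_profile_deriv: "(extinction_profile \<gamma> \<mu> q has_real_derivative
      - (2 * \<gamma> * extinction_profile \<gamma> \<mu> q t powr (1 - \<mu>))) (at t)"
    and extinction_profile_le: "0 \<le> t \<Longrightarrow> extinction_profile \<gamma> \<mu> q t \<le> q"
proof -
  show "0 \<le> extinction_profile \<gamma> \<mu> q t" by (simp add: extinction_profile_def)
  show 0: "extinction_profile \<gamma> \<mu> q 0 = q"
    using \<mu> q by (simp add: extinction_profile_def powr_powr max_absorb2)
  show "extinction_profile \<gamma> \<mu> q t = 0" if "q powr \<mu> / (2 * \<gamma> * \<mu>) \<le> t"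
  proof -
    have "q powr \<mu> - 2 * \<gamma> * \<mu> * t \<le> 0" using that \<mu> \<gamma> by (simp add: field_simps)
    then show ?thesis by (simp add: extinction_profile_def max_absorb1)
  qed
  show "extinction_profile \<gamma> \<mu> q t \<le> q" if "0 \<le> t"
  proof -
    have "max 0 (q powr \<mu> - 2 * \<gamma> * \<mu> * t) \<le> q powr \<mu>" using that \<mu> \<gamma> by simp
    then have "max 0 (q powr \<mu> - 2 * \<gamma> * \<mu> * t) powr (1 / \<mu>) \<le> (q powr \<mu>) powr (1 / \<mu>)"
      using \<mu> by (intro powr_mono2) auto
    then show ?thesis using \<mu> q by (simp add: extinction_profile_def powr_powr)
  qed
  define X where "X s = q powr \<mu> - 2 * \<gamma> * \<mu> * s" for s
  have "(X has_real_derivative - (2 * \<gamma> * \<mu>)) (at t)"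
    unfolding X_def by (auto intro!: derivative_eq_intros)
  from DERIV_chain2[OF has_real_derivative_max_powr this, of "1 / \<mu>"]
  have "((\<lambda>s. max 0 (X s) powr (1 / \<mu>)) has_real_derivative
      1 / \<mu> * max 0 (X t) powr (1 / \<mu> - 1) * - (2 * \<gamma> * \<mu>)) (at t)"
    using \<mu> by simp
  \<comment> \<open>The exponents match because
    \<open>1 / \<mu> - 1 = (1 - \<mu>) / \<mu>\<close>.\<close>
  moreover have "1 / \<mu> * max 0 (X t) powr (1 / \<mu> - 1) * - (2 * \<gamma> * \<mu>)
      = - (2 * \<gamma> * (max 0 (X t) powr (1 / \<mu>)) powr (1 - \<mu>))"
    using \<mu> by (simp add: powr_powr diff_divide_distrib)
  ultimately show "(extinction_profile \<gamma> \<mu> q has_real_derivative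
      - (2 * \<gamma> * extinction_profile \<gamma> \<mu> q t powr (1 - \<mu>))) (at t)"
    by (simp add: extinction_profile_def[abs_def] X_def)
qed

text \<open>Supplies the absolute continuity needed to compare solutions with the profile; the slope
  is steepest at time \<open>0\<close>.\<close>

lemma extinction_profile_lipschitz:
  assumes \<mu>: "0 < \<mu>" "\<mu> < 1" and \<gamma>: "0 < \<gamma>" and q: "0 \<le> q"
  shows "(2 * \<gamma> * q powr (1 - \<mu>))-lipschitz_on {0..} (extinction_profile \<gamma> \<mu> q)"
proof (rule lipschitz_onI)
  fix x y :: real assume xy: "x \<in> {0..}" "y \<in> {0..}"
  have "norm (extinction_profile \<gamma> \<mu> q x - extinction_profile \<gamma> \<mu> q y) \<le> 2 * \<gamma> * q powr (1 - \<mu>) * norm (x - y)"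
  proof (rule field_differentiable_bound[where S = "{0..}"])
    fix z :: real assume z: "z \<in> {0..}"
    show "(extinction_profile \<gamma> \<mu> q has_real_derivative
        - (2 * \<gamma> * extinction_profile \<gamma> \<mu> q z powr (1 - \<mu>))) (at z within {0..})"
      by (rule has_field_derivative_at_within[OF extinction_profile_deriv[OF assms]])
    show "norm (- (2 * \<gamma> * extinction_profile \<gamma> \<mu> q z powr (1 - \<mu>))) \<le> 2 * \<gamma> * q powr (1 - \<mu>)"
      using z assms extinction_profile_le[OF assms] extinction_profile_nonneg[OF assms]
      by (auto intro!: powr_mono2)
  qed (use xy in auto)
  then show "dist (extinction_profile \<gamma> \<mu> q x) (extinction_profile \<gamma> \<mu> q y) \<le> 2 * \<gamma> * q powr (1 - \<mu>) * dist x y"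
    by (simp add: dist_norm)
qed (use \<gamma> in simp)

text \<open>Comparison with this solution turns the estimate for differences into a bound on the
  norm, as Lyapunov stability requires.\<close>

lemma (in perturbed_semigroup) weak_solution_zero:
  assumes "F 0 = 0"
  shows "weak_solution D G 0 (\<lambda>_. 0)"
  unfolding weak_solution_def
proof (intro conjI allI impI exI[of _ "\<lambda>_ _. 0"])
  show "in_L1 T (\<lambda>_. 0 :: 'h)" for T
    unfolding in_L1_def
    by (auto simp: L1_norm_def intro: strongly_measurable_AE_continuous[of "{}"])
  have ac: "abs_continuous_on K (\<lambda>_. 0 :: 'h)" for K
    by (rule lipschitz_on_imp_abs_continuous_on[of 0]) (rule lipschitz_onI, auto)
  show "strong_solution D G (\<lambda>_. 0) T (\<lambda>_. 0)" for T
    unfolding strong_solution_def using assms generator_0 ac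
    by (auto simp: generator_dom_0 G_eq intro!: continuous_intros always_eventually)
qed (auto simp: L1_norm_def uniform_limit_const)

section \<open>Finite-time stabilisation\<close>

locale controlled_semigroup = quasi_contractive_semigroup D A S \<omega>
  for D :: "'h::{real_inner, complete_space} set" and A S \<omega> +
  fixes L :: "'u::{real_inner, complete_space} \<Rightarrow> 'h" and \<phi> :: "'h \<Rightarrow> real" and \<Upsilon> :: "'h \<Rightarrow> 'h"
    and C \<gamma> \<delta> \<mu> :: real
  assumes L: "bounded_linear L"
    and invariant: "0 \<le> t \<Longrightarrow> x \<in> (unobservable S L)\<^sup>\<bottom> \<Longrightarrow> S t x \<in> (unobservable S L)\<^sup>\<bottom>"
    and \<phi>: "x \<in> (unobservable S L)\<^sup>\<bottom> \<Longrightarrow> x \<in> D \<Longrightarrow>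
      A x \<bullet> L (adjoint L x) \<le> \<phi> x * (norm (L (adjoint L x)))\<^sup>2"
    and \<Upsilon>: "x \<in> (unobservable S L)\<^sup>\<bottom> \<Longrightarrow> x \<in> D \<Longrightarrow> \<Upsilon> x = \<phi> x *\<^sub>R L (adjoint L x)"
    and \<Upsilon>_lipschitz: "C-lipschitz_on ((unobservable S L)\<^sup>\<bottom>) \<Upsilon>"
    and \<gamma>: "0 < \<gamma>" "x \<in> (unobservable S L)\<^sup>\<bottom> \<Longrightarrow> \<gamma> * (L (adjoint L x) \<bullet> x) \<le> (norm (L (adjoint L x)))\<^sup>2"
    and \<delta>: "0 \<le> \<delta>" "\<delta> \<le> t \<Longrightarrow> x \<in> unobservable S L \<Longrightarrow> S t x = 0"
    and \<mu>: "0 < \<mu>" "\<mu> < 1/2"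
begin

abbreviation "L' \<equiv> adjoint L"
abbreviation "W \<equiv> unobservable S L"
abbreviation "P \<equiv> orthogonal_projection (W\<^sup>\<bottom>)"
abbreviation "Q \<equiv> orthogonal_projection W"

sublocale L: bounded_linear L by (rule L)
sublocale L': bounded_linear L' by (rule bounded_linear_adjoint[OF L])

lemma subspace_W: "subspace W"
  by (auto simp: unobservable_def subspace_def S_zero S_plus S_scaleR L'.zero L'.add L'.scaleR)

lemma closed_W: "closed W"
proof -
  have "W = (\<Inter>t\<in>{0..}. {x. L' (S t x) = 0})" by (auto simp: unobservable_def)
  then show ?thesis
    by (auto intro!: closed_INT closed_Collect_eq L'.continuous_on continuous_on_const
        bounded_linear.continuous_on[OF bounded_linear_S] continuous_on_id)
qed

lemma L'_W: "x \<in> W \<Longrightarrow> L' x = 0"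
  by (force simp: unobservable_def dest: spec[of _ 0])

lemma S_W: "0 \<le> t \<Longrightarrow> x \<in> W \<Longrightarrow> S t x \<in> W"
  by (auto simp: unobservable_def simp flip: S_add)

lemma L_orth_W: "L u \<in> W\<^sup>\<bottom>"
  by (auto simp: orthogonal_comp_def orthogonal_def L'_W inner_adjoint[OF L] inner_commute[of _ "L u"])

lemmas orth_W = subspace_orthogonal_comp[of W] closed_orthogonal_comp[of W]

lemma P_mem: "P x \<in> W\<^sup>\<bottom>"
  by (rule orthogonal_projection_mem[OF orth_W])

lemma P_diff: "x - P x \<in> W"
  using orthogonal_projection_diff[OF orth_W, of x] orthogonal_comp_orthogonal_comp[OF subspace_W closed_W]
  by simp

lemma P_eqI: "p \<in> W\<^sup>\<bottom> \<Longrightarrow> x - p \<in> W \<Longrightarrow> P x = p"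
  using orthogonal_projection_eqI[OF orth_W] orthogonal_comp_subset[of W] by blast

lemma Q_eq: "Q x = x - P x"
  using P_mem P_diff by (intro orthogonal_projection_eqI[OF subspace_W closed_W]) auto

sublocale P: bounded_linear P by (rule bounded_linear_orthogonal_projection[OF orth_W])

lemma norm_P_le: "norm (P x) \<le> norm x"
  by (rule norm_orthogonal_projection_le[OF orth_W])

lemma L'_P: "L' (P x) = L' x"
  using L'_W[OF P_diff[of x]] by (simp add: L'.diff)

text \<open>\<open>W\<close> is invariant by the semigroup law and its orthogonal complement by
  assumption, so \<open>S t\<close> respects the decomposition.\<close>

lemma P_S: "0 \<le> t \<Longrightarrow> P (S t x) = S t (P x)"
  using S_W[OF _ P_diff[of x]] by (intro P_eqI invariant P_mem) (simp_all add: S_diff)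

lemma
  assumes x: "x \<in> D"
  shows P_dom: "P x \<in> D" and A_P: "A (P x) = P (A x)"
proof -
  have "((\<lambda>h. P ((S h x - x) /\<^sub>R h)) \<longlongrightarrow> P (A x)) (at_right 0)"
    by (intro P.tendsto generator_lim x)
  moreover have "\<forall>\<^sub>F h in at_right 0. P ((S h x - x) /\<^sub>R h) = (S h (P x) - P x) /\<^sub>R h"
    by (rule eventually_at_right_less[THEN eventually_mono]) (simp add: P.scaleR P.diff P_S)
  ultimately have "((\<lambda>h. (S h (P x) - P x) /\<^sub>R h) \<longlongrightarrow> P (A x)) (at_right 0)"
    by (rule Lim_transform_eventually)
  then show "P x \<in> D" "A (P x) = P (A x)" by (rule generator_domI, rule generator_eqI)
qed

lemma Q_dom_A: "x \<in> D \<Longrightarrow> Q x \<in> D \<and> A (Q x) = Q (A x)"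
  by (simp add: Q_eq P_dom A_P generator_dom_diff generator_diff)

lemma inner_orth_P: "z \<in> W\<^sup>\<bottom> \<Longrightarrow> z \<bullet> P x = z \<bullet> x"
  using P_diff[of x] by (auto simp: orthogonal_comp_def orthogonal_def inner_diff_right inner_commute)

section \<open>The closed loop as a perturbed semigroup\<close>

definition F :: "'h \<Rightarrow> 'h" where
  "F y = L (truncated_sign (2 * \<mu>) 0 (L' y)) + \<Upsilon> (P y)"

definition G :: "'h \<Rightarrow> 'h" where
  "G = closed_loop A L (feedback L P \<phi> \<mu>)"

lemma \<Upsilon>_P_le: "norm (\<Upsilon> (P x) - \<Upsilon> (P y)) \<le> C * norm (x - y)"
proof -
  have "norm (\<Upsilon> (P x) - \<Upsilon> (P y)) \<le> C * norm (P x - P y)"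
    using lipschitz_onD[OF \<Upsilon>_lipschitz P_mem P_mem] by (simp add: dist_norm)
  also have "\<dots> \<le> C * norm (x - y)"
    using norm_P_le[of "x - y"] lipschitz_on_nonneg[OF \<Upsilon>_lipschitz]
    by (intro mult_left_mono) (auto simp: P.diff)
  finally show ?thesis .
qed

lemma \<Upsilon>_P_eq: "x \<in> D \<Longrightarrow> \<Upsilon> (P x) = \<phi> (P x) *\<^sub>R L (L' x)"
  using \<Upsilon>[OF P_mem P_dom] by (simp add: L'_P)

text \<open>Where the output vanishes the indicator switches the feedback off, and \<open>F\<close>
  agrees because \<open>truncated_sign\<close> at \<open>0\<close> and
  \<open>\<Upsilon> (P x)\<close> both vanish.\<close>

lemma closed_loop_eq: "x \<in> D \<Longrightarrow> G x = A x - F x"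
  by (cases "L' x = 0")
    (simp_all add: G_def closed_loop_def feedback_def F_def L'_P truncated_sign_def \<Upsilon>_P_eq
      L.zero linear_neg[OF L.linear_axioms] L.diff L.scaleR max_absorb1)

sublocale perturbed_semigroup D A S \<omega> F G C
proof
  show "0 \<le> C" using \<Upsilon>_lipschitz by (rule lipschitz_on_nonneg)
  show "G x = A x - F x" if "x \<in> D" for x using that by (rule closed_loop_eq)
  fix x y :: 'h
  have "(L (truncated_sign (2 * \<mu>) 0 (L' x)) - L (truncated_sign (2 * \<mu>) 0 (L' y))) \<bullet> (x - y)
      = (truncated_sign (2 * \<mu>) 0 (L' x) - truncated_sign (2 * \<mu>) 0 (L' y)) \<bullet> (L' x - L' y)"
    by (simp add: inner_adjoint[OF L] flip: L.diff L'.diff)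
  moreover have "\<dots> \<ge> 0" using \<mu> by (intro truncated_sign_monotone) auto
  moreover have "- (\<Upsilon> (P x) - \<Upsilon> (P y)) \<bullet> (x - y) \<le> C * norm (x - y) * norm (x - y)"
    using norm_cauchy_schwarz[of "- (\<Upsilon> (P x) - \<Upsilon> (P y))" "x - y"] \<Upsilon>_P_le[of x y]
    by (smt (verit, best) mult_right_mono norm_ge_zero norm_minus_cancel)
  ultimately show "- C * (norm (x - y))\<^sup>2 \<le> (F x - F y) \<bullet> (x - y)"
    by (simp add: F_def power2_eq_square inner_diff_left inner_add_left)
next
  fix \<epsilon> :: real assume \<epsilon>: "0 < \<epsilon>"
  obtain K where K: "0 < K" "\<And>u. norm (L u) \<le> norm u * K" using L.pos_bounded by blast
  obtain K' where K': "0 < K'" "\<And>x. norm (L' x) \<le> norm x * K'" using L'.pos_bounded by blast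
  \<comment> \<open>Solves \<open>2 * e powr (1 - 2 * \<mu>) * K = \<epsilon>\<close>, the exponent
    being positive because \<mu> < 1/2.\<close>
  define e where "e = (\<epsilon> / (2 * K)) powr (1 / (1 - 2 * \<mu>))"
  have e: "0 < e" using \<epsilon> K by (simp add: e_def)
  have "e powr (1 - 2 * \<mu>) = \<epsilon> / (2 * K)" using \<mu> \<epsilon> K by (simp add: e_def powr_powr)
  define F' where "F' y = L (truncated_sign (2 * \<mu>) e (L' y)) + \<Upsilon> (P y)" for y
  have "norm (F x - F' x) \<le> \<epsilon>" for x
  proof -
    have "F x - F' x = L (truncated_sign (2 * \<mu>) 0 (L' x) - truncated_sign (2 * \<mu>) e (L' x))"
      by (simp add: F_def F'_def L.diff)
    then have "norm (F x - F' x) \<le> norm (truncated_sign (2 * \<mu>) 0 (L' x) - truncated_sign (2 * \<mu>) e (L' x)) * K"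
      using K(2) by simp
    also have "\<dots> \<le> 2 * e powr (1 - 2 * \<mu>) * K"
      using K(1) \<mu> e by (intro mult_right_mono truncated_sign_approx) auto
    also have "\<dots> = \<epsilon>" using K(1) \<open>e powr (1 - 2 * \<mu>) = _\<close> by simp
    finally show ?thesis .
  qed
  moreover have "(2 / e powr (2 * \<mu>) * K' * K + C)-lipschitz_on UNIV F'"
  proof (rule lipschitz_onI)
    fix x y
    have "norm (L (truncated_sign (2 * \<mu>) e (L' x)) - L (truncated_sign (2 * \<mu>) e (L' y)))
        \<le> norm (truncated_sign (2 * \<mu>) e (L' x) - truncated_sign (2 * \<mu>) e (L' y)) * K"
      using K(2) by (simp flip: L.diff)
    also have "\<dots> \<le> (2 / e powr (2 * \<mu>) * norm (L' x - L' y)) * K"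
      using K(1) \<mu> e by (intro mult_right_mono truncated_sign_lipschitz) auto
    also have "\<dots> \<le> (2 / e powr (2 * \<mu>) * (norm (x - y) * K')) * K"
      using K(1) K'(2)[of "x - y"] by (intro mult_right_mono mult_left_mono) (auto simp: L'.diff)
    finally have 1: "norm (L (truncated_sign (2 * \<mu>) e (L' x)) - L (truncated_sign (2 * \<mu>) e (L' y)))
        \<le> 2 / e powr (2 * \<mu>) * K' * K * norm (x - y)" by (simp add: mult_ac)
    have "F' x - F' y = (L (truncated_sign (2 * \<mu>) e (L' x)) - L (truncated_sign (2 * \<mu>) e (L' y))) +
        (\<Upsilon> (P x) - \<Upsilon> (P y))" by (simp add: F'_def)
    then have "norm (F' x - F' y) \<le> norm (L (truncated_sign (2 * \<mu>) e (L' x)) - L (truncated_sign (2 * \<mu>) e (L' y))) +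
        norm (\<Upsilon> (P x) - \<Upsilon> (P y))" by (simp only: norm_triangle_ineq)
    then show "dist (F' x) (F' y) \<le> (2 / e powr (2 * \<mu>) * K' * K + C) * dist x y"
      using 1 \<Upsilon>_P_le[of x y] by (simp add: dist_norm distrib_right)
  qed (use K K' lipschitz_on_nonneg[OF \<Upsilon>_lipschitz] in auto)
  ultimately show "\<exists>F' \<Lambda>. \<Lambda>-lipschitz_on UNIV F' \<and> (\<forall>x. norm (F x - F' x) \<le> \<epsilon>)" by blast
qed

text \<open>The left side is half the derivative of \<open>(norm (L' z))\<^sup>2\<close> along the
  equation with forcing \<open>f\<close>. The forcing is kept linear, so that it integrates to a
  multiple of its L1 norm.\<close>

lemma output_energy_rate:
  assumes z: "z \<in> D" and Lz: "L' z \<noteq> 0"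
  shows "L' z \<bullet> L' (A z - F z + f) \<le>
    - \<gamma> * ((norm (L' z))\<^sup>2) powr (1 - \<mu>) + norm (L (L' z)) * norm f"
proof -
  let ?B = "L (L' z)" and ?r = "norm (L' z)"
  have r: "?r > 0" using Lz by simp
  \<comment> \<open>The bound by \<open>\<phi>\<close> is assumed on the orthogonal complement of
    \<open>W\<close>; since \<open>?B\<close> lies there, \<open>A z\<close> may be replaced by its
    projection \<open>A (P z)\<close>.\<close>
  have "A z \<bullet> ?B = A (P z) \<bullet> ?B"
    using inner_orth_P[OF L_orth_W, of "L' z" "A z"] by (simp add: A_P[OF z] inner_commute)
  also have "\<dots> \<le> \<phi> (P z) * (norm ?B)\<^sup>2" using \<phi>[OF P_mem P_dom[OF z]] by (simp add: L'_P)
  finally have A: "?B \<bullet> A z \<le> \<phi> (P z) * (norm ?B)\<^sup>2" by (simp add: inner_commute)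
  have F: "?B \<bullet> F z = (norm ?B)\<^sup>2 / ?r powr (2 * \<mu>) + \<phi> (P z) * (norm ?B)\<^sup>2"
    by (simp add: F_def \<Upsilon>_P_eq[OF z] truncated_sign_def L.scaleR inner_add_right
        power2_norm_eq_inner max_absorb1 divide_inverse mult.commute)
  have "\<gamma> * ?r\<^sup>2 \<le> (norm ?B)\<^sup>2"
    using \<gamma>(2)[OF P_mem[of z]] by (simp add: L'_P inner_adjoint[OF L] power2_norm_eq_inner)
  then have "\<gamma> * ?r\<^sup>2 / ?r powr (2 * \<mu>) \<le> (norm ?B)\<^sup>2 / ?r powr (2 * \<mu>)"
    by (intro divide_right_mono) auto
  moreover have "?r\<^sup>2 / ?r powr (2 * \<mu>) = (?r\<^sup>2) powr (1 - \<mu>)"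
    using r by (simp add: powr_diff powr_powr flip: powr_numeral)
  ultimately have B: "\<gamma> * (?r\<^sup>2) powr (1 - \<mu>) \<le> (norm ?B)\<^sup>2 / ?r powr (2 * \<mu>)"
    by (metis times_divide_eq_right)
  have "L' z \<bullet> L' (A z - F z + f) = ?B \<bullet> A z - ?B \<bullet> F z + ?B \<bullet> f"
    by (simp add: inner_adjoint[OF L, symmetric] inner_add_right inner_diff_right)
  then show ?thesis using A F B norm_cauchy_schwarz[of ?B f] by linarith
qed

text \<open>Passes to weak solutions because the forcing only contributes a multiple of its \<open>L1\<close> norm.\<close>

lemma output_le_extinction_profile:
  assumes y: "weak_solution D G y0 y" and t: "0 \<le> t"
  shows "(norm (L' (y t)))\<^sup>2 \<le> extinction_profile \<gamma> \<mu> ((norm (L' y0))\<^sup>2) t"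
proof -
  define T where "T = t + 1"
  have T: "0 < T" "t \<in> {0..T}" using t by (auto simp: T_def)
  define q0 where "q0 = (norm (L' y0))\<^sup>2"
  define p where "p = extinction_profile \<gamma> \<mu> q0"
  have \<mu>1: "0 < \<mu>" "\<mu> < 1" using \<mu> by auto
  have q0: "0 \<le> q0" by (simp add: q0_def)
  note profile = \<mu>1 \<gamma>(1) q0
  obtain Y f where Y: "\<And>n::nat. in_L1 T (f n)" "\<And>n. strong_solution D G (f n) T (Y n)"
    "(\<lambda>n. L1_norm T (f n)) \<longlonglongrightarrow> 0" "uniform_limit {0..T} Y y sequentially"
    using weak_solutionE[OF y T(1)] by metis
  have "continuous_on {0..T} y"
    using y by (auto simp: weak_solution_def intro: continuous_on_subset)
  then have "bounded (y ` {0..T})" by (intro compact_imp_bounded compact_continuous_image) auto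
  then obtain M0 where "\<forall>x\<in>y ` {0..T}. norm x \<le> M0" unfolding bounded_iff by blast
  then have M0: "norm (y r) \<le> M0" if "r \<in> {0..T}" for r using that by blast
  \<comment> \<open>A common bound for the approximations turns
    \<open>norm (L (L' z)) * norm f\<close> into a multiple of \<open>norm f\<close>; the extra
    \<open>1\<close> absorbs their uniform distance to \<open>y\<close>.\<close>
  define M where "M = M0 + 1"
  have M: "M \<ge> 0" using order_trans[OF norm_ge_zero M0[of 0]] T by (simp add: M_def)
  have "\<forall>\<^sub>F n in sequentially. \<forall>r\<in>{0..T}. dist (Y n r) (y r) < 1"
    by (rule uniform_limitD[OF Y(4)]) simp
  then have Y_bdd: "\<forall>\<^sub>F n in sequentially. \<forall>r\<in>{0..T}. norm (Y n r) \<le> M"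
  proof eventually_elim
    case (elim n)
    show ?case
    proof
      fix r assume r: "r \<in> {0..T}"
      then have "norm (Y n r - y r) < 1" using elim by (simp add: dist_norm)
      then show "norm (Y n r) \<le> M"
        using M0[OF r] norm_triangle_ineq2[of "Y n r" "y r"] by (simp add: M_def)
    qed
  qed
  obtain K where K: "0 < K" "\<And>x. norm (L (L' x)) \<le> norm x * K"
    using bounded_linear.pos_bounded[OF bounded_linear_compose[OF L L'.bounded_linear_axioms]]
    by (auto simp: o_def)
  obtain K' where K': "0 < K'" "\<And>x. norm (L' x) \<le> norm x * K'" using L'.pos_bounded by blast
  define u where "u n r = (norm (L' (Y n r)))\<^sup>2 - p r" for n r
  have bound: "ennreal (u n t) \<le> ennreal (u n 0) + ennreal (2 * (M * K)) * L1_norm T (f n)"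
    if n: "\<forall>r\<in>{0..T}. norm (Y n r) \<le> M" for n
  proof -
    obtain N where N: "continuous_on {0..T} (Y n)"
      "\<And>s t. 0 < s \<Longrightarrow> s \<le> t \<Longrightarrow> t < T \<Longrightarrow> abs_continuous_on {s..t} (Y n)" "negligible N"
      "\<And>t. t \<in> {0<..<T} - N \<Longrightarrow> Y n t \<in> D \<and> (Y n has_vector_derivative A (Y n t) - F (Y n t) + f n t) (at t)"
      using strong_solutionE[OF Y(2)] by metis
    have "ennreal (u n t) \<le> ennreal (u n 0) + (\<integral>\<^sup>+r. ennreal (2 * (M * K) * norm (f n r)) \<partial>lebesgue_on {0..T})"
    proof (rule abs_continuous_growth[OF _ _ N(3) _ _ T(2)])
      have "continuous_on {0..T} p"
        unfolding p_def using lipschitz_on_continuous_on[OF extinction_profile_lipschitz[OF profile]]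
        by (rule continuous_on_subset) auto
      then show "continuous_on {0..T} (u n)"
        unfolding u_def by (intro continuous_intros L'.continuous_on N(1))
    next
      fix a b assume ab: "0 < a" "a \<le> b" "b < T"
      show "abs_continuous_on {a..b} (u n)"
      proof (rule abs_continuous_onI_dist[OF N(2)[OF ab] abs_continuous_on_ident,
            of "2 * (M * K') * K'" "2 * \<gamma> * q0 powr (1 - \<mu>)"])
        fix r s assume rs: "r \<in> {a..b}" "s \<in> {a..b}"
        have L'_le: "norm (L' (Y n r)) \<le> M * K'" if "r \<in> {a..b}" for r
          using K'(2)[of "Y n r"] n that ab K'(1)
          by (meson atLeastAtMost_iff less_imp_le mult_right_mono order_trans)
        have "\<bar>(norm (L' (Y n r)))\<^sup>2 - (norm (L' (Y n s)))\<^sup>2\<bar>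
            = (norm (L' (Y n r)) + norm (L' (Y n s))) * \<bar>norm (L' (Y n r)) - norm (L' (Y n s))\<bar>"
          by (simp add: power2_eq_square square_diff_square_factored abs_mult)
        also have "\<dots> \<le> (M * K' + M * K') * (norm (Y n r - Y n s) * K')"
        proof (intro mult_mono add_mono L'_le rs)
          have "\<bar>norm (L' (Y n r)) - norm (L' (Y n s))\<bar> \<le> norm (L' (Y n r - Y n s))"
            unfolding L'.diff by (rule norm_triangle_ineq3)
          also have "\<dots> \<le> norm (Y n r - Y n s) * K'" by (rule K')
          finally show "\<bar>norm (L' (Y n r)) - norm (L' (Y n s))\<bar> \<le> norm (Y n r - Y n s) * K'" .
        qed (use M K'(1) in auto)
        finally have 1: "\<bar>(norm (L' (Y n r)))\<^sup>2 - (norm (L' (Y n s)))\<^sup>2\<bar> \<le> 2 * (M * K') * K' * dist (Y n r) (Y n s)"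
          by (simp add: dist_norm mult_ac)
        have "dist (p r) (p s) \<le> 2 * \<gamma> * q0 powr (1 - \<mu>) * dist r s"
          unfolding p_def using rs ab by (intro lipschitz_onD[OF extinction_profile_lipschitz[OF profile]]) auto
        then show "dist (u n r) (u n s) \<le> 2 * (M * K') * K' * dist (Y n r) (Y n s) + 2 * \<gamma> * q0 powr (1 - \<mu>) * dist r s"
          using 1 by (simp add: u_def dist_real_def)
      qed (use M K'(1) \<gamma>(1) in auto)
    next
      fix r assume r: "r \<in> {0<..<T} - N" and pos: "u n r > 0"
      define z where "z = Y n r"
      have z: "z \<in> D" "(Y n has_vector_derivative A z - F z + f n r) (at r)"
        using N(4)[OF r] by (auto simp: z_def)
      have p0: "0 \<le> p r" unfolding p_def by (rule extinction_profile_nonneg[OF profile])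
      \<comment> \<open>A rate is needed only where the energy exceeds the profile. There the output
        is nonzero, as \<open>output_energy_rate\<close> demands, and monotonicity of
        \<open>powr (1 - \<mu>)\<close> makes the energy decay at least as fast as the profile, up
        to the forcing.\<close>
      have qp: "p r < (norm (L' z))\<^sup>2" using pos by (simp add: u_def z_def)
      then have Lz: "L' z \<noteq> 0" using p0 by auto
      have "((\<lambda>r. L' (Y n r)) has_derivative (\<lambda>h. h *\<^sub>R L' (A z - F z + f n r))) (at r)"
        using L'.has_vector_derivative[OF z(2)] by (simp add: has_vector_derivative_def)
      from has_derivative_inner[OF this this]
      have "((\<lambda>r. (norm (L' (Y n r)))\<^sup>2) has_real_derivative 2 * (L' z \<bullet> L' (A z - F z + f n r))) (at r)"
        unfolding has_field_derivative_def power2_norm_eq_inner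
        by (rule has_derivative_eq_rhs) (auto simp: z_def inner_commute algebra_simps)
      then have "(u n has_real_derivative 2 * (L' z \<bullet> L' (A z - F z + f n r)) - - (2 * \<gamma> * p r powr (1 - \<mu>))) (at r)"
        unfolding u_def p_def by (intro DERIV_diff extinction_profile_deriv[OF profile])
      moreover have "2 * (L' z \<bullet> L' (A z - F z + f n r)) - - (2 * \<gamma> * p r powr (1 - \<mu>)) \<le> 2 * (M * K) * norm (f n r)"
      proof -
        have "p r powr (1 - \<mu>) \<le> ((norm (L' z))\<^sup>2) powr (1 - \<mu>)"
          using qp p0 \<mu>1 by (intro powr_mono2) auto
        then have 1: "\<gamma> * p r powr (1 - \<mu>) \<le> \<gamma> * ((norm (L' z))\<^sup>2) powr (1 - \<mu>)"
          using \<gamma>(1) by (intro mult_left_mono) auto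
        have "norm (L (L' z)) \<le> norm z * K" by (rule K)
        also have "\<dots> \<le> M * K" using n r K(1) by (intro mult_right_mono) (auto simp: z_def)
        finally have "norm (L (L' z)) * norm (f n r) \<le> M * K * norm (f n r)"
          by (intro mult_right_mono) auto
        then show ?thesis using output_energy_rate[OF z(1) Lz, of "f n r"] 1 by linarith
      qed
      ultimately show "\<exists>d\<le>2 * (M * K) * norm (f n r). (u n has_real_derivative d) (at r)" by blast
    qed (use M K(1) in auto)
    also have "(\<integral>\<^sup>+r. ennreal (2 * (M * K) * norm (f n r)) \<partial>lebesgue_on {0..T}) \<le> ennreal (2 * (M * K)) * L1_norm T (f n)"
      using nn_integral_affine_L1_le[OF Y(1), of 0 T "2 * (M * K)" 0] T M K(1) by simp
    finally show ?thesis by simp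
  qed
  have lim: "(\<lambda>n. ennreal (u n r)) \<longlonglongrightarrow> ennreal ((norm (L' (y r)))\<^sup>2 - p r)" if "r \<in> {0..T}" for r
    unfolding u_def
    by (intro tendsto_ennrealI tendsto_intros L'.tendsto tendsto_uniform_limitI[OF Y(4) that])
  have "ennreal ((norm (L' (y t)))\<^sup>2 - p t) \<le> ennreal ((norm (L' (y 0)))\<^sup>2 - p 0) + ennreal (2 * (M * K)) * 0"
  proof (rule tendsto_le[OF sequentially_bot])
    show "(\<lambda>n. ennreal (u n 0) + ennreal (2 * (M * K)) * L1_norm T (f n))
        \<longlonglongrightarrow> ennreal ((norm (L' (y 0)))\<^sup>2 - p 0) + ennreal (2 * (M * K)) * 0"
      using T by (intro tendsto_add lim ennreal_tendsto_cmult Y) auto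
    show "(\<lambda>n. ennreal (u n t)) \<longlonglongrightarrow> ennreal ((norm (L' (y t)))\<^sup>2 - p t)" by (rule lim) (rule T)
    show "\<forall>\<^sub>F n in sequentially. ennreal (u n t) \<le> ennreal (u n 0) + ennreal (2 * (M * K)) * L1_norm T (f n)"
      using Y_bdd by eventually_elim (rule bound)
  qed
  moreover have "p 0 = q0" unfolding p_def by (rule extinction_profile_0[OF profile])
  moreover have "y 0 = y0" using y by (simp add: weak_solution_def)
  ultimately have "ennreal ((norm (L' (y t)))\<^sup>2 - p t) \<le> 0" by (simp add: q0_def)
  then have "(norm (L' (y t)))\<^sup>2 - p t \<le> 0" by (simp add: ennreal_eq_0_iff)
  then show ?thesis by (simp add: p_def q0_def)
qed

text \<open>A time from which the profile starting at \<open>(norm (L' y0))\<^sup>2\<close> is zero.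
  As \<open>L'\<close> does not see the component in \<open>W\<close>, the value is the same for
  \<open>P y0\<close>.\<close>

definition extinction_time :: "'h \<Rightarrow> real" where
  "extinction_time y0 = norm (L' y0) powr (2 * \<mu>) / (2 * \<gamma> * \<mu>)"

lemma extinction_time_nonneg: "0 \<le> extinction_time y0"
  using \<gamma>(1) \<mu> by (simp add: extinction_time_def)

lemma output_extinct:
  assumes y: "weak_solution D G y0 y" and t: "extinction_time y0 \<le> t"
  shows "L' (y t) = 0"
proof -
  have "((norm (L' y0))\<^sup>2) powr \<mu> = norm (L' y0) powr (2 * \<mu>)"
    by (cases "L' y0 = 0") (simp_all add: powr_powr flip: powr_numeral)
  then have "(norm (L' (y t)))\<^sup>2 \<le> 0"
    using output_le_extinction_profile[OF y, of t] extinction_profile_eq_0[of \<mu> \<gamma> "(norm (L' y0))\<^sup>2" t]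
      t extinction_time_nonneg[of y0] \<mu> \<gamma>(1)
    by (simp add: extinction_time_def)
  then show ?thesis by simp
qed

text \<open>\<open>\<Upsilon>\<close> vanishes on \<open>D \<inter> ker L'\<close>, but \<open>ker L'\<close> need not be the closure of this set.  However, the
  time averages of the solution after extinction of the output lie in \<open>D \<inter> ker L'\<close>.\<close>

lemma F_extinct:
  assumes y: "weak_solution D G y0 y" and t: "extinction_time y0 \<le> t"
  shows "F (y t) = 0"
proof -
  have t0: "0 \<le> t" using extinction_time_nonneg[of y0] t by linarith
  have "continuous_on {0..} y" using y by (simp add: weak_solution_def)
  from ex_antiderivative_atLeast[OF this] obtain I where
    I: "\<And>s. 0 \<le> s \<Longrightarrow> (I has_vector_derivative y s) (at s)" by blast
  have "\<Upsilon> (P ((I (t + h) - I t) /\<^sub>R h)) = 0" if h: "0 < h" for h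
  proof -
    let ?u = "(I (t + h) - I t) /\<^sub>R h"
    have u: "?u \<in> D"
      using t0 h by (intro generator_dom_scaleR weak_solution_integral_in_dom[OF y] I) auto
    \<comment> \<open>The output is zero on the whole interval, so \<open>L' (I s)\<close> has zero
      derivative there.\<close>
    have "L' (I (t + h)) = L' (I t)"
    proof (rule has_vector_derivative_zero_const)
      fix s assume s: "s \<in> {t..t+h}"
      then show "((\<lambda>s. L' (I s)) has_vector_derivative 0) (at s)"
        using L'.has_vector_derivative[OF I[of s]] output_extinct[OF y, of s] t t0 by simp
    qed (use h in simp)
    then have "L' ?u = 0" by (simp add: L'.scaleR L'.diff)
    then show ?thesis by (simp add: \<Upsilon>_P_eq[OF u] L.zero)
  qed
  then have "\<forall>\<^sub>F h in at_right 0. \<Upsilon> (P ((I (t + h) - I t) /\<^sub>R h)) = 0"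
    by (intro eventually_at_right_less[THEN eventually_mono])
  then have "((\<lambda>h. \<Upsilon> (P ((I (t + h) - I t) /\<^sub>R h))) \<longlongrightarrow> 0) (at_right 0)"
    by (rule tendsto_eventually)
  moreover have "((\<lambda>h. \<Upsilon> (P ((I (t + h) - I t) /\<^sub>R h))) \<longlongrightarrow> \<Upsilon> (P (y t))) (at_right 0)"
  proof (rule LIM_zero_cancel, rule Lim_null_comparison)
    show "\<forall>\<^sub>F h in at_right 0. norm (\<Upsilon> (P ((I (t + h) - I t) /\<^sub>R h)) - \<Upsilon> (P (y t)))
        \<le> C * norm ((I (t + h) - I t) /\<^sub>R h - y t)"
      by (intro always_eventually allI \<Upsilon>_P_le)
    have "((\<lambda>h. C * norm ((I (t + h) - I t) /\<^sub>R h - y t)) \<longlongrightarrow> C * norm (y t - y t)) (at_right 0)"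
      by (intro tendsto_intros has_vector_derivative_right_quotient I t0)
    then show "((\<lambda>h. C * norm ((I (t + h) - I t) /\<^sub>R h - y t)) \<longlongrightarrow> 0) (at_right 0)" by simp
  qed
  ultimately have "0 = \<Upsilon> (P (y t))" by (rule tendsto_unique[OF trivial_limit_at_right_real])
  then show ?thesis by (simp add: F_def output_extinct[OF y t] truncated_sign_def L.zero)
qed

lemma J_zero: "0 \<le> s \<Longrightarrow> J s 0 = 0"
  using J_scaleR[of s 0 0] by simp

lemma solution_in_W:
  assumes y: "weak_solution D G y0 y" and t: "extinction_time y0 \<le> t"
  shows "y t \<in> W"
proof -
  have t0: "0 \<le> t" using extinction_time_nonneg[of y0] t by linarith
  have "L' (S s (y t)) = 0" if s: "0 \<le> s" for s
  proof -
    \<comment> \<open>With \<open>F\<close> zero along the solution the consistency error is zero,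
      so a step of any length is exact.\<close>
    have "norm (y (t + s) - S s (y t) - J s 0) \<le> exp (\<omega> * s) * (0 * s)"
      using F_extinct[OF y] t by (intro weak_solution_step[OF y t0 s bounded_linear_ident]) auto
    then have "S s (y t) = y (t + s)" using s by (simp add: J_zero)
    then show ?thesis using output_extinct[OF y, of "t + s"] t s by simp
  qed
  then show ?thesis by (simp add: unobservable_def)
qed

text \<open>On \<open>D\<close> both parts of \<open>F\<close> lie in the range of \<open>L\<close>,
  which is orthogonal to \<open>W\<close>; density of \<open>D\<close>, continuity of
  \<open>F\<close> and closedness of the complement extend this to all points.\<close>

lemma Q_F: "Q (F x) = 0"
proof -
  have Q_orth: "Q z = 0" if "z \<in> W\<^sup>\<bottom>" for z
    using P_eqI[of z z] that subspace_0[OF subspace_W] by (simp add: Q_eq)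
  have F_orth: "F d \<in> W\<^sup>\<bottom>" if "d \<in> D" for d
    unfolding F_def \<Upsilon>_P_eq[OF that] by (intro subspace_add subspace_scale orth_W L_orth_W)
  obtain d where d: "\<And>n. d n \<in> D" "d \<longlonglongrightarrow> x" using generator_dom_seq by metis
  have "(\<lambda>n. F (d n)) \<longlonglongrightarrow> F x"
    using continuous_on_F by (intro isCont_tendsto_compose[OF _ d(2)]) (simp add: continuous_on_eq_continuous_at)
  then have "F x \<in> W\<^sup>\<bottom>"
    by (rule closed_sequentially[OF closed_orthogonal_comp _ _, rotated]) (rule F_orth[OF d(1)])
  then show ?thesis by (rule Q_orth)
qed

lemma Q_solution:
  assumes y: "weak_solution D G y0 y" and t: "0 \<le> t"
  shows "Q (y t) = S t (Q y0)"
proof -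
  have "norm (Q (y (0 + t)) - S t (Q (y 0)) - J t 0) \<le> exp (\<omega> * t) * (0 * t)"
    by (rule weak_solution_step[OF y order_refl t])
      (auto simp: Q_F Q_dom_A bounded_linear_orthogonal_projection[OF subspace_W closed_W]
        norm_orthogonal_projection_le[OF subspace_W closed_W])
  then show ?thesis using y t by (simp add: J_zero weak_solution_def)
qed

lemma solution_extinct:
  assumes y: "weak_solution D G y0 y" and t: "max \<delta> (extinction_time y0) \<le> t"
  shows "y t = 0"
proof -
  have "y t \<in> W" using solution_in_W[OF y] t by simp
  then have "P (y t) = 0" by (intro P_eqI subspace_0 orth_W) simp
  then have "y t = Q (y t)" by (simp add: Q_eq)
  also have "\<dots> = S t (Q y0)" using t \<delta>(1) by (intro Q_solution[OF y]) auto
  also have "\<dots> = 0"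
    using t by (intro \<delta>(2) orthogonal_projection_mem[OF subspace_W closed_W]) auto
  finally show ?thesis .
qed

lemma F_0: "F 0 = 0"
  using \<Upsilon>_P_eq[OF generator_dom_0]
  by (simp add: F_def truncated_sign_def L.zero L'.zero P.zero)

text \<open>The extinction time is bounded on the unit ball. Up to a time \<open>T\<close> beyond
  this bound and \<delta>, the distance to the zero solution is estimated; after \<open>T\<close>
  the solution is zero.\<close>

lemma stable: "lyapunov_stable D G"
  unfolding lyapunov_stable_def
proof (intro allI impI)
  fix \<epsilon> :: real assume \<epsilon>: "0 < \<epsilon>"
  obtain K' where K': "0 < K'" "\<And>x. norm (L' x) \<le> norm x * K'" using L'.pos_bounded by blast
  define T where "T = max \<delta> (K' powr (2 * \<mu>) / (2 * \<gamma> * \<mu>)) + 1"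
  have T: "0 < T" using \<delta>(1) by (simp add: T_def)
  define M where "M = exp ((\<omega> + C) * T)"
  have M: "0 < M" by (simp add: M_def)
  have "norm (y t) < \<epsilon>"
    if y0: "norm y0 < min 1 (\<epsilon> / M)" and y: "weak_solution D G y0 y" and t: "0 \<le> t" for y0 y t
  proof (cases "t \<le> T")
    case True
    have "norm (y t) \<le> M * norm y0"
      using weak_solution_diff_le[OF y weak_solution_zero[OF F_0] t True T] by (simp add: M_def)
    also have "\<dots> < \<epsilon>" using y0 M by (simp add: field_simps)
    finally show ?thesis .
  next
    case False
    have "norm y0 * K' \<le> 1 * K'" using y0 K'(1) by (intro mult_right_mono) auto
    then have "norm (L' y0) \<le> K'" using K'(2)[of y0] by simp
    then have "norm (L' y0) powr (2 * \<mu>) \<le> K' powr (2 * \<mu>)" using \<mu> by (intro powr_mono2) auto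
    then have "extinction_time y0 \<le> K' powr (2 * \<mu>) / (2 * \<gamma> * \<mu>)"
      unfolding extinction_time_def using \<gamma>(1) \<mu> by (intro divide_right_mono) auto
    then have "y t = 0" using False by (intro solution_extinct[OF y]) (auto simp: T_def)
    then show ?thesis using \<epsilon> by simp
  qed
  then show "\<exists>\<eta>>0. \<forall>y0 y. norm y0 < \<eta> \<and> weak_solution D G y0 y \<longrightarrow> (\<forall>t\<ge>0. norm (y t) < \<epsilon>)"
    using \<epsilon> M by (intro exI[of _ "min 1 (\<epsilon> / M)"]) auto
qed

theorem finite_time_stable: "globally_finite_time_stable D G"
  unfolding globally_finite_time_stable_def
proof (intro conjI allI well_posed stable)
  fix y0
  show "\<exists>T\<ge>0. \<forall>y. weak_solution D G y0 y \<longrightarrow> (\<forall>t\<ge>T. y t = 0)"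
    using solution_extinct[of y0] \<delta>(1) by (intro exI[of _ "max \<delta> (extinction_time y0)"]) auto
qed

theorem settling_time_le:
  assumes "weak_solution D G y0 y"
  shows "settling_time y \<le> max \<delta> (extinction_time y0)"
  unfolding settling_time_def
proof (rule cInf_lower)
  show "max \<delta> (extinction_time y0) \<in> {T. 0 \<le> T \<and> (\<forall>t\<ge>T. y t = 0)}"
    using solution_extinct[OF assms] \<delta>(1) by auto
  show "bdd_below {T. 0 \<le> T \<and> (\<forall>t\<ge>T. y t = 0)}" by (rule bdd_belowI[of _ 0]) auto
qed

end

theorem theorem4p1:
  fixes D :: "'h::{real_inner, complete_space} set"
    and A :: "'h \<Rightarrow> 'h"
    and S :: "real \<Rightarrow> 'h \<Rightarrow> 'h"
    and L :: "'u::{real_inner, complete_space} \<Rightarrow> 'h"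
    and B P :: "'h \<Rightarrow> 'h"
    and W :: "'h set"
    and \<phi> :: "'h \<Rightarrow> real"
    and \<gamma> \<delta> \<mu> :: real
    and G :: "'h \<Rightarrow> 'h"
  assumes gen: "generates D A S" and qc: "quasi_contractive D A"
    and L: "bounded_linear L"
    and B_def: "B = L \<circ> adjoint L"
    and W_def: "W = unobservable S L"
    and P_def: "P = orthogonal_projection (W\<^sup>\<bottom>)"
    and i: "\<forall>t\<ge>0. \<forall>x\<in>W\<^sup>\<bottom>. S t x \<in> W\<^sup>\<bottom>"
    and ii: "\<forall>y\<in>W\<^sup>\<bottom> \<inter> D. 0 \<le> \<phi> y"
      "\<forall>y\<in>W\<^sup>\<bottom> \<inter> D. A y \<bullet> B y \<le> \<phi> y * (norm (B y))\<^sup>2"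
      "\<exists>\<Upsilon> :: 'h \<Rightarrow> 'h. (\<forall>y\<in>W\<^sup>\<bottom> \<inter> D. \<Upsilon> y = \<phi> y *\<^sub>R B y) \<and>
         (\<exists>C. C-lipschitz_on (W\<^sup>\<bottom>) \<Upsilon>)"
    and iii: "\<gamma> > 0" "\<forall>x\<in>W\<^sup>\<bottom>. \<gamma> * (B x \<bullet> x) \<le> (norm (B x))\<^sup>2"
    and iv: "\<delta> \<ge> 0" "\<forall>t\<ge>\<delta>. \<forall>x\<in>W. S t x = 0"
    and mu: "0 < \<mu>" "\<mu> < 1/2"
    and G_def: "G = closed_loop A L (feedback L P \<phi> \<mu>)"
  shows "globally_finite_time_stable D G \<and>
    (\<forall>y0 y. weak_solution D G y0 y \<longrightarrow>
       settling_time y \<le> max \<delta> (norm (adjoint L (P y0)) powr (2 * \<mu>) / (2 * \<gamma> * \<mu>)))"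
proof -
  obtain \<omega> where \<omega>: "\<And>x. x \<in> D \<Longrightarrow> A x \<bullet> x \<le> \<omega> * (norm x)\<^sup>2"
    using qc by (auto simp: quasi_contractive_def)
  obtain \<Upsilon> C where \<Upsilon>: "\<And>y. y \<in> W\<^sup>\<bottom> \<Longrightarrow> y \<in> D \<Longrightarrow> \<Upsilon> y = \<phi> y *\<^sub>R B y" "C-lipschitz_on (W\<^sup>\<bottom>) \<Upsilon>"
    using ii(3) by blast
  interpret cs: controlled_semigroup D A S "max \<omega> 0" L \<phi> \<Upsilon> C \<gamma> \<delta> \<mu>
  proof (intro controlled_semigroup.intro quasi_contractive_semigroup.intro controlled_semigroup_axioms.intro)
    show "A x \<bullet> x \<le> max \<omega> 0 * (norm x)\<^sup>2" if "x \<in> D" for x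
      using \<omega>[OF that] by (rule order_trans) (auto intro: mult_right_mono)
  qed (use gen L i ii(2) \<Upsilon> iii iv mu in \<open>auto simp: W_def B_def\<close>)
  have G: "G = cs.G" by (simp add: G_def cs.G_def P_def W_def)
  \<comment> \<open>Matches the stated settling bound, expressed through \<open>P y0\<close>, with
    \<open>extinction_time y0\<close>.\<close>
  have P: "adjoint L (P y0) = adjoint L y0" for y0
    by (simp add: P_def W_def cs.L'_P)
  show ?thesis
    using cs.finite_time_stable cs.settling_time_le unfolding G P cs.extinction_time_def by blast
qed

end
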